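(* Let $(\xi_1,\eta_1),(\xi_2,\eta_2),\ldots$ be independent copies of an $\mathbb{R}^2$-valued random vector $(\xi,\eta)$ with arbitrarily dependent components, and let $S_0:=0$, $S_k:=\xi_1+\ldots+\xi_k$ for $k\in\mathbb{N}$. Assume that $\mu:=\mathbb{E}\xi\in(0,\infty)$, $\mathbb{E}\eta=0$ and $s^2:=\mathrm{Var}\,\eta\in(0,\infty)$. Then, as $b\to1-$, $$\Big((1-b^2)^{1/2}\sum_{k\geq 0}b^{uS_k}\eta_{k+1}\Big)_{u>0}\ \Rightarrow\ (2s^2\mu^{-1})^{1/2}\Big(\int_{[0,\infty)}e^{-uy}\,\mathrm{d}B(y)\Big)_{u>0}$$ in the $J_1$-topology on $D(0,\infty)$, where $(B(t))_{t\geq 0}$ is a standard Brownian motion.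
   Context: $D(0,\infty)$ is the Skorokhod space of right-continuous functions on $(0,\infty)$ with finite limits from the left at positive points, and $\Rightarrow$ denotes weak convergence in this function space. Here $b\in(0,1)$. The process $\big(\int_{[0,\infty)}e^{-uy}\,\mathrm{d}B(y)\big)_{u>0}$ is an almost surely continuous centered Gaussian process on $(0,\infty)$ with covariance $\frac{1}{u+v}$, $u,v>0$. Under the stated assumptions the series converge absolutely almost surely for all $b\in(0,1)$ and $u>0$. *)

theory Defs
  imports "HOL-Probability.Probability"
begin

section \<open>The Skorokhod space on the open half-line\<close>

definition cadlag :: "(real \<Rightarrow> real) \<Rightarrow> bool" where
  "cadlag f \<longleftrightarrow>
    (\<forall>t>0. continuous (at_right t) f \<and> (\<exists>l. (f \<longlongrightarrow> l) (at_left t)))"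

lemma cadlag_restrict: "cadlag f \<Longrightarrow> cadlag (restrict f {0<..})"
proof -
  assume f: "cadlag f"
  have "continuous (at_right t) (restrict f {0<..}) \<and>
      (\<exists>l. (restrict f {0<..} \<longlongrightarrow> l) (at_left t))" if t: "t > 0" for t :: real
  proof
    have "\<forall>\<^sub>F x in at_right t. f x = restrict f {0<..} x"
      using t by (auto simp: eventually_at_filter)
    moreover have "(f \<longlongrightarrow> f t) (at_right t)"
      using f t by (auto simp: cadlag_def continuous_within)
    ultimately show "continuous (at_right t) (restrict f {0<..})"
      using t by (auto simp: continuous_within intro: Lim_transform_eventually)
  next
    have "\<forall>\<^sub>F x in at_left t. f x = restrict f {0<..} x"
      using eventually_at_left_real[OF t] by eventually_elim auto
    moreover obtain l where "(f \<longlongrightarrow> l) (at_left t)"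
      using f t by (auto simp: cadlag_def)
    ultimately show "\<exists>l. (restrict f {0<..} \<longlongrightarrow> l) (at_left t)"
      by (blast intro: Lim_transform_eventually)
  qed
  then show ?thesis by (simp add: cadlag_def)
qed

lemma cadlag_zero: "cadlag (\<lambda>_. 0)"
  by (auto simp: cadlag_def)

text \<open>An element of \<open>D(0,\<infinity>)\<close> is a total function whose values outside \<open>(0,\<infinity>)\<close> are fixed
  to \<open>undefined\<close>, so that equality in the type is equality on \<open>(0,\<infinity>)\<close>.\<close>

typedef skorokhod = "{f :: real \<Rightarrow> real. cadlag f \<and> f \<in> extensional {0<..}}"
  morphisms skor_fun Abs_skor
  using cadlag_restrict[OF cadlag_zero] by auto

text \<open>An increasing bijection of \<open>(0,\<infinity>)\<close> is automatically a homeomorphism.\<close>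

definition time_change :: "(real \<Rightarrow> real) \<Rightarrow> bool" where
  "time_change l \<longleftrightarrow> strict_mono_on {0<..} l \<and> l ` {0<..} = {0<..}"

definition J1_nbhd :: "skorokhod \<Rightarrow> real \<Rightarrow> real \<Rightarrow> real \<Rightarrow> skorokhod set" where
  "J1_nbhd f a b e = {g. \<exists>l. time_change l \<and>
     (\<forall>t\<in>{a..b}. \<bar>l t - t\<bar> < e \<and> \<bar>skor_fun g (l t) - skor_fun f t\<bar> < e)}"

lemma J1_nbhd_mono:
  "a' \<le> a \<Longrightarrow> b \<le> b' \<Longrightarrow> e' \<le> e \<Longrightarrow> J1_nbhd f a' b' e' \<subseteq> J1_nbhd f a b e"
proof
  fix g assume *: "a' \<le> a" "b \<le> b'" "e' \<le> e" and "g \<in> J1_nbhd f a' b' e'"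
  then obtain l where "time_change l"
    and l: "\<And>t. t \<in> {a'..b'} \<Longrightarrow>
      \<bar>l t - t\<bar> < e' \<and> \<bar>skor_fun g (l t) - skor_fun f t\<bar> < e'"
    by (auto simp: J1_nbhd_def)
  moreover have "\<bar>l t - t\<bar> < e \<and> \<bar>skor_fun g (l t) - skor_fun f t\<bar> < e"
    if "t \<in> {a..b}" for t
    using l[of t] * that by auto
  ultimately show "g \<in> J1_nbhd f a b e"
    by (auto simp: J1_nbhd_def)
qed

text \<open>The \<open>J\<^sub>1\<close>-topology: a sequence \<open>g\<^sub>n\<close> converges to \<open>f\<close> iff there are time changes \<open>l\<^sub>n\<close> of
  \<open>(0,\<infinity>)\<close> such that \<open>l\<^sub>n(t) - t\<close> and \<open>g\<^sub>n(l\<^sub>n(t)) - f(t)\<close> tend to \<open>0\<close> uniformly on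
  every compact subset of \<open>(0,\<infinity>)\<close>.\<close>

instantiation skorokhod :: topological_space
begin

definition open_skorokhod :: "skorokhod set \<Rightarrow> bool" where
  "open_skorokhod U \<longleftrightarrow>
    (\<forall>f\<in>U. \<exists>a b e. 0 < a \<and> a < b \<and> 0 < e \<and> J1_nbhd f a b e \<subseteq> U)"

instance
proof
  show "open (UNIV :: skorokhod set)"
    unfolding open_skorokhod_def using zero_less_one less_add_one by blast
next
  fix U V :: "skorokhod set"
  assume U: "open U" and V: "open V"
  show "open (U \<inter> V)"
    unfolding open_skorokhod_def
  proof
    fix f assume "f \<in> U \<inter> V"
    then obtain a b e a' b' e' where
      1: "0 < a" "a < b" "0 < e" "J1_nbhd f a b e \<subseteq> U" and
      2: "0 < a'" "a' < b'" "0 < e'" "J1_nbhd f a' b' e' \<subseteq> V"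
      using U V unfolding open_skorokhod_def by (metis IntD1 IntD2)
    have "J1_nbhd f (min a a') (max b b') (min e e') \<subseteq> U \<inter> V"
      using J1_nbhd_mono[of "min a a'" a b "max b b'" "min e e'" e f]
        J1_nbhd_mono[of "min a a'" a' b' "max b b'" "min e e'" e' f] 1(4) 2(4) by auto
    moreover have "0 < min a a'" "min a a' < max b b'" "0 < min e e'"
      using 1 2 by auto
    ultimately show "\<exists>a b e. 0 < a \<and> a < b \<and> 0 < e \<and> J1_nbhd f a b e \<subseteq> U \<inter> V"
      by blast
  qed
next
  fix K :: "skorokhod set set"
  assume "\<forall>U\<in>K. open U"
  then show "open (\<Union>K)"
    unfolding open_skorokhod_def by (meson Union_upper UnionE order_trans)
qed

end


section \<open>Weak convergence of processes in the Skorokhod space\<close>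

definition weak_conv_along ::
  "('i \<Rightarrow> 'd::topological_space measure) \<Rightarrow> 'd measure \<Rightarrow> 'i filter \<Rightarrow> bool" where
  "weak_conv_along P Q F \<longleftrightarrow>
    (\<forall>\<phi> :: 'd \<Rightarrow> real. continuous_on UNIV \<phi> \<longrightarrow> bounded (range \<phi>) \<longrightarrow>
      ((\<lambda>i. \<integral>x. \<phi> x \<partial>P i) \<longlongrightarrow> (\<integral>x. \<phi> x \<partial>Q)) F)"

text \<open>A process \<open>X u \<omega>\<close> is assumed to have cadlag paths only almost surely. On the exceptional
  null set its path is replaced by the zero function; as this set need not be an event,
  measurability refers to the completed probability space.\<close>

definition skorokhod_path :: "(real \<Rightarrow> 'a \<Rightarrow> real) \<Rightarrow> 'a \<Rightarrow> skorokhod" where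
  "skorokhod_path X \<omega> = Abs_skor (restrict
     (if cadlag (\<lambda>u. X u \<omega>) then (\<lambda>u. X u \<omega>) else (\<lambda>_. 0)) {0<..})"

definition skorokhod_process :: "'a measure \<Rightarrow> (real \<Rightarrow> 'a \<Rightarrow> real) \<Rightarrow> bool" where
  "skorokhod_process M X \<longleftrightarrow>
    (AE \<omega> in M. cadlag (\<lambda>u. X u \<omega>)) \<and> skorokhod_path X \<in> completion M \<rightarrow>\<^sub>M borel"

definition path_law :: "'a measure \<Rightarrow> (real \<Rightarrow> 'a \<Rightarrow> real) \<Rightarrow> skorokhod measure" where
  "path_law M X = distr (completion M) borel (skorokhod_path X)"

definition J1_weak_conv ::
  "'a measure \<Rightarrow> ('i \<Rightarrow> real \<Rightarrow> 'a \<Rightarrow> real) \<Rightarrow> 'i filter \<Rightarrow>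
   'b measure \<Rightarrow> (real \<Rightarrow> 'b \<Rightarrow> real) \<Rightarrow> bool" where
  "J1_weak_conv M X F N Y \<longleftrightarrow>
    (\<forall>\<^sub>F i in F. skorokhod_process M (X i)) \<and> skorokhod_process N Y \<and>
    weak_conv_along (\<lambda>i. path_law M (X i)) (path_law N Y) F"


section \<open>Brownian motion and the Wiener integral\<close>

definition standard_brownian_motion :: "'b measure \<Rightarrow> (real \<Rightarrow> 'b \<Rightarrow> real) \<Rightarrow> bool" where
  "standard_brownian_motion N B \<longleftrightarrow>
    prob_space N \<and>
    (\<forall>t\<ge>0. B t \<in> borel_measurable N) \<and>
    (AE \<omega> in N. B 0 \<omega> = 0) \<and>
    (\<forall>(t :: nat \<Rightarrow> real) n. 0 \<le> t 0 \<longrightarrow> mono t \<longrightarrow>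
      prob_space.indep_vars N (\<lambda>_. borel) (\<lambda>i \<omega>. B (t (Suc i)) \<omega> - B (t i) \<omega>) {..<n}) \<and>
    (\<forall>r t. 0 \<le> r \<longrightarrow> r < t \<longrightarrow>
      distributed N lborel (\<lambda>\<omega>. B t \<omega> - B r \<omega>) (normal_density 0 (sqrt (t - r)))) \<and>
    (AE \<omega> in N. continuous_on {0..} (\<lambda>t. B t \<omega>))"

definition step_fun :: "nat \<Rightarrow> (nat \<Rightarrow> real) \<Rightarrow> (nat \<Rightarrow> real) \<Rightarrow> real \<Rightarrow> real" where
  "step_fun n c t y = (\<Sum>i<n. c i * indicator {t i<..t (Suc i)} y)"

definition step_integral ::
  "(real \<Rightarrow> 'b \<Rightarrow> real) \<Rightarrow> nat \<Rightarrow> (nat \<Rightarrow> real) \<Rightarrow> (nat \<Rightarrow> real) \<Rightarrow> 'b \<Rightarrow> real" where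
  "step_integral B n c t \<omega> = (\<Sum>i<n. c i * (B (t (Suc i)) \<omega> - B (t i) \<omega>))"

text \<open>\<open>I\<close> is a version of the Wiener integral of \<open>f\<close> over \<open>[0,\<infinity>)\<close> with respect to \<open>B\<close>, i.e. the
  \<open>L\<^sup>2\<close>-limit of the elementary integrals of step functions approximating \<open>f\<close> in
  \<open>L\<^sup>2[0,\<infinity>)\<close>. The \<open>L\<^sup>2\<close>-distances are nonnegative integrals, since the Bochner integral of
  a non-integrable function is zero.\<close>

definition is_wiener_integral ::
  "'b measure \<Rightarrow> (real \<Rightarrow> 'b \<Rightarrow> real) \<Rightarrow> (real \<Rightarrow> real) \<Rightarrow> ('b \<Rightarrow> real) \<Rightarrow> bool" where
  "is_wiener_integral N B f I \<longleftrightarrow>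
    f \<in> borel_measurable borel \<and> I \<in> borel_measurable N \<and>
    (\<exists>n c t. (\<forall>m. 0 \<le> t m 0 \<and> mono (t m)) \<and>
      (\<lambda>m. \<integral>\<^sup>+y\<in>{0..}. ennreal ((f y - step_fun (n m) (c m) (t m) y)\<^sup>2) \<partial>lborel)
        \<longlonglongrightarrow> 0 \<and>
      (\<lambda>m. \<integral>\<^sup>+\<omega>. ennreal ((I \<omega> - step_integral B (n m) (c m) (t m) \<omega>)\<^sup>2) \<partial>N)
        \<longlonglongrightarrow> 0)"


section \<open>The discounted series\<close>

definition random_walk :: "(nat \<Rightarrow> 'a \<Rightarrow> real) \<Rightarrow> nat \<Rightarrow> 'a \<Rightarrow> real" where
  "random_walk \<xi> k \<omega> = (\<Sum>i=1..k. \<xi> i \<omega>)"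

definition discounted_series ::
  "(nat \<Rightarrow> 'a \<Rightarrow> real) \<Rightarrow> (nat \<Rightarrow> 'a \<Rightarrow> real) \<Rightarrow> real \<Rightarrow> real \<Rightarrow> 'a \<Rightarrow> real" where
  "discounted_series \<xi> \<eta> b u \<omega> =
    (\<Sum>k. b powr (u * random_walk \<xi> k \<omega>) * \<eta> (k + 1) \<omega>)"

end

(*
  Both sides have continuous paths almost surely, so only locally uniform convergence matters. A
  bounded continuous functional is the increasing limit of functionals that are Lipschitz for a
  metric of locally uniform convergence; applied to the functional and to its negative, this
  reduces the claim to bounded Lipschitz functionals.

  Write b = exp (-d), so that d tends to 0 from above. By the law of large numbers the walk may be
  cut off below a line of slope mu / 2. The series is then a martingale with square integrable
  predictable weights, and so is its difference to the sum in which the weight exp (-u d S_k) is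
  replaced by exp (-u j / m) on the j-th block of about 1 / (m d mu) indices, for j < m^2. Second
  moments of increments in u together with Kolmogorov's chaining make this difference uniformly
  small on compact sets for large m and small d. The block sums are independent, and the central
  limit theorem sends them to the increments of B over the intervals (j / m, (j + 1) / m]. The same
  second moment bounds compare the resulting Riemann sums of Brownian increments with the Wiener
  integral, so the joint law of the latter never has to be computed.
*)
theory Submission
  imports Defs
begin

section \<open>Locally uniform convergence of paths\<close>

text \<open>As \<xi> and \<eta> of one pair may be dependent, conditioning on the whole walk would
  destroy the centering of \<eta>. What survives is that S_k uses the first k pairs only, whereas
  \<eta> with index k + 1 is independent of them. Moreover \<xi> may be negative with no more than a
  first moment, so the weights exp (- u * \<delta> * S_k) need not be integrable; the walk has to be
  cut off before any second moment is taken. With m * m blocks a single parameter refines the mesh 1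
  / m and extends the horizon m. The constant of the theorem is 1 - b^2 ~ 2 * \<delta> times the
  variance s^2 / (m * \<delta> * \<mu>) of a block sum: this is 2 * s^2 / \<mu> times the variance 1
  / m of a Brownian increment. On the side of the Skorokhod space one comparison suffices: around a
  continuous path every \<open>J1_nbhd\<close> contains, among continuous paths, a locally uniform
  ball. Functionals that are Lipschitz for \<open>path_dist\<close> are convenient because they
  depend measurably on countably many coordinates.\<close>

text \<open>The cap \<open>min u (1 / u)\<close> vanishes at both ends of \<open>(0,\<infinity>)\<close>, so that \<open>path_dist\<close>
  metrizes locally uniform convergence.\<close>

definition path_dist :: "(real \<Rightarrow> real) \<Rightarrow> (real \<Rightarrow> real) \<Rightarrow> real" where
  "path_dist f g = (SUP u\<in>{0<..}. min \<bar>f u - g u\<bar> (min u (1 / u)))"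

lemma min_inverse_le_one: "u > 0 \<Longrightarrow> min u (1 / u) \<le> (1::real)"
  by (auto simp: min_le_iff_disj)

lemma path_dist_upper: "u > 0 \<Longrightarrow> min \<bar>f u - g u\<bar> (min u (1 / u)) \<le> path_dist f g"
  unfolding path_dist_def
  by (rule cSUP_upper) (auto intro!: bdd_aboveI[where M=1] dest: min_inverse_le_one simp: min_le_iff_disj)

lemma path_dist_least:
  "(\<And>u. u > 0 \<Longrightarrow> min \<bar>f u - g u\<bar> (min u (1 / u)) \<le> c) \<Longrightarrow> path_dist f g \<le> c"
  unfolding path_dist_def by (rule cSUP_least) (auto intro: exI[of _ 1])

lemma path_dist_nonneg: "0 \<le> path_dist f g"
  using path_dist_upper[of 1 f g] by (auto simp: min_def split: if_splits)

lemma path_dist_self [simp]: "path_dist f f = 0"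
  by (rule antisym[OF path_dist_least path_dist_nonneg]) (auto simp: min_def)

lemma path_dist_commute: "path_dist f g = path_dist g f"
  by (simp add: path_dist_def abs_minus_commute)

text \<open>Truncation at a fixed positive level is nondecreasing and subadditive on nonnegative
  numbers.\<close>

lemma path_dist_triangle: "path_dist f h \<le> path_dist f g + path_dist g h"
proof (rule path_dist_least)
  fix u :: real assume u: "u > 0"
  have "0 < min u (1 / u)" using u by auto
  then have "min \<bar>f u - h u\<bar> (min u (1 / u)) \<le>
    min \<bar>f u - g u\<bar> (min u (1 / u)) + min \<bar>g u - h u\<bar> (min u (1 / u))"
    by (smt (verit))
  also have "\<dots> \<le> path_dist f g + path_dist g h"
    by (intro add_mono path_dist_upper u)
  finally show "min \<bar>f u - h u\<bar> (min u (1 / u)) \<le> path_dist f g + path_dist g h" .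
qed

text \<open>One number e sets both the window and the error: outside \<open>{e..1/e}\<close> the cap
  itself is at most e.\<close>

lemma path_dist_leI:
  assumes "e > 0" "\<And>u. u \<in> {e..1/e} \<Longrightarrow> \<bar>f u - g u\<bar> \<le> e"
  shows "path_dist f g \<le> e"
proof (rule path_dist_least)
  fix u :: real assume u: "u > 0"
  consider "u < e" | "u \<in> {e..1/e}" | "u > 1/e" by fastforce
  then show "min \<bar>f u - g u\<bar> (min u (1 / u)) \<le> e"
  proof cases
    case 3
    then have "1 / u \<le> e" using u assms(1) by (simp add: field_simps)
    then show ?thesis by auto
  qed (use assms(2)[of u] in auto)
qed

text \<open>On \<open>{a..c}\<close> the cap is at least \<open>min a (1 / c)\<close>; below that
  value the truncation in \<open>path_dist\<close> is inactive.\<close>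

lemma path_dist_imp_uniform:
  assumes "0 < a" "path_dist f g < min a (1 / c)" "u \<in> {a..c}"
  shows "\<bar>f u - g u\<bar> \<le> path_dist f g"
proof -
  have u: "u > 0" "1 / c \<le> 1 / u" using assms by (auto simp: frac_le)
  have "min a (1 / c) \<le> min u (1 / u)" using u(2) assms(3) by (auto simp: min_def)
  then show ?thesis using path_dist_upper[of u f g] u(1) assms(2) by linarith
qed

text \<open>A countable supremum is what measurability asks for. By continuity, a strict excess at u
  persists just to the right of u, where there is a rational.\<close>

lemma path_dist_rational:
  assumes f: "continuous_on {0<..} f" and g: "continuous_on {0<..} g"
  shows "path_dist f g = (SUP u\<in>\<rat> \<inter> {0<..}. min \<bar>f u - g u\<bar> (min u (1 / u)))"
    (is "_ = (SUP u\<in>?Q. ?F u)")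
proof (rule antisym)
  have bdd: "bdd_above (?F ` ?Q)"
    by (auto intro!: bdd_aboveI[where M=1] dest: min_inverse_le_one simp: min_le_iff_disj)
  show "path_dist f g \<le> (SUP u\<in>?Q. ?F u)"
  proof (rule path_dist_least, rule ccontr)
    fix u :: real assume u: "u > 0" and "\<not> ?F u \<le> (SUP u\<in>?Q. ?F u)"
    then have gt: "?F u > (SUP u\<in>?Q. ?F u)" by (simp only: not_le)
    have "continuous_on {0<..} ?F"
      by (intro continuous_intros f g) auto
    then have "open (?F -` {(SUP u\<in>?Q. ?F u)<..} \<inter> {0<..})"
      using continuous_on_open_vimage[OF open_greaterThan, of 0 ?F] open_greaterThan by blast
    moreover have "u \<in> ?F -` {(SUP u\<in>?Q. ?F u)<..} \<inter> {0<..}" using gt u by simp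
    ultimately obtain d where d: "d > 0" "\<And>y. dist y u < d \<Longrightarrow> y \<in> ?F -` {(SUP u\<in>?Q. ?F u)<..} \<inter> {0<..}"
      unfolding open_dist by blast
    obtain q where q: "q \<in> \<rat>" "u < q" "q < u + d"
      using Rats_dense_in_real[of u "u + d"] d(1) by auto
    then have q2: "?F q > (SUP u\<in>?Q. ?F u)" "q > 0" using d(2)[of q] by (auto simp: dist_real_def)
    have "?F q \<le> (SUP u\<in>?Q. ?F u)" by (rule cSUP_upper[OF _ bdd]) (use q q2 in auto)
    then show False using q2 by simp
  qed
  have "1 \<in> ?Q" by simp
  then show "(SUP u\<in>?Q. ?F u) \<le> path_dist f g"
    by (intro cSUP_least) (auto intro: path_dist_upper simp del: Int_iff)
qed

lemma borel_measurable_path_dist: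
  fixes X :: "real \<Rightarrow> 'a \<Rightarrow> real"
  assumes X: "\<And>u. u > 0 \<Longrightarrow> X u \<in> borel_measurable M"
    and c: "\<And>\<omega>. \<omega> \<in> space M \<Longrightarrow> continuous_on {0<..} (\<lambda>u. X u \<omega>)"
    and g: "continuous_on {0<..} g"
  shows "(\<lambda>\<omega>. path_dist (\<lambda>u. X u \<omega>) g) \<in> borel_measurable M"
proof -
  have "(\<lambda>\<omega>. SUP u\<in>\<rat> \<inter> {0<..}. min \<bar>X u \<omega> - g u\<bar> (min u (1 / u))) \<in> borel_measurable M"
  proof (rule borel_measurable_cSUP)
    show "countable (\<rat> \<inter> {0<..} :: real set)" using countable_rat by blast
    show "(\<lambda>\<omega>. min \<bar>X u \<omega> - g u\<bar> (min u (1 / u))) \<in> borel_measurable M" if "u \<in> \<rat> \<inter> {0<..}" for u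
      using that
      by (intro borel_measurable_min borel_measurable_abs borel_measurable_diff borel_measurable_const X) auto
  qed (auto intro!: bdd_aboveI[where M=1] dest: min_inverse_le_one simp: min_le_iff_disj)
  then show ?thesis
    by (rule measurable_cong[THEN iffD1, rotated]) (simp add: path_dist_rational c g)
qed

section \<open>A countable dense set of paths\<close>

definition rat_polys :: "(real \<Rightarrow> real) set" where
  "rat_polys = range (\<lambda>(l :: rat list) u. \<Sum>i<length l. of_rat (l ! i) * u ^ i)"

lemma countable_rat_polys: "countable rat_polys"
  unfolding rat_polys_def by simp

lemma continuous_on_rat_polys: "g \<in> rat_polys \<Longrightarrow> continuous_on S g"
  unfolding rat_polys_def by (auto intro!: continuous_intros)

lemma rat_polys_dense:
  assumes f: "continuous_on {0<..} f" and e: "e > 0"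
  obtains g where "g \<in> rat_polys" "path_dist f g \<le> e"
proof -
  have "continuous_on {e..1/e} f" by (rule continuous_on_subset[OF f]) (use e in auto)
  then obtain p where p: "real_polynomial_function p" "\<And>x. x \<in> {e..1/e} \<Longrightarrow> \<bar>f x - p x\<bar> < e / 2"
    using Stone_Weierstrass_real_polynomial_function[of "{e..1/e}" f "e/2"] e by auto
  then obtain a n where a: "p = (\<lambda>x. \<Sum>i\<le>n. a i * x ^ i)"
    by (auto simp: real_polynomial_function_iff_sum)
  \<comment> \<open>C bounds the sum of the powers of u on the window, where u is at most 1 / e.
    Coefficient errors below \<delta> thus cost at most \<delta> * C, which is at most e / 2; the
    other half of e goes to the Weierstrass approximation.\<close>
  define C where "C = (\<Sum>i\<le>n. (1 / e) ^ i)"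
  have C: "C \<ge> 0" unfolding C_def using e by (intro sum_nonneg) auto
  define \<delta> where "\<delta> = e / (2 * (C + 1))"
  have \<delta>: "\<delta> > 0" using e C by (auto simp: \<delta>_def)
  have "\<exists>q::rat. \<bar>of_rat q - a i\<bar> < \<delta>" for i
  proof -
    obtain r where "r \<in> \<rat>" "a i < r" "r < a i + \<delta>"
      using Rats_dense_in_real[of "a i" "a i + \<delta>"] \<delta> by auto
    then show ?thesis by (auto elim!: Rats_cases simp: abs_less_iff intro: exI[of _ "SOME q. r = of_rat q"])
  qed
  then obtain q :: "nat \<Rightarrow> rat" where q: "\<And>i. \<bar>of_rat (q i) - a i\<bar> < \<delta>" by metis
  define g where "g = (\<lambda>u::real. \<Sum>i<length (map q [0..<Suc n]). of_rat (map q [0..<Suc n] ! i) * u ^ i)"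
  have g: "g u = (\<Sum>i\<le>n. of_rat (q i) * u ^ i)" for u
    unfolding g_def by (rule sum.cong) (auto simp del: upt_Suc simp: nth_map_upt)
  show ?thesis
  proof (rule that)
    show "g \<in> rat_polys" unfolding rat_polys_def g_def by blast
    show "path_dist f g \<le> e"
    proof (rule path_dist_leI[OF e])
      fix u assume u: "u \<in> {e..1/e}"
      have "\<bar>p u - g u\<bar> = \<bar>\<Sum>i\<le>n. (a i - of_rat (q i)) * u ^ i\<bar>"
        by (simp add: a g sum_subtractf left_diff_distrib)
      also have "\<dots> \<le> (\<Sum>i\<le>n. \<bar>a i - of_rat (q i)\<bar> * \<bar>u\<bar> ^ i)"
        by (rule order.trans[OF sum_abs]) (simp add: abs_mult power_abs)
      also have "\<dots> \<le> (\<Sum>i\<le>n. \<delta> * (1 / e) ^ i)"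
      proof (intro sum_mono mult_mono power_mono)
        show "\<bar>a i - of_rat (q i)\<bar> \<le> \<delta>" for i using q[of i] by (simp add: abs_minus_commute)
      qed (use u e \<delta> in auto)
      also have "\<dots> = \<delta> * C" by (simp add: C_def sum_distrib_left)
      also have "\<dots> \<le> e / 2" using C e by (simp add: \<delta>_def field_simps)
      finally show "\<bar>f u - g u\<bar> \<le> e" using p(2)[OF u] by linarith
    qed
  qed
qed

section \<open>Lipschitz functionals of paths\<close>

definition path_lipschitz :: "real \<Rightarrow> ((real \<Rightarrow> real) \<Rightarrow> real) \<Rightarrow> bool" where
  "path_lipschitz L h \<longleftrightarrow> 0 \<le> L \<and> (\<forall>f g. continuous_on {0<..} f \<longrightarrow> continuous_on {0<..} g \<longrightarrow>
     \<bar>h f - h g\<bar> \<le> L * path_dist f g)"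

text \<open>A Lipschitz functional is the infimal convolution of its values on a countable dense set,
  hence depends measurably on the coordinates of the path.\<close>

lemma borel_measurable_path_lipschitz:
  fixes X :: "real \<Rightarrow> 'a \<Rightarrow> real"
  assumes X: "\<And>u. u > 0 \<Longrightarrow> X u \<in> borel_measurable M"
    and c: "\<And>\<omega>. \<omega> \<in> space M \<Longrightarrow> continuous_on {0<..} (\<lambda>u. X u \<omega>)"
    and h: "path_lipschitz L h"
  shows "(\<lambda>\<omega>. h (\<lambda>u. X u \<omega>)) \<in> borel_measurable M"
proof -
  have L: "L \<ge> 0" and hl: "\<And>f g. continuous_on {0<..} f \<Longrightarrow> continuous_on {0<..} g \<Longrightarrow>
     \<bar>h f - h g\<bar> \<le> L * path_dist f g" using h by (auto simp: path_lipschitz_def)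
  have ne: "rat_polys \<noteq> {}" by (simp add: rat_polys_def)
  have lower: "h f \<le> h g + L * path_dist f g" if "continuous_on {0<..} f" "g \<in> rat_polys" for f g
    using hl[OF that(1) continuous_on_rat_polys[OF that(2)]] by linarith
  have bdd: "bdd_below ((\<lambda>g. h g + L * path_dist f g) ` rat_polys)" if "continuous_on {0<..} f" for f
    using lower[OF that] by (auto intro!: bdd_belowI)
  have eq: "(INF g\<in>rat_polys. h g + L * path_dist f g) = h f" if f: "continuous_on {0<..} f" for f
  proof (rule antisym)
    show "h f \<le> (INF g\<in>rat_polys. h g + L * path_dist f g)"
      by (rule cINF_greatest[OF ne lower[OF f]])
    show "(INF g\<in>rat_polys. h g + L * path_dist f g) \<le> h f"
    proof (rule field_le_epsilon)
      fix e :: real assume e: "e > 0"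
      \<comment> \<open>L times the distance is paid twice, once for the penalty and once for
        replacing \<open>h g\<close> by \<open>h f\<close>.\<close>
      obtain g where g: "g \<in> rat_polys" "path_dist f g \<le> e / (2 * (L + 1))"
        using rat_polys_dense[OF f, of "e / (2 * (L + 1))"] e L by auto
      have "(INF g\<in>rat_polys. h g + L * path_dist f g) \<le> h g + L * path_dist f g"
        by (rule cINF_lower[OF bdd[OF f] g(1)])
      also have "\<dots> \<le> h f + 2 * L * path_dist f g"
        using hl[OF f continuous_on_rat_polys[OF g(1)]] by linarith
      also have "\<dots> \<le> h f + 2 * L * (e / (2 * (L + 1)))"
        using g(2) L by (intro add_left_mono mult_left_mono) auto
      also have "\<dots> \<le> h f + e" using L e by (simp add: field_simps)
      finally show "(INF g\<in>rat_polys. h g + L * path_dist f g) \<le> h f + e" .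
    qed
  qed
  have "(\<lambda>\<omega>. INF g\<in>rat_polys. h g + L * path_dist (\<lambda>u. X u \<omega>) g) \<in> borel_measurable M"
  proof (rule borel_measurable_cINF[OF countable_rat_polys])
    show "(\<lambda>\<omega>. h g + L * path_dist (\<lambda>u. X u \<omega>) g) \<in> borel_measurable M" if "g \<in> rat_polys" for g
      using borel_measurable_path_dist[OF X c continuous_on_rat_polys[OF that]] by simp
  qed (use bdd c in auto)
  then show ?thesis
    by (rule measurable_cong[THEN iffD1, rotated]) (simp add: eq c)
qed

section \<open>Pasch-Hausdorff envelopes of a bounded functional\<close>

definition inf_conv :: "((real \<Rightarrow> real) \<Rightarrow> real) \<Rightarrow> nat \<Rightarrow> (real \<Rightarrow> real) \<Rightarrow> real" where
  "inf_conv \<Phi> n f = (INF g\<in>{g. continuous_on {0<..} g}. \<Phi> g + real n * path_dist f g)"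

context
  fixes \<Phi> :: "(real \<Rightarrow> real) \<Rightarrow> real" and K :: real
  assumes \<Phi>_bound: "\<And>f. \<bar>\<Phi> f\<bar> \<le> K"
begin

lemma bdd_below_inf_conv: "bdd_below ((\<lambda>g. \<Phi> g + real n * path_dist f g) ` {g. continuous_on {0<..} g})"
proof (rule bdd_belowI2)
  fix g show "- K \<le> \<Phi> g + real n * path_dist f g"
    using \<Phi>_bound[of g] mult_nonneg_nonneg[OF of_nat_0_le_iff[of n] path_dist_nonneg[of f g]] by linarith
qed

lemma inf_conv_lower:
  "continuous_on {0<..} g \<Longrightarrow> inf_conv \<Phi> n f \<le> \<Phi> g + real n * path_dist f g"
  unfolding inf_conv_def by (rule cINF_lower[OF bdd_below_inf_conv]) simp

lemma inf_conv_greatest: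
  "(\<And>g. continuous_on {0<..} g \<Longrightarrow> c \<le> \<Phi> g + real n * path_dist f g) \<Longrightarrow> c \<le> inf_conv \<Phi> n f"
  unfolding inf_conv_def by (rule cINF_greatest) (auto intro: exI[of _ "\<lambda>_. 0"])

lemma inf_conv_le: "continuous_on {0<..} f \<Longrightarrow> inf_conv \<Phi> n f \<le> \<Phi> f"
  using inf_conv_lower[of f n f] by simp

lemma abs_inf_conv_le: "continuous_on {0<..} f \<Longrightarrow> \<bar>inf_conv \<Phi> n f\<bar> \<le> K"
proof -
  assume f: "continuous_on {0<..} f"
  have "- K \<le> inf_conv \<Phi> n f"
  proof (rule inf_conv_greatest)
    fix g show "- K \<le> \<Phi> g + real n * path_dist f g"
      using \<Phi>_bound[of g] mult_nonneg_nonneg[OF of_nat_0_le_iff[of n] path_dist_nonneg[of f g]] by linarith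
  qed
  then show ?thesis using inf_conv_le[OF f, of n] \<Phi>_bound[of f] by linarith
qed

text \<open>By the triangle inequality each competitor contributes an n-Lipschitz function of f, and
  an infimum of such functions that is bounded below is again n-Lipschitz.\<close>

lemma path_lipschitz_inf_conv: "path_lipschitz (real n) (inf_conv \<Phi> n)"
proof -
  have *: "inf_conv \<Phi> n f \<le> inf_conv \<Phi> n g + real n * path_dist f g" for f g
  proof -
    have "inf_conv \<Phi> n f - real n * path_dist f g \<le> inf_conv \<Phi> n g"
    proof (rule inf_conv_greatest)
      fix k :: "real \<Rightarrow> real" assume k: "continuous_on {0<..} k"
      have "real n * path_dist f k \<le> real n * (path_dist f g + path_dist g k)"
        by (intro mult_left_mono path_dist_triangle) auto
      then show "inf_conv \<Phi> n f - real n * path_dist f g \<le> \<Phi> k + real n * path_dist g k"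
        using inf_conv_lower[OF k, of n f] by (simp add: distrib_left)
    qed
    then show ?thesis by simp
  qed
  show ?thesis
    unfolding path_lipschitz_def
    using * path_dist_commute by (simp add: abs_le_iff) (smt (verit, best))
qed

text \<open>Competitors within \<rho> of f have values near \<open>\<Phi> f\<close>. All others pay
  a penalty of at least n * \<rho>, which for large n reaches the largest possible oscillation 2 * K
  of \<Phi>.\<close>

lemma inf_conv_tendsto:
  assumes f: "continuous_on {0<..} f"
    and cont: "\<And>e. e > 0 \<Longrightarrow> \<exists>\<rho>>0. \<forall>g. continuous_on {0<..} g \<longrightarrow> path_dist f g < \<rho> \<longrightarrow> \<bar>\<Phi> g - \<Phi> f\<bar> \<le> e"
  shows "(\<lambda>n. inf_conv \<Phi> n f) \<longlonglongrightarrow> \<Phi> f"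
proof (rule LIMSEQ_I)
  fix r :: real assume r: "r > 0"
  obtain \<rho> where \<rho>: "\<rho> > 0" "\<And>g. continuous_on {0<..} g \<Longrightarrow> path_dist f g < \<rho> \<Longrightarrow> \<bar>\<Phi> g - \<Phi> f\<bar> \<le> r / 2"
    using cont[of "r/2"] r by auto
  obtain n0 :: nat where n0: "real n0 * \<rho> \<ge> 2 * K"
    using reals_Archimedean3[OF \<rho>(1)] by (auto intro: less_imp_le)
  have "norm (inf_conv \<Phi> n f - \<Phi> f) < r" if n: "n \<ge> n0" for n
  proof -
    have "\<Phi> f - r / 2 \<le> inf_conv \<Phi> n f"
    proof (rule inf_conv_greatest)
      fix g :: "real \<Rightarrow> real" assume g: "continuous_on {0<..} g"
      show "\<Phi> f - r / 2 \<le> \<Phi> g + real n * path_dist f g"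
      proof (cases "path_dist f g < \<rho>")
        case True
        have "0 \<le> real n * path_dist f g" by (intro mult_nonneg_nonneg path_dist_nonneg) auto
        then show ?thesis using \<rho>(2)[OF g True] by linarith
      next
        case False
        have "2 * K \<le> real n0 * \<rho>" by (rule n0)
        also have "\<dots> \<le> real n * path_dist f g"
          using False n \<rho>(1) by (intro mult_mono) auto
        finally show ?thesis using \<Phi>_bound[of f] \<Phi>_bound[of g] r by linarith
      qed
    qed
    then show ?thesis using inf_conv_le[OF f, of n] r by (simp add: abs_less_iff)
  qed
  then show "\<exists>n0. \<forall>n\<ge>n0. norm (inf_conv \<Phi> n f - \<Phi> f) < r" by blast
qed

end

section \<open>Processes with continuous paths in the Skorokhod space\<close>

definition to_skor :: "(real \<Rightarrow> real) \<Rightarrow> skorokhod" where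
  "to_skor f = Abs_skor (restrict f {0<..})"

lemma continuous_imp_cadlag:
  assumes f: "continuous_on {0<..} f"
  shows "cadlag f"
  unfolding cadlag_def
proof (intro allI impI conjI)
  fix t :: real assume "t > 0"
  then have c: "continuous (at t) f"
    using f by (simp add: continuous_on_eq_continuous_at)
  then show "continuous (at_right t) f" by (rule continuous_at_imp_continuous_within)
  have "(f \<longlongrightarrow> f t) (at_left t)"
    using continuous_at_imp_continuous_within[OF c, of "{..<t}"] by (simp add: continuous_within)
  then show "\<exists>l. (f \<longlongrightarrow> l) (at_left t)" by blast
qed

lemma skor_fun_to_skor: "cadlag f \<Longrightarrow> skor_fun (to_skor f) = restrict f {0<..}"
  unfolding to_skor_def by (rule Abs_skor_inverse) (simp add: cadlag_restrict)

lemma to_skor_cong: "(\<And>u. u > 0 \<Longrightarrow> f u = g u) \<Longrightarrow> to_skor f = to_skor g"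
  unfolding to_skor_def by (rule arg_cong[where f = Abs_skor]) (auto intro!: restrict_ext)

lemma time_change_id: "time_change (\<lambda>t. t)"
  by (auto simp: time_change_def strict_mono_on_def)

text \<open>Locally uniform closeness implies \<open>J\<^sub>1\<close>-closeness, with the identity as time change.\<close>

lemma to_skor_open:
  assumes U: "open U" and f: "continuous_on {0<..} f" and fU: "to_skor f \<in> U"
  obtains \<rho> where "\<rho> > 0"
    "\<And>g. continuous_on {0<..} g \<Longrightarrow> path_dist f g < \<rho> \<Longrightarrow> to_skor g \<in> U"
proof -
  obtain a b e where abe: "0 < a" "a < b" "0 < e" "J1_nbhd (to_skor f) a b e \<subseteq> U"
    using U fU unfolding open_skorokhod_def by blast
  show ?thesis
  proof (rule that)
    \<comment> \<open>The inner minimum keeps the truncation in \<open>path_dist\<close> inactive on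
      \<open>{a..b}\<close>; e is the tolerance of the neighbourhood.\<close>
    show "min (min a (1 / b)) e > 0" using abe by auto
    fix g assume g: "continuous_on {0<..} g" and d: "path_dist f g < min (min a (1 / b)) e"
    have "\<bar>f t - g t\<bar> < e" if "t \<in> {a..b}" for t
      using path_dist_imp_uniform[of a f g b t] d abe that by auto
    then have "to_skor g \<in> J1_nbhd (to_skor f) a b e"
      unfolding J1_nbhd_def using abe
      by (auto intro!: exI[of _ "\<lambda>t. t"] time_change_id
          simp: skor_fun_to_skor continuous_imp_cadlag f g abs_minus_commute)
    then show "to_skor g \<in> U" using abe by blast
  qed
qed

lemma to_skor_continuous:
  fixes \<phi> :: "skorokhod \<Rightarrow> real"
  assumes \<phi>: "continuous_on UNIV \<phi>" and f: "continuous_on {0<..} f" and e: "e > 0"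
  shows "\<exists>\<rho>>0. \<forall>g. continuous_on {0<..} g \<longrightarrow> path_dist f g < \<rho> \<longrightarrow> \<bar>\<phi> (to_skor g) - \<phi> (to_skor f)\<bar> \<le> e"
proof -
  have "open (\<phi> -` ball (\<phi> (to_skor f)) e)"
    using \<phi> by (simp add: open_vimage)
  moreover have "to_skor f \<in> \<phi> -` ball (\<phi> (to_skor f)) e" using e by simp
  ultimately obtain \<rho> where "\<rho> > 0"
    "\<And>g. continuous_on {0<..} g \<Longrightarrow> path_dist f g < \<rho> \<Longrightarrow> to_skor g \<in> \<phi> -` ball (\<phi> (to_skor f)) e"
    using to_skor_open[OF _ f] by blast
  then show ?thesis
    by (intro exI[of _ \<rho>]) (auto simp: dist_real_def abs_minus_commute intro: less_imp_le)
qed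

text \<open>The distance to the complement of an open set is Lipschitz and positive exactly on it.\<close>

lemma measurable_to_skor:
  fixes X :: "real \<Rightarrow> 'a \<Rightarrow> real"
  assumes X: "\<And>u. u > 0 \<Longrightarrow> X u \<in> borel_measurable M"
    and c: "\<And>\<omega>. \<omega> \<in> space M \<Longrightarrow> continuous_on {0<..} (\<lambda>u. X u \<omega>)"
  shows "(\<lambda>\<omega>. to_skor (\<lambda>u. X u \<omega>)) \<in> M \<rightarrow>\<^sub>M borel"
proof (rule borel_measurableI)
  fix U :: "skorokhod set" assume U: "open U"
  define G where "G = {g. continuous_on {0<..} g \<and> to_skor g \<notin> U}"
  show "(\<lambda>\<omega>. to_skor (\<lambda>u. X u \<omega>)) -` U \<inter> space M \<in> sets M"
  \<comment> \<open>The infimum that defines h says nothing for empty G, so this case is treated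
    apart.\<close>
  proof (cases "G = {}")
    case True
    then have "(\<lambda>\<omega>. to_skor (\<lambda>u. X u \<omega>)) -` U \<inter> space M = space M" using c by (auto simp: G_def)
    then show ?thesis by simp
  next
    case False
    define h where "h f = (INF g\<in>G. path_dist f g)" for f
    have bdd: "bdd_below (path_dist f ` G)" for f
      by (auto intro!: bdd_belowI[where m=0] path_dist_nonneg)
    have lip: "h f \<le> h f' + path_dist f f'" for f f'
    proof -
      have "h f - path_dist f f' \<le> h f'"
        unfolding h_def[of f']
      proof (rule cINF_greatest[OF False])
        fix g assume "g \<in> G"
        then have "h f \<le> path_dist f g" unfolding h_def by (rule cINF_lower[OF bdd])
        then show "h f - path_dist f f' \<le> path_dist f' g"
          using path_dist_triangle[of f g f'] by linarith
      qed
      then show ?thesis by simp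
    qed
    have "path_lipschitz 1 h"
      unfolding path_lipschitz_def
    proof (intro conjI allI impI)
      fix f g show "\<bar>h f - h g\<bar> \<le> 1 * path_dist f g"
        using lip[of f g] lip[of g f] path_dist_commute[of f g] by (simp add: abs_le_iff)
    qed simp
    from borel_measurable_path_lipschitz[OF X c this]
    have [measurable]: "(\<lambda>\<omega>. h (\<lambda>u. X u \<omega>)) \<in> borel_measurable M" .
    have iff: "to_skor f \<in> U \<longleftrightarrow> h f > 0" if f: "continuous_on {0<..} f" for f
    proof
      assume "to_skor f \<in> U"
      then obtain \<rho> where \<rho>: "\<rho> > 0"
        "\<And>g. continuous_on {0<..} g \<Longrightarrow> path_dist f g < \<rho> \<Longrightarrow> to_skor g \<in> U"
        using to_skor_open[OF U f] by blast
      have "\<rho> \<le> h f"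
        unfolding h_def
        by (rule cINF_greatest[OF False]) (use \<rho>(2) in \<open>force simp: G_def not_less[symmetric]\<close>)
      then show "h f > 0" using \<rho>(1) by simp
    next
      assume *: "h f > 0"
      show "to_skor f \<in> U"
      proof (rule ccontr)
        assume "to_skor f \<notin> U"
        then have "f \<in> G" using f by (simp add: G_def)
        then have "h f \<le> path_dist f f" unfolding h_def by (rule cINF_lower[OF bdd])
        then show False using * by simp
      qed
    qed
    have "(\<lambda>\<omega>. to_skor (\<lambda>u. X u \<omega>)) -` U \<inter> space M = {\<omega>\<in>space M. h (\<lambda>u. X u \<omega>) > 0}"
      using iff c by auto
    also have "\<dots> \<in> sets M" by measurable
    finally show ?thesis .
  qed
qed

text \<open>The exceptional null set is common to all u. This is indistinguishability, and it
  determines the path law, which agreement for each single u would not.\<close>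

definition continuous_version ::
  "'a measure \<Rightarrow> (real \<Rightarrow> 'a \<Rightarrow> real) \<Rightarrow> (real \<Rightarrow> 'a \<Rightarrow> real) \<Rightarrow> bool" where
  "continuous_version M X X' \<longleftrightarrow> (\<forall>u>0. X' u \<in> borel_measurable M) \<and>
     (\<forall>\<omega>\<in>space M. continuous_on {0<..} (\<lambda>u. X' u \<omega>)) \<and>
     (AE \<omega> in M. \<forall>u>0. X u \<omega> = X' u \<omega>)"

lemma continuous_version_path:
  assumes v: "continuous_version M X X'"
  shows "AE \<omega> in M. cadlag (\<lambda>u. X u \<omega>) \<and> skorokhod_path X \<omega> = to_skor (\<lambda>u. X' u \<omega>)"
proof -
  have "AE \<omega> in M. \<forall>u>0. X u \<omega> = X' u \<omega>" using v by (simp add: continuous_version_def)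
  moreover have "AE \<omega> in M. \<omega> \<in> space M" by simp
  ultimately show ?thesis
  proof eventually_elim
    case (elim \<omega>)
    then have "continuous_on {0<..} (\<lambda>u. X' u \<omega>)" using v by (simp add: continuous_version_def)
    moreover have "continuous_on {0<..} (\<lambda>u. X u \<omega>) = continuous_on {0<..} (\<lambda>u. X' u \<omega>)"
      using elim by (intro continuous_on_cong) auto
    ultimately have c: "cadlag (\<lambda>u. X u \<omega>)" by (simp add: continuous_imp_cadlag)
    then have "skorokhod_path X \<omega> = to_skor (\<lambda>u. X u \<omega>)" by (simp add: skorokhod_path_def to_skor_def)
    also have "\<dots> = to_skor (\<lambda>u. X' u \<omega>)" using elim by (intro to_skor_cong) auto
    finally show ?case using c by simp
  qed
qed

lemma continuous_version_measurable:
  "continuous_version M X X' \<Longrightarrow> (\<lambda>\<omega>. to_skor (\<lambda>u. X' u \<omega>)) \<in> M \<rightarrow>\<^sub>M borel"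
  by (rule measurable_to_skor) (auto simp: continuous_version_def)

text \<open>The set where the two path maps differ need not be an event, but it lies in a null event
  A. Off A the map agrees with a measurable one, and every subset of A is measurable for the
  completion.\<close>

lemma continuous_version_skorokhod_path:
  assumes v: "continuous_version M X X'"
  shows "skorokhod_path X \<in> completion M \<rightarrow>\<^sub>M borel"
proof (rule measurableI)
  obtain A where A: "A \<in> null_sets M"
    "{\<omega>\<in>space M. \<not> (cadlag (\<lambda>u. X u \<omega>) \<and> skorokhod_path X \<omega> = to_skor (\<lambda>u. X' u \<omega>))} \<subseteq> A"
    using continuous_version_path[OF v] by (auto simp: eventually_ae_filter)
  fix U :: "skorokhod set" assume U: "U \<in> sets borel"
  let ?V = "(\<lambda>\<omega>. to_skor (\<lambda>u. X' u \<omega>)) -` U \<inter> space M"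
  let ?S = "skorokhod_path X -` U \<inter> space M"
  have V: "?V - A \<in> sets M"
    using measurable_sets[OF continuous_version_measurable[OF v] U] A by auto
  have "?S = (?V - A) \<union> (?S \<inter> A)" using A(2) by auto
  moreover have "?S \<inter> A \<in> sets (completion M)"
    using A(1) null_sets_completion_subset[of "?S \<inter> A" A M] null_sets_completionI[OF A(1)]
    by (auto intro: null_setsD2)
  ultimately have "?S \<in> sets (completion M)"
    using V sets_completionI_sets[OF V] by (metis sets.Un)
  then show "skorokhod_path X -` U \<inter> space (completion M) \<in> sets (completion M)" by simp
qed simp

lemma continuous_version_skorokhod_process:
  assumes v: "continuous_version M X X'"
  shows "skorokhod_process M X"
  unfolding skorokhod_process_def
  using continuous_version_path[OF v] continuous_version_skorokhod_path[OF v] by (auto elim: eventually_mono)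

text \<open>The completion is left again at once: after an almost sure replacement the integrand is
  measurable for M itself.\<close>

lemma continuous_version_path_law:
  fixes \<phi> :: "skorokhod \<Rightarrow> real"
  assumes v: "continuous_version M X X'" and \<phi>[measurable]: "\<phi> \<in> borel_measurable borel"
  shows "(\<integral>x. \<phi> x \<partial>path_law M X) = (\<integral>\<omega>. \<phi> (to_skor (\<lambda>u. X' u \<omega>)) \<partial>M)"
proof -
  note m = continuous_version_measurable[OF v]
  have "(\<integral>x. \<phi> x \<partial>path_law M X) = (\<integral>\<omega>. \<phi> (skorokhod_path X \<omega>) \<partial>completion M)"
    unfolding path_law_def using continuous_version_skorokhod_path[OF v] by (intro integral_distr) auto
  also have "\<dots> = (\<integral>\<omega>. \<phi> (to_skor (\<lambda>u. X' u \<omega>)) \<partial>completion M)"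
  proof (rule integral_cong_AE)
    show "(\<lambda>\<omega>. \<phi> (skorokhod_path X \<omega>)) \<in> borel_measurable (completion M)"
      using continuous_version_skorokhod_path[OF v] by measurable
    show "(\<lambda>\<omega>. \<phi> (to_skor (\<lambda>u. X' u \<omega>))) \<in> borel_measurable (completion M)"
      using measurable_completion[OF m] by measurable
    show "AE \<omega> in completion M. \<phi> (skorokhod_path X \<omega>) = \<phi> (to_skor (\<lambda>u. X' u \<omega>))"
      using AE_completion[OF continuous_version_path[OF v]] by eventually_elim simp
  qed
  also have "\<dots> = (\<integral>\<omega>. \<phi> (to_skor (\<lambda>u. X' u \<omega>)) \<partial>M)"
    using m by (intro integral_completion) measurable
  finally show ?thesis .
qed

text \<open>Dominated convergence under the limit law selects one n for which the envelope of level
  n loses less than e. This n does not depend on i, so the hypothesis is applied to a single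
  Lipschitz functional, and for \<open>X' i\<close> only the inequality between envelope and
  functional enters.\<close>

lemma J1_weak_conv_lipschitz:
  fixes X X' :: "'i \<Rightarrow> real \<Rightarrow> 'a \<Rightarrow> real" and Y Y' :: "real \<Rightarrow> 'b \<Rightarrow> real"
  assumes M: "prob_space M" and N: "prob_space N"
    and X: "\<forall>\<^sub>F i in F. continuous_version M (X i) (X' i)"
    and Y: "continuous_version N Y Y'"
    and lim: "\<And>h L K. path_lipschitz L h \<Longrightarrow> (\<And>f. continuous_on {0<..} f \<Longrightarrow> \<bar>h f\<bar> \<le> K) \<Longrightarrow>
      ((\<lambda>i. \<integral>\<omega>. h (\<lambda>u. X' i u \<omega>) \<partial>M) \<longlongrightarrow> (\<integral>\<omega>. h (\<lambda>u. Y' u \<omega>) \<partial>N)) F"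
  shows "J1_weak_conv M X F N Y"
proof -
  interpret M: prob_space M by fact
  interpret N: prob_space N by fact
  have Ym: "\<And>u. u > 0 \<Longrightarrow> Y' u \<in> borel_measurable N"
    and Yc: "\<And>\<omega>. \<omega> \<in> space N \<Longrightarrow> continuous_on {0<..} (\<lambda>u. Y' u \<omega>)"
    using Y by (auto simp: continuous_version_def)
  have lower: "\<forall>\<^sub>F i in F. (\<integral>\<omega>. \<phi> (to_skor (\<lambda>u. X' i u \<omega>)) \<partial>M) > (\<integral>\<omega>. \<phi> (to_skor (\<lambda>u. Y' u \<omega>)) \<partial>N) - e"
    if \<phi>: "continuous_on UNIV \<phi>" and K: "\<And>x. \<bar>\<phi> x\<bar> \<le> K" and e: "e > 0" for \<phi> :: "skorokhod \<Rightarrow> real" and K e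
  proof -
    define \<Phi> where "\<Phi> f = \<phi> (to_skor f)" for f
    have \<Phi>K: "\<bar>\<Phi> f\<bar> \<le> K" for f by (simp add: \<Phi>_def K)
    have [measurable]: "\<phi> \<in> borel_measurable borel" by (rule borel_measurable_continuous_onI[OF \<phi>])
    have hm: "(\<lambda>\<omega>. inf_conv \<Phi> n (\<lambda>u. Y' u \<omega>)) \<in> borel_measurable N" for n
      by (rule borel_measurable_path_lipschitz[OF Ym Yc path_lipschitz_inf_conv[OF \<Phi>K]])
    have "(\<lambda>n. \<integral>\<omega>. inf_conv \<Phi> n (\<lambda>u. Y' u \<omega>) \<partial>N) \<longlonglongrightarrow> (\<integral>\<omega>. \<Phi> (\<lambda>u. Y' u \<omega>) \<partial>N)"
    proof (rule integral_dominated_convergence[where w = "\<lambda>_. K"])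
      show "(\<lambda>\<omega>. \<Phi> (\<lambda>u. Y' u \<omega>)) \<in> borel_measurable N"
        unfolding \<Phi>_def using measurable_to_skor[OF Ym Yc] by measurable
      show "AE \<omega> in N. (\<lambda>n. inf_conv \<Phi> n (\<lambda>u. Y' u \<omega>)) \<longlonglongrightarrow> \<Phi> (\<lambda>u. Y' u \<omega>)"
        using to_skor_continuous[OF \<phi> Yc, folded \<Phi>_def] by (intro AE_I2 inf_conv_tendsto[OF \<Phi>K] Yc)
      show "AE \<omega> in N. norm (inf_conv \<Phi> n (\<lambda>u. Y' u \<omega>)) \<le> K" for n
        using abs_inf_conv_le[OF \<Phi>K Yc] by (intro AE_I2) simp
    qed (simp_all add: hm)
    then have "\<forall>\<^sub>F n in sequentially. (\<integral>\<omega>. inf_conv \<Phi> n (\<lambda>u. Y' u \<omega>) \<partial>N) > (\<integral>\<omega>. \<Phi> (\<lambda>u. Y' u \<omega>) \<partial>N) - e"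
      by (rule order_tendstoD(1)) (use e in simp)
    then obtain n where n: "(\<integral>\<omega>. inf_conv \<Phi> n (\<lambda>u. Y' u \<omega>) \<partial>N) > (\<integral>\<omega>. \<Phi> (\<lambda>u. Y' u \<omega>) \<partial>N) - e"
      by (auto simp: eventually_sequentially)
    have "((\<lambda>i. \<integral>\<omega>. inf_conv \<Phi> n (\<lambda>u. X' i u \<omega>) \<partial>M) \<longlongrightarrow> (\<integral>\<omega>. inf_conv \<Phi> n (\<lambda>u. Y' u \<omega>) \<partial>N)) F"
      by (rule lim[OF path_lipschitz_inf_conv[OF \<Phi>K] abs_inf_conv_le[OF \<Phi>K]])
    then have "\<forall>\<^sub>F i in F. (\<integral>\<omega>. inf_conv \<Phi> n (\<lambda>u. X' i u \<omega>) \<partial>M) > (\<integral>\<omega>. \<Phi> (\<lambda>u. Y' u \<omega>) \<partial>N) - e"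
      using n by (rule order_tendstoD(1))
    with X show ?thesis
    proof eventually_elim
      case (elim i)
      have Xm: "\<And>u. u > 0 \<Longrightarrow> X' i u \<in> borel_measurable M"
        and Xc: "\<And>\<omega>. \<omega> \<in> space M \<Longrightarrow> continuous_on {0<..} (\<lambda>u. X' i u \<omega>)"
        using elim(1) by (auto simp: continuous_version_def)
      have "(\<integral>\<omega>. inf_conv \<Phi> n (\<lambda>u. X' i u \<omega>) \<partial>M) \<le> (\<integral>\<omega>. \<Phi> (\<lambda>u. X' i u \<omega>) \<partial>M)"
      proof (rule integral_mono)
        show "integrable M (\<lambda>\<omega>. inf_conv \<Phi> n (\<lambda>u. X' i u \<omega>))"
          using abs_inf_conv_le[OF \<Phi>K Xc]
          by (intro M.integrable_const_bound[of _ K] AE_I2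
              borel_measurable_path_lipschitz[OF Xm Xc path_lipschitz_inf_conv[OF \<Phi>K]]) auto
        show "integrable M (\<lambda>\<omega>. \<Phi> (\<lambda>u. X' i u \<omega>))"
        proof (rule M.integrable_const_bound[of _ K])
          show "(\<lambda>\<omega>. \<Phi> (\<lambda>u. X' i u \<omega>)) \<in> borel_measurable M"
            unfolding \<Phi>_def using measurable_to_skor[OF Xm Xc] by measurable
        qed (simp add: \<Phi>K)
        show "inf_conv \<Phi> n (\<lambda>u. X' i u \<omega>) \<le> \<Phi> (\<lambda>u. X' i u \<omega>)" if "\<omega> \<in> space M" for \<omega>
          by (rule inf_conv_le[OF \<Phi>K Xc[OF that]])
      qed
      with elim(2) show ?case by (simp add: \<Phi>_def)
    qed
  qed
  have "weak_conv_along (\<lambda>i. path_law M (X i)) (path_law N Y) F"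
    unfolding weak_conv_along_def
  proof (intro allI impI)
    fix \<phi> :: "skorokhod \<Rightarrow> real" assume \<phi>: "continuous_on UNIV \<phi>" and b: "bounded (range \<phi>)"
    then obtain K where K: "\<And>x. \<bar>\<phi> x\<bar> \<le> K" by (auto simp: bounded_iff)
    have m: "\<phi> \<in> borel_measurable borel" by (rule borel_measurable_continuous_onI[OF \<phi>])
    have "((\<lambda>i. \<integral>\<omega>. \<phi> (to_skor (\<lambda>u. X' i u \<omega>)) \<partial>M) \<longlongrightarrow> (\<integral>\<omega>. \<phi> (to_skor (\<lambda>u. Y' u \<omega>)) \<partial>N)) F"
    proof (rule tendstoI)
      fix e :: real assume e: "e > 0"
      have n: "continuous_on UNIV (\<lambda>x. - \<phi> x)" by (intro continuous_intros \<phi>)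
      have nK: "\<bar>- \<phi> x\<bar> \<le> K" for x by (simp add: K)
      show "\<forall>\<^sub>F i in F. dist (\<integral>\<omega>. \<phi> (to_skor (\<lambda>u. X' i u \<omega>)) \<partial>M) (\<integral>\<omega>. \<phi> (to_skor (\<lambda>u. Y' u \<omega>)) \<partial>N) < e"
        using lower[OF n nK e] lower[OF \<phi> K e]
        by eventually_elim (simp add: dist_real_def abs_less_iff)
    qed
    then show "((\<lambda>i. \<integral>x. \<phi> x \<partial>path_law M (X i)) \<longlongrightarrow> (\<integral>x. \<phi> x \<partial>path_law N Y)) F"
      unfolding continuous_version_path_law[OF Y m]
      by (rule Lim_transform_eventually) (use X in eventually_elim, simp add: continuous_version_path_law m)
  qed
  then show ?thesis
    unfolding J1_weak_conv_def
    using X continuous_version_skorokhod_process[OF Y]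
    by (auto elim!: eventually_mono intro: continuous_version_skorokhod_process)
qed

section \<open>Chaining\<close>

text \<open>Nonnegative integrals let the estimate be applied before integrability of the square is
  known.\<close>

lemma nn_integral_Chebyshev:
  assumes [measurable]: "f \<in> borel_measurable M" and t: "t > 0"
  shows "emeasure M {\<omega>\<in>space M. \<bar>f \<omega>\<bar> > t} \<le> ennreal (1 / t\<^sup>2) * (\<integral>\<^sup>+\<omega>. ennreal ((f \<omega>)\<^sup>2) \<partial>M)"
proof -
  have "emeasure M {\<omega>\<in>space M. \<bar>f \<omega>\<bar> > t} \<le> emeasure M {\<omega>\<in>space M. 1 \<le> ennreal (1 / t\<^sup>2) * ennreal ((f \<omega>)\<^sup>2)}"
  proof (rule emeasure_mono)
    have "1 \<le> ennreal (1 / t\<^sup>2) * ennreal ((f \<omega>)\<^sup>2)" if "\<bar>f \<omega>\<bar> > t" for \<omega>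
    proof -
      have "t\<^sup>2 \<le> (f \<omega>)\<^sup>2" using that t by (subst abs_le_square_iff[symmetric]) simp
      then have "1 \<le> 1 / t\<^sup>2 * (f \<omega>)\<^sup>2" using t by (simp add: field_simps)
      then show ?thesis by (simp add: ennreal_mult[symmetric] ennreal_le_iff flip: ennreal_1)
    qed
    then show "{\<omega>\<in>space M. \<bar>f \<omega>\<bar> > t} \<subseteq> {\<omega>\<in>space M. 1 \<le> ennreal (1 / t\<^sup>2) * ennreal ((f \<omega>)\<^sup>2)}" by auto
  qed measurable
  also have "\<dots> \<le> ennreal (1 / t\<^sup>2) * (\<integral>\<^sup>+\<omega>. ennreal ((f \<omega>)\<^sup>2) * indicator (space M) \<omega> \<partial>M)"
    by (rule nn_integral_Markov_inequality) measurable
  also have "(\<integral>\<^sup>+\<omega>. ennreal ((f \<omega>)\<^sup>2) * indicator (space M) \<omega> \<partial>M) = (\<integral>\<^sup>+\<omega>. ennreal ((f \<omega>)\<^sup>2) \<partial>M)"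
    by (rule nn_integral_cong) simp
  finally show ?thesis .
qed

section \<open>Dyadic grids\<close>

definition dyadic_pt :: "real \<Rightarrow> real \<Rightarrow> nat \<Rightarrow> nat \<Rightarrow> real" where
  "dyadic_pt a c m i = a + (c - a) * real i / 2 ^ m"

lemma dyadic_pt_in: "a \<le> c \<Longrightarrow> i \<le> 2 ^ m \<Longrightarrow> dyadic_pt a c m i \<in> {a..c}"
proof -
  assume *: "a \<le> c" "i \<le> 2 ^ m"
  have i: "real i \<le> 2 ^ m" using *(2) by (metis of_nat_le_iff of_nat_numeral of_nat_power)
  have "real i / 2 ^ m \<le> 1" using i by (simp add: divide_le_eq_1)
  then have "(c - a) * (real i / 2 ^ m) \<le> (c - a) * 1" using *(1) by (intro mult_left_mono) auto
  then show ?thesis using *(1) by (simp add: dyadic_pt_def)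
qed

lemma dyadic_pt_Suc: "dyadic_pt a c (Suc m) (2 * i) = dyadic_pt a c m i"
  by (simp add: dyadic_pt_def)

text \<open>A point of level m + 1 with even index already belongs to level m, and one with odd
  index has an even left neighbour. So each level adds at most one increment.\<close>

lemma dyadic_chain:
  fixes f :: "real \<Rightarrow> real"
  assumes base: "\<And>i. i \<le> 2 ^ m0 \<Longrightarrow> \<bar>f (dyadic_pt a c m0 i)\<bar> \<le> b"
    and step: "\<And>m i. m > m0 \<Longrightarrow> i < 2 ^ m \<Longrightarrow>
      \<bar>f (dyadic_pt a c m (Suc i)) - f (dyadic_pt a c m i)\<bar> \<le> t m"
    and t: "\<And>m. 0 \<le> t m"
    and m: "m \<ge> m0" and i: "i \<le> 2 ^ m"
  shows "\<bar>f (dyadic_pt a c m i)\<bar> \<le> b + (\<Sum>k\<in>{m0<..m}. t k)"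
  using m i
proof (induction m arbitrary: i rule: dec_induct)
  case base
  then show ?case using assms(1) by simp
next
  case (step m)
  have S: "(\<Sum>k\<in>{m0<..Suc m}. t k) = (\<Sum>k\<in>{m0<..m}. t k) + t (Suc m)"
    using step.hyps(1) by (simp add: greaterThanAtMost_def atMost_Suc Int_insert_right add.commute)
  have IH: "\<bar>f (dyadic_pt a c (Suc m) (2 * j))\<bar> \<le> b + (\<Sum>k\<in>{m0<..m}. t k)" if "j \<le> 2 ^ m" for j
    using step.IH[OF that] by (simp add: dyadic_pt_Suc)
  show ?case
  proof (cases "even i")
    case True
    then obtain j where "i = 2 * j" by (elim evenE)
    with step.prems IH[of j] t[of "Suc m"] show ?thesis by (simp add: S)
  next
    case False
    then obtain j where j: "i = Suc (2 * j)" by (metis oddE Suc_eq_plus1)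
    with step.prems have j2: "j \<le> 2 ^ m" "2 * j < 2 ^ Suc m" by auto
    have "\<bar>f (dyadic_pt a c (Suc m) (Suc (2 * j))) - f (dyadic_pt a c (Suc m) (2 * j))\<bar> \<le> t (Suc m)"
      using step.hyps j2(2) by (intro assms(2)) auto
    with IH[OF j2(1)] show ?thesis by (simp add: S j)
  qed
qed

lemma dyadic_pt_dense:
  assumes f: "continuous_on {a..c} (f :: real \<Rightarrow> real)" and ac: "a < c"
    and b: "\<And>m i. m \<ge> m0 \<Longrightarrow> i \<le> 2 ^ m \<Longrightarrow> \<bar>f (dyadic_pt a c m i)\<bar> \<le> b"
    and u: "u \<in> {a..c}"
  shows "\<bar>f u\<bar> \<le> b"
proof -
  \<comment> \<open>Rounding the position of u down gives a grid point to its left, within one mesh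
    width.\<close>
  define i where "i m = nat \<lfloor>(u - a) / (c - a) * 2 ^ m\<rfloor>" for m
  define x where "x m = dyadic_pt a c m (i m)" for m
  have r: "0 \<le> (u - a) / (c - a)" "(u - a) / (c - a) \<le> 1" using u ac by (auto simp: field_simps)
  have i: "real (i m) \<le> (u - a) / (c - a) * 2 ^ m" "(u - a) / (c - a) * 2 ^ m - 1 \<le> real (i m)" for m
  proof -
    define y where "y = (u - a) / (c - a) * 2 ^ m"
    have "y \<ge> 0" unfolding y_def using r(1) by (rule mult_nonneg_nonneg) simp
    then have "real (nat \<lfloor>y\<rfloor>) = of_int \<lfloor>y\<rfloor>" by simp
    then have "real (nat \<lfloor>y\<rfloor>) \<le> y" "y - 1 \<le> real (nat \<lfloor>y\<rfloor>)" by linarith+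
    then show "real (i m) \<le> (u - a) / (c - a) * 2 ^ m" "(u - a) / (c - a) * 2 ^ m - 1 \<le> real (i m)"
      by (simp_all only: i_def y_def)
  qed
  have i': "i m \<le> 2 ^ m" for m
  proof -
    have "real (i m) \<le> 1 * 2 ^ m" using i(1)[of m] r(2) by (meson mult_right_mono order_trans zero_le_numeral zero_le_power)
    then show ?thesis by (metis mult_1 of_nat_le_iff of_nat_numeral of_nat_power)
  qed
  have x: "x m \<in> {a..c}" for m unfolding x_def using ac i' by (intro dyadic_pt_in) auto
  have "(\<lambda>m. (c - a) * (1 / 2) ^ m) \<longlonglongrightarrow> (c - a) * 0"
    by (intro tendsto_intros LIMSEQ_power_zero) auto
  moreover have "\<bar>x m - u\<bar> \<le> (c - a) * (1 / 2) ^ m" for m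
  proof -
    have "u - x m = (c - a) / 2 ^ m * ((u - a) / (c - a) * 2 ^ m - real (i m))"
      using ac by (simp add: x_def dyadic_pt_def field_simps)
    then have "\<bar>u - x m\<bar> = (c - a) / 2 ^ m * \<bar>(u - a) / (c - a) * 2 ^ m - real (i m)\<bar>"
      using ac by (simp add: abs_mult)
    also have "\<dots> \<le> (c - a) / 2 ^ m * 1"
      using i[of m] ac by (intro mult_left_mono) auto
    finally show ?thesis by (simp add: power_divide abs_minus_commute)
  qed
  ultimately have "x \<longlonglongrightarrow> u"
    by (intro LIMSEQ_I) (smt (verit, best) LIMSEQ_D mult_zero_right real_norm_def)
  then have "(\<lambda>m. f (x m)) \<longlonglongrightarrow> f u"
    using f u x by (auto simp: continuous_on_sequentially comp_def)
  then have "(\<lambda>m. \<bar>f (x m)\<bar>) \<longlonglongrightarrow> \<bar>f u\<bar>" by (rule tendsto_rabs)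
  then show ?thesis
    by (rule LIMSEQ_le_const2) (use b i' in \<open>auto simp: x_def intro!: exI[of _ m0]\<close>)
qed

text \<open>The order of quantifiers is the point: the grid G and the bound \<kappa> are fixed
  before D, so one choice serves a whole family of processes that share the increment constant
  K.\<close>

definition controls_sup :: "'a measure \<Rightarrow> real \<Rightarrow> real \<Rightarrow> real \<Rightarrow> real \<Rightarrow> real set \<Rightarrow> real \<Rightarrow> bool" where
  "controls_sup M a c K e G \<kappa> \<longleftrightarrow> (\<forall>D.
      (\<forall>u\<in>{a..c}. D u \<in> borel_measurable M) \<longrightarrow>
      (\<forall>\<omega>\<in>space M. continuous_on {a..c} (\<lambda>u. D u \<omega>)) \<longrightarrow>
      (\<forall>u\<in>{a..c}. \<forall>v\<in>{a..c}. (\<integral>\<^sup>+\<omega>. ennreal ((D u \<omega> - D v \<omega>)\<^sup>2) \<partial>M) \<le> ennreal (K * (u - v)\<^sup>2)) \<longrightarrow>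
      (\<forall>u\<in>G. (\<integral>\<^sup>+\<omega>. ennreal ((D u \<omega>)\<^sup>2) \<partial>M) \<le> ennreal \<kappa>) \<longrightarrow>
      (\<exists>A\<in>sets M. emeasure M A \<le> ennreal e \<and> (\<forall>\<omega>\<in>space M - A. \<forall>u\<in>{a..c}. \<bar>D u \<omega>\<bar> \<le> e)))"

lemma controls_supD:
  assumes "controls_sup M a c K e G \<kappa>"
    and "\<And>u. u \<in> {a..c} \<Longrightarrow> D u \<in> borel_measurable M"
    and "\<And>\<omega>. \<omega> \<in> space M \<Longrightarrow> continuous_on {a..c} (\<lambda>u. D u \<omega>)"
    and "\<And>u v. u \<in> {a..c} \<Longrightarrow> v \<in> {a..c} \<Longrightarrow>
      (\<integral>\<^sup>+\<omega>. ennreal ((D u \<omega> - D v \<omega>)\<^sup>2) \<partial>M) \<le> ennreal (K * (u - v)\<^sup>2)"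
    and "\<And>u. u \<in> G \<Longrightarrow> (\<integral>\<^sup>+\<omega>. ennreal ((D u \<omega>)\<^sup>2) \<partial>M) \<le> ennreal \<kappa>"
  shows "\<exists>A\<in>sets M. emeasure M A \<le> ennreal e \<and> (\<forall>\<omega>\<in>space M - A. \<forall>u\<in>{a..c}. \<bar>D u \<omega>\<bar> \<le> e)"
  by (rule assms(1)[unfolded controls_sup_def, rule_format]; rule assms)

text \<open>Kolmogorov's chaining: the increment at dyadic level \<open>m\<close> exceeds \<open>e (3/4)\<^sup>m\<close> somewhere with
  probability at most a multiple of \<open>(8/9)\<^sup>m\<close>, so all levels beyond some \<open>m0\<close> are negligible and
  only the finite grid of level \<open>m0\<close> remains.\<close>

lemma chaining_small_sup:
  fixes M :: "'a measure" and a c K e :: real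
  assumes ac: "a < c" and K: "K \<ge> 0" and e: "e > 0"
  obtains G \<kappa> where "finite G" "G \<subseteq> {a..c}" "\<kappa> > 0" "controls_sup M a c K e G \<kappa>"
proof -
  \<comment> \<open>Chebyshev's inequality at threshold e * (3/4)^m bounds the probability for one
    increment of level m by B * (4/9)^m; there are 2^m of them.\<close>
  define B where "B = K * (c - a)\<^sup>2 / e\<^sup>2"
  have B: "B \<ge> 0" using K by (simp add: B_def)
  have "(\<lambda>m. 9 * B * (8 / 9) ^ m) \<longlonglongrightarrow> 9 * B * 0" "(\<lambda>m. 4 * (3 / 4) ^ m) \<longlonglongrightarrow> (4 * 0 :: real)"
    by (intro tendsto_intros LIMSEQ_power_zero; simp)+
  then have "\<forall>\<^sub>F m in sequentially. 9 * B * (8 / 9) ^ m < e / 2" "\<forall>\<^sub>F m in sequentially. 4 * (3 / 4) ^ m < (1 / 2 :: real)"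
    using e by (auto simp only: mult_zero_right elim!: order_tendstoD(2))
  then have "\<forall>\<^sub>F m in sequentially. 9 * B * (8 / 9) ^ m < e / 2 \<and> 4 * (3 / 4) ^ m < (1 / 2 :: real)"
    by eventually_elim simp
  \<comment> \<open>Both conditions concern geometric tails from m0 on, with 1 / (1 - 8/9) = 9 for
    the probabilities and 1 / (1 - 3/4) = 4 for the thresholds.\<close>
  then obtain m0 where m0: "9 * B * (8 / 9) ^ m0 < e / 2" "4 * (3 / 4) ^ m0 < (1 / 2 :: real)"
    by (auto simp: eventually_sequentially)
  \<comment> \<open>Exceeding e / 2 at one grid point has probability at most 4 * \<kappa> / e^2,
    and the grid of level m0 has 2^m0 + 1 points; this \<kappa> makes the total e / 2.\<close>
  define \<kappa> where "\<kappa> = e ^ 3 / (8 * (2 ^ m0 + 1))"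
  define G where "G = dyadic_pt a c m0 ` {..2 ^ m0}"
  \<comment> \<open>The ratio must be below 1 for the thresholds to be summable and above 1 / sqrt 2
    for the probabilities to be; 3/4 satisfies both.\<close>
  define t where "t m = e * (3 / 4) ^ m" for m :: nat
  have t: "t m > 0" for m using e by (simp add: t_def)
  have t_sum: "(\<Sum>k\<in>{m0<..m}. t k) \<le> e / 2" for m
  proof -
    have sm: "summable (\<lambda>k. t (k + m0))"
      unfolding t_def power_add by (intro summable_mult summable_mult2 summable_geometric) auto
    have "(\<Sum>k\<in>{m0<..m}. t k) \<le> (\<Sum>k\<in>{m0..<m0 + (m + 1)}. t k)"
      by (rule sum_mono2) (use t in \<open>auto intro: less_imp_le\<close>)
    also have "\<dots> = (\<Sum>k<m+1. t (k + m0))"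
      using sum.shift_bounds_nat_ivl[of t 0 m0 "m + 1"] by (simp add: atLeast0LessThan add.commute)
    also have "\<dots> \<le> (\<Sum>k. t (k + m0))"
      by (rule sum_le_suminf[OF sm]) (use t in \<open>auto intro: less_imp_le\<close>)
    also have "\<dots> = e * (3 / 4) ^ m0 * (\<Sum>k. (3 / 4) ^ k)"
      unfolding t_def power_add by (subst suminf_mult[symmetric]) (auto intro: summable_geometric simp: mult_ac)
    also have "\<dots> = e * (4 * (3 / 4) ^ m0)" by (subst suminf_geometric) auto
    also have "\<dots> \<le> e * (1 / 2)" using m0(2) e by (intro mult_left_mono) auto
    finally show ?thesis by simp
  qed
  show ?thesis
  proof (rule that[of G \<kappa>])
    show "finite G" by (simp add: G_def)
    show "G \<subseteq> {a..c}" using ac by (auto simp: G_def simp del: atLeastAtMost_iff intro!: dyadic_pt_in)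
    show "\<kappa> > 0" using e by (simp add: \<kappa>_def add_pos_pos)
    show "controls_sup M a c K e G \<kappa>"
      unfolding controls_sup_def
    proof (intro allI impI)
      fix D :: "real \<Rightarrow> 'a \<Rightarrow> real"
      assume D': "\<forall>u\<in>{a..c}. D u \<in> borel_measurable M"
        and cont': "\<forall>\<omega>\<in>space M. continuous_on {a..c} (\<lambda>u. D u \<omega>)"
        and inc': "\<forall>u\<in>{a..c}. \<forall>v\<in>{a..c}. (\<integral>\<^sup>+\<omega>. ennreal ((D u \<omega> - D v \<omega>)\<^sup>2) \<partial>M) \<le> ennreal (K * (u - v)\<^sup>2)"
        and pt': "\<forall>u\<in>G. (\<integral>\<^sup>+\<omega>. ennreal ((D u \<omega>)\<^sup>2) \<partial>M) \<le> ennreal \<kappa>"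
      note D = D'[rule_format] and cont = cont'[rule_format] and inc = inc'[rule_format] and pt = pt'[rule_format]
      note D[measurable]
      define P where "P = dyadic_pt a c"
      have Pin: "i \<le> 2 ^ m \<Longrightarrow> P m i \<in> {a..c}" for m i
        unfolding P_def using ac by (intro dyadic_pt_in) auto
      have DP[measurable]: "i \<le> 2 ^ m \<Longrightarrow> D (P m i) \<in> borel_measurable M" for m i
        using D Pin by blast
      define E where "E m i = {\<omega>\<in>space M. \<bar>D (P m (Suc i)) \<omega> - D (P m i) \<omega>\<bar> > t m}" for m i
      define F where "F i = {\<omega>\<in>space M. \<bar>D (P m0 i) \<omega>\<bar> > e / 2}" for i
      have E_sets: "E m i \<in> sets M" if "i < 2 ^ m" for m i
      proof -
        have [measurable]: "D (P m (Suc i)) \<in> borel_measurable M" "D (P m i) \<in> borel_measurable M"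
          using that by (auto intro!: DP)
        show ?thesis unfolding E_def by measurable
      qed
      have F_sets: "F i \<in> sets M" if "i \<le> 2 ^ m0" for i
        unfolding F_def using DP[OF that] by measurable
      have E_le: "emeasure M (E m i) \<le> ennreal (B * (4 / 9) ^ m)" if i: "i < 2 ^ m" for m i
      proof -
        have Pi: "P m (Suc i) \<in> {a..c}" "P m i \<in> {a..c}" using i by (auto intro!: Pin simp del: atLeastAtMost_iff)
        have d: "P m (Suc i) - P m i = (c - a) / 2 ^ m" by (simp add: P_def dyadic_pt_def field_simps)
        have "emeasure M (E m i) \<le> ennreal (1 / (t m)\<^sup>2) * (\<integral>\<^sup>+\<omega>. ennreal ((D (P m (Suc i)) \<omega> - D (P m i) \<omega>)\<^sup>2) \<partial>M)"
          unfolding E_def using Pi t by (intro nn_integral_Chebyshev) auto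
        also have "\<dots> \<le> ennreal (1 / (t m)\<^sup>2) * ennreal (K * ((c - a) / 2 ^ m)\<^sup>2)"
          using inc[OF Pi] by (intro mult_left_mono) (auto simp: d)
        also have "\<dots> = ennreal (1 / (t m)\<^sup>2 * (K * ((c - a) / 2 ^ m)\<^sup>2))"
          using K by (subst ennreal_mult[symmetric]) auto
        also have "1 / (t m)\<^sup>2 * (K * ((c - a) / 2 ^ m)\<^sup>2) = B * (1 / (((3 / 4) ^ m)\<^sup>2 * (2 ^ m)\<^sup>2))"
          by (simp add: B_def t_def power_mult_distrib power_divide mult_ac)
        also have "((3 / 4) ^ m)\<^sup>2 * (2 ^ m)\<^sup>2 = ((9 / 4 :: real) ^ m)"
          by (simp add: power_mult_distrib[symmetric] power_mult[symmetric] mult.commute[of m 2] power_mult power2_eq_square)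
        also have "1 / (9 / 4 :: real) ^ m = (4 / 9) ^ m" by (simp add: power_divide)
        finally show ?thesis .
      qed
      have F_le: "emeasure M (F i) \<le> ennreal (e / (2 * (2 ^ m0 + 1)))" if i: "i \<le> 2 ^ m0" for i
      proof -
        have "emeasure M (F i) \<le> ennreal (1 / (e/2)\<^sup>2) * (\<integral>\<^sup>+\<omega>. ennreal ((D (P m0 i) \<omega>)\<^sup>2) \<partial>M)"
          unfolding F_def using i e by (intro nn_integral_Chebyshev) auto
        also have "\<dots> \<le> ennreal (1 / (e/2)\<^sup>2) * ennreal \<kappa>"
          using i by (intro mult_left_mono pt) (auto simp: G_def P_def)
        also have "\<dots> = ennreal (1 / (e/2)\<^sup>2 * \<kappa>)" by (subst ennreal_mult'[symmetric]) auto
        also have "1 / (e/2)\<^sup>2 * \<kappa> = e / (2 * (2 ^ m0 + 1))"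
        proof -
          have nz: "(2 :: real) ^ m0 + 1 \<noteq> 0" by (smt (verit) zero_less_power)
          then show ?thesis using e by (simp add: \<kappa>_def power2_eq_square power3_eq_cube divide_simps)
        qed
        finally show ?thesis .
      qed
      define EE where "EE m = (\<Union>i<2 ^ m. E m i)" for m :: nat
      define FF where "FF = (\<Union>i\<le>2 ^ m0. F i)"
      have EE_sets[measurable]: "EE m \<in> sets M" for m unfolding EE_def using E_sets by auto
      have FF_sets[measurable]: "FF \<in> sets M" unfolding FF_def using F_sets by auto
      have EE_le: "emeasure M (EE m) \<le> ennreal (B * (8 / 9) ^ m)" for m
      proof -
        have "emeasure M (EE m) \<le> (\<Sum>i<2 ^ m. emeasure M (E m i))"
          unfolding EE_def using E_sets by (intro emeasure_subadditive_finite) auto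
        also have "\<dots> \<le> (\<Sum>i<(2::nat) ^ m. ennreal (B * (4 / 9) ^ m))" by (intro sum_mono E_le) auto
        also have "\<dots> = ennreal ((\<Sum>i<(2::nat) ^ m. B * (4 / 9) ^ m))" using B by (intro sum_ennreal) auto
        also have "(\<Sum>i<(2::nat) ^ m. B * (4 / 9) ^ m) = B * (2 ^ m * (4 / 9) ^ m)" by simp
        also have "(2::real) ^ m * (4 / 9) ^ m = (8 / 9) ^ m" by (simp flip: power_mult_distrib)
        finally show ?thesis .
      qed
      have FF_le: "emeasure M FF \<le> ennreal (e / 2)"
      proof -
        have "emeasure M FF \<le> (\<Sum>i\<le>2 ^ m0. emeasure M (F i))"
          unfolding FF_def using F_sets by (intro emeasure_subadditive_finite) auto
        also have "\<dots> \<le> (\<Sum>i\<le>(2::nat) ^ m0. ennreal (e / (2 * (2 ^ m0 + 1))))" by (intro sum_mono F_le) auto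
        also have "\<dots> = ennreal (\<Sum>i\<le>(2::nat) ^ m0. e / (2 * (2 ^ m0 + 1)))"
          using e by (intro sum_ennreal) (auto simp: add_nonneg_nonneg)
        also have "(\<Sum>i\<le>(2::nat) ^ m0. e / (2 * (2 ^ m0 + 1))) = (2 ^ m0 + 1) * (e / (2 * (2 ^ m0 + 1)))"
          by (simp add: add.commute)
        also have "\<dots> = e / 2"
        proof -
          have "(2 :: real) ^ m0 + 1 \<noteq> 0" by (smt (verit) zero_less_power)
          then show ?thesis by (simp add: divide_simps)
        qed
        finally show ?thesis .
      qed
      define A where "A = FF \<union> (\<Union>m. EE (m + m0))"
      have A_sets: "A \<in> sets M" unfolding A_def by measurable
      have "emeasure M (\<Union>m. EE (m + m0)) \<le> (\<Sum>m. emeasure M (EE (m + m0)))"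
        by (rule emeasure_subadditive_countably) auto
      also have "\<dots> \<le> (\<Sum>m. ennreal (B * (8 / 9) ^ (m + m0)))"
        by (intro suminf_le EE_le) auto
      also have "\<dots> = ennreal (\<Sum>m. B * (8 / 9) ^ (m + m0))"
        using B unfolding power_add
        by (intro suminf_ennreal2) (auto intro!: summable_mult summable_mult2 summable_geometric)
      also have "(\<Sum>m. B * (8 / 9) ^ (m + m0)) = B * (8 / 9) ^ m0 * (\<Sum>m. (8 / 9) ^ m)"
        unfolding power_add by (subst suminf_mult[symmetric]) (auto intro: summable_geometric simp: mult_ac)
      also have "\<dots> = 9 * B * (8 / 9) ^ m0" by (subst suminf_geometric) auto
      also have "ennreal \<dots> \<le> ennreal (e / 2)" using m0(1) by (intro ennreal_leI) simp
      finally have "emeasure M (\<Union>m. EE (m + m0)) \<le> ennreal (e / 2)" .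
      then have "emeasure M A \<le> ennreal (e / 2) + ennreal (e / 2)"
        unfolding A_def by (intro order.trans[OF emeasure_subadditive] add_mono FF_le) auto
      also have "\<dots> = ennreal e" using e by (simp flip: ennreal_plus)
      finally have A_le: "emeasure M A \<le> ennreal e" .
      have "\<bar>D u \<omega>\<bar> \<le> e" if \<omega>: "\<omega> \<in> space M - A" and u: "u \<in> {a..c}" for u \<omega>
      proof (rule dyadic_pt_dense[OF cont ac _ u])
        show "\<omega> \<in> space M" using \<omega> by simp
        fix m i assume mi: "m \<ge> m0" "i \<le> (2::nat) ^ m"
        have "\<bar>D (dyadic_pt a c m i) \<omega>\<bar> \<le> e / 2 + (\<Sum>k\<in>{m0<..m}. t k)"
        proof (rule dyadic_chain[where f="\<lambda>u. D u \<omega>", OF _ _ _ mi])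
          show "\<bar>D (dyadic_pt a c m0 i) \<omega>\<bar> \<le> e / 2" if "i \<le> 2 ^ m0" for i
            using \<omega> that by (force simp: A_def FF_def F_def P_def)
          show "\<bar>D (dyadic_pt a c m (Suc i)) \<omega> - D (dyadic_pt a c m i) \<omega>\<bar> \<le> t m" if "m > m0" "i < 2 ^ m" for m i
          proof -
            have "\<omega> \<notin> EE (m - m0 + m0)" using \<omega> by (auto simp: A_def)
            then show ?thesis using that \<omega> by (force simp: EE_def E_def P_def)
          qed
          show "0 \<le> t k" for k using t[of k] by simp
        qed
        then show "\<bar>D (dyadic_pt a c m i) \<omega>\<bar> \<le> e" using t_sum[of m] by linarith
      qed
      then show "\<exists>A\<in>sets M. emeasure M A \<le> ennreal e \<and> (\<forall>\<omega>\<in>space M - A. \<forall>u\<in>{a..c}. \<bar>D u \<omega>\<bar> \<le> e)"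
        using A_sets A_le by blast
    qed
  qed
qed

section \<open>The strong law of large numbers\<close>

text \<open>This is the maximum over k <= n of the sums of k consecutive terms from index j on, the
  empty sum included. Lindley's recursion removes the first summand, so that the rest involves later
  indices only.\<close>

primrec lindley :: "(nat \<Rightarrow> real) \<Rightarrow> nat \<Rightarrow> nat \<Rightarrow> real" where
  "lindley y 0 j = 0"
| "lindley y (Suc n) j = max 0 (y j + lindley y n (Suc j))"

lemma lindley_nonneg: "0 \<le> lindley y n j"
  by (cases n) auto

lemma lindley_le_Suc: "lindley y n j \<le> lindley y (Suc n) j"
proof (induction n arbitrary: j)
  case (Suc n)
  show ?case using Suc.IH[of "Suc j"] by (simp only: lindley.simps(2))
qed simp

lemma lindley_mono: "m \<le> n \<Longrightarrow> lindley y m j \<le> lindley y n j"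
  by (rule lift_Suc_mono_le[of "\<lambda>n. lindley y n j", OF lindley_le_Suc])

lemma partial_sum_le_lindley: "k \<le> n \<Longrightarrow> (\<Sum>i<k. y (j + i)) \<le> lindley y n j"
proof (induction n arbitrary: j k)
  case (Suc n)
  show ?case
  proof (cases k)
    case (Suc k')
    with Suc.prems Suc.IH[of k' "Suc j"] show ?thesis
      by (simp add: sum.lessThan_Suc_shift del: sum.lessThan_Suc)
  qed (simp add: lindley_nonneg)
qed simp

lemma lindley_cong: "(\<And>i. j \<le> i \<Longrightarrow> x i = y i) \<Longrightarrow> lindley x n j = lindley y n j"
  by (induction n arbitrary: j) auto

lemma borel_measurable_lindley:
  assumes "\<And>i. j \<le> i \<Longrightarrow> Y i \<in> borel_measurable N"
  shows "(\<lambda>\<omega>. lindley (\<lambda>i. Y i \<omega>) n j) \<in> borel_measurable N"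
  using assms
proof (induction n arbitrary: j)
  case (Suc n)
  have [measurable]: "Y j \<in> borel_measurable N" "(\<lambda>\<omega>. lindley (\<lambda>i. Y i \<omega>) n (Suc j)) \<in> borel_measurable N"
    using Suc by auto
  show ?case by simp
qed simp

text \<open>Moving the start by one index shifts the nonempty partial sums by the finite number
  \<open>y j\<close>; unboundedness is therefore a tail property.\<close>

lemma lindley_unbounded_Suc:
  "(\<forall>k::nat. \<exists>n. lindley y n j > real k) \<longleftrightarrow> (\<forall>k::nat. \<exists>n. lindley y n (Suc j) > real k)"
proof
  assume *: "\<forall>k::nat. \<exists>n. lindley y n j > real k"
  show "\<forall>k::nat. \<exists>n. lindley y n (Suc j) > real k"
  proof
    fix k :: nat
    obtain l :: nat where l: "real k + max 0 (y j) < real l" using reals_Archimedean2 by blast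
    obtain n where n: "lindley y n j > real l" using * by blast
    then have "n \<noteq> 0" by (auto intro!: Nat.gr0I)
    then obtain n' where "n = Suc n'" by (auto simp: gr0_conv_Suc)
    with n l have "lindley y n' (Suc j) > real k" by auto
    then show "\<exists>n. lindley y n (Suc j) > real k" by blast
  qed
next
  assume *: "\<forall>k::nat. \<exists>n. lindley y n (Suc j) > real k"
  show "\<forall>k::nat. \<exists>n. lindley y n j > real k"
  proof
    fix k :: nat
    obtain l :: nat where l: "real k - y j < real l" using reals_Archimedean2 by blast
    obtain n where "lindley y n (Suc j) > real l" using * by blast
    with l have "lindley y (Suc n) j > real k" by auto
    then show "\<exists>n. lindley y n j > real k" by blast
  qed
qed

section \<open>One-sided bounds for sums of i.i.d. variables\<close>

context prob_space
begin

context
  fixes Y :: "nat \<Rightarrow> 'a \<Rightarrow> real"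
  assumes indep: "indep_vars (\<lambda>_. borel) Y UNIV"
    and law: "\<And>i. distr M borel (Y i) = distr M borel (Y 0)"
    and int: "integrable M (Y 0)"
begin

lemma iid_measurable: "Y i \<in> borel_measurable M"
  using indep by (auto simp: indep_vars_def)

lemma iid_integrable: "integrable M (Y i)"
proof -
  note [measurable] = iid_measurable
  have "integrable (distr M borel (Y i)) (\<lambda>x. x)"
    using int law[of i] by (simp add: integrable_distr_eq)
  then show ?thesis by (simp add: integrable_distr_eq)
qed

lemma lindley_measurable: "(\<lambda>\<omega>. lindley (\<lambda>i. Y i \<omega>) n j) \<in> borel_measurable M"
  by (rule borel_measurable_lindley) (rule iid_measurable)

lemma lindley_integrable: "integrable M (\<lambda>\<omega>. lindley (\<lambda>i. Y i \<omega>) n j)"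
  by (induction n arbitrary: j) (auto intro!: integrable_max iid_integrable)

lemma lindley_indep: "indep_var borel (Y j) borel (\<lambda>\<omega>. lindley (\<lambda>i. Y i \<omega>) n (Suc j))"
proof -
  have "indep_var (PiM {j} (\<lambda>_. borel)) (\<lambda>\<omega>. restrict (\<lambda>i. Y i \<omega>) {j})
      (PiM {Suc j..} (\<lambda>_. borel)) (\<lambda>\<omega>. restrict (\<lambda>i. Y i \<omega>) {Suc j..})"
    by (rule indep_var_restrict[OF indep]) auto
  then have "indep_var borel ((\<lambda>x. x j) \<circ> (\<lambda>\<omega>. restrict (\<lambda>i. Y i \<omega>) {j}))
      borel ((\<lambda>x. lindley x n (Suc j)) \<circ> (\<lambda>\<omega>. restrict (\<lambda>i. Y i \<omega>) {Suc j..}))"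
    by (rule indep_var_compose)
      (auto intro!: borel_measurable_lindley measurable_component_singleton)
  moreover have "lindley (restrict (\<lambda>i. Y i \<omega>) {Suc j..}) n (Suc j) = lindley (\<lambda>i. Y i \<omega>) n (Suc j)" for \<omega>
    by (rule lindley_cong) auto
  ultimately show ?thesis by (simp add: comp_def)
qed

text \<open>By \<open>lindley_indep\<close> the joint law of \<open>Y j\<close> and of the maximum
  from the next index is a product. Neither factor depends on j, the second one by
  induction.\<close>

lemma lindley_law:
  "distr M borel (\<lambda>\<omega>. lindley (\<lambda>i. Y i \<omega>) n j) = distr M borel (\<lambda>\<omega>. lindley (\<lambda>i. Y i \<omega>) n 0)"
proof (induction n arbitrary: j)
  case (Suc n)
  note [measurable] = iid_measurable lindley_measurable
  have *: "distr M borel (\<lambda>\<omega>. lindley (\<lambda>i. Y i \<omega>) (Suc n) j) =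
      distr (distr M borel (Y 0) \<Otimes>\<^sub>M distr M borel (\<lambda>\<omega>. lindley (\<lambda>i. Y i \<omega>) n 0)) borel (\<lambda>(a, b). max 0 (a + b))"
    for j
  proof -
    have "distr M borel (\<lambda>\<omega>. lindley (\<lambda>i. Y i \<omega>) (Suc n) j) =
      distr (distr M (borel \<Otimes>\<^sub>M borel) (\<lambda>\<omega>. (Y j \<omega>, lindley (\<lambda>i. Y i \<omega>) n (Suc j)))) borel (\<lambda>(a, b). max 0 (a + b))"
      by (subst distr_distr) (auto simp: comp_def)
    also have "distr M (borel \<Otimes>\<^sub>M borel) (\<lambda>\<omega>. (Y j \<omega>, lindley (\<lambda>i. Y i \<omega>) n (Suc j))) =
      distr M borel (Y j) \<Otimes>\<^sub>M distr M borel (\<lambda>\<omega>. lindley (\<lambda>i. Y i \<omega>) n (Suc j))"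
      using lindley_indep[of j n] by (simp add: indep_var_distribution_eq)
    finally show ?thesis by (simp only: law[of j] Suc.IH[of "Suc j"])
  qed
  show ?case by (simp only: *[of j] *[of 0])
qed simp

text \<open>The maximum over n terms has the same mean from index 1 as from index 0, and the latter
  grows with n. The recursion identifies the difference with the integrand. The argument is in the
  spirit of Garsia's proof of the maximal ergodic lemma.\<close>

lemma lindley_expectation_drift: "0 \<le> expectation (\<lambda>\<omega>. max (Y 0 \<omega>) (- lindley (\<lambda>i. Y i \<omega>) n 1))"
proof -
  note [measurable] = iid_measurable lindley_measurable
  let ?L = "\<lambda>n j \<omega>. lindley (\<lambda>i. Y i \<omega>) n j"
  have "expectation (?L n 1) = (\<integral>x. x \<partial>distr M borel (?L n 1))" by (simp add: integral_distr)
  also have "\<dots> = expectation (?L n 0)" by (subst lindley_law) (simp add: integral_distr)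
  also have "\<dots> \<le> expectation (?L (Suc n) 0)"
    by (intro integral_mono lindley_integrable lindley_le_Suc)
  finally have "0 \<le> expectation (?L (Suc n) 0) - expectation (?L n 1)" by simp
  also have "\<dots> = expectation (\<lambda>\<omega>. ?L (Suc n) 0 \<omega> - ?L n 1 \<omega>)"
    by (intro Bochner_Integration.integral_diff[symmetric] lindley_integrable)
  also have "(\<lambda>\<omega>. ?L (Suc n) 0 \<omega> - ?L n 1 \<omega>) = (\<lambda>\<omega>. max (Y 0 \<omega>) (- ?L n 1 \<omega>))"
    by (auto simp: fun_eq_iff max_def)
  finally show ?thesis .
qed

text \<open>If the partial sums were unbounded with positive probability, then by the 0-1 law
  \<open>lindley _ n 1\<close> would tend to infinity almost surely, and \<open>lindley_expectation_drift\<close> would give a nonnegative mean.\<close>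

lemma AE_partial_sums_bdd_above:
  assumes neg: "expectation (Y 0) < 0"
  shows "AE \<omega> in M. \<exists>b. \<forall>k. (\<Sum>i<k. Y i \<omega>) \<le> b"
proof -
  note [measurable] = iid_measurable lindley_measurable
  let ?L = "\<lambda>n j \<omega>. lindley (\<lambda>i. Y i \<omega>) n j"
  define U where "U j = {\<omega>\<in>space M. \<forall>k::nat. \<exists>n. ?L n j \<omega> > real k}" for j
  have U_eq: "U j = U 0" for j
    by (induction j) (auto simp: U_def lindley_unbounded_Suc[symmetric])
  define \<sigma> where "\<sigma> = (\<lambda>i. sigma_sets (space M) {Y i -` S \<inter> space M | S. S \<in> sets borel})"
  have U_sets: "U j \<in> events" for j
    unfolding U_def by measurable
  \<comment> \<open>By \<open>U_eq\<close> the event can be described from any starting index j,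
    hence through the variables of index at least j.\<close>
  have tail: "U 0 \<in> tail_events \<sigma>"
    unfolding tail_events_def
  proof safe
    fix j :: nat
    have sub: "\<Union> (\<sigma> ` {j..}) \<subseteq> Pow (space M)"
      unfolding \<sigma>_def by (auto dest!: sigma_sets_into_sp[rotated])
    define N where "N = sigma (space M) (\<Union> (\<sigma> ` {j..}))"
    have spN: "space N = space M" and setsN: "sets N = sigma_sets (space M) (\<Union> (\<sigma> ` {j..}))"
      using sub by (auto simp: N_def)
    have "Y i \<in> borel_measurable N" if "j \<le> i" for i
    proof (rule measurableI)
      fix S :: "real set" assume "S \<in> sets borel"
      then have "Y i -` S \<inter> space M \<in> \<sigma> i" unfolding \<sigma>_def by (auto intro: sigma_sets.Basic)
      then show "Y i -` S \<inter> space N \<in> sets N" using that by (auto simp: spN setsN intro!: sigma_sets.Basic)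
    qed simp
    then have [measurable]: "?L n j \<in> borel_measurable N" for n by (rule borel_measurable_lindley)
    have "{\<omega>\<in>space N. \<forall>k::nat. \<exists>n. ?L n j \<omega> > real k} \<in> sets N" by measurable
    then have "U j \<in> sets N" by (simp add: U_def spN)
    then show "U 0 \<in> sigma_sets (space M) (\<Union> (\<sigma> ` {j..}))" by (simp only: U_eq[of j] setsN)
  qed
  have "prob (U 0) = 0 \<or> prob (U 0) = 1"
  proof (rule kolmogorov_0_1_law[OF _ _ tail])
    show "sigma_algebra (space M) (\<sigma> i)" for i
      unfolding \<sigma>_def by (rule sigma_algebra_sigma_sets) auto
    show "indep_sets \<sigma> UNIV" using indep by (simp add: indep_vars_def \<sigma>_def)
  qed
  moreover have "prob (U 0) \<noteq> 1"
  proof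
    assume 1: "prob (U 0) = 1"
    have "AE \<omega> in M. \<omega> \<in> U 0" using AE_in_set_eq_1[OF U_sets] 1 by (rule iffD2)
    \<comment> \<open>Once the maximum from index 1 exceeds - \<open>Y 0\<close>, it does so for all
      larger n, and the expression is constantly \<open>Y 0\<close>. Since the maximum is
      nonnegative, |\<open>Y 0\<close>| dominates throughout.\<close>
    then have "AE \<omega> in M. (\<lambda>n. max (Y 0 \<omega>) (- ?L n 1 \<omega>)) \<longlonglongrightarrow> Y 0 \<omega>"
    proof eventually_elim
      case (elim \<omega>)
      then have "\<omega> \<in> U 1" by (simp only: U_eq[of 1])
      then have "\<forall>k::nat. \<exists>n. ?L n 1 \<omega> > real k" by (simp add: U_def)
      moreover obtain k :: nat where k: "- Y 0 \<omega> < real k" using reals_Archimedean2 by blast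
      ultimately obtain n0 where "real k < ?L n0 1 \<omega>" by blast
      with k have n0: "- Y 0 \<omega> < ?L n0 1 \<omega>" by linarith
      have "max (Y 0 \<omega>) (- ?L n 1 \<omega>) = Y 0 \<omega>" if "n \<ge> n0" for n
        using n0 lindley_mono[OF that, of "\<lambda>i. Y i \<omega>" 1] by linarith
      then show ?case by (intro tendsto_eventually eventually_sequentiallyI[of n0])
    qed
    then have "(\<lambda>n. expectation (\<lambda>\<omega>. max (Y 0 \<omega>) (- ?L n 1 \<omega>))) \<longlonglongrightarrow> expectation (Y 0)"
    proof (rule integral_dominated_convergence[rotated 3])
      show "AE \<omega> in M. norm (max (Y 0 \<omega>) (- ?L n 1 \<omega>)) \<le> \<bar>Y 0 \<omega>\<bar>" for n
        using lindley_nonneg[of "\<lambda>i. Y i _" n 1] by (intro AE_I2) (smt (verit) lindley_nonneg real_norm_def)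
      show "integrable M (\<lambda>\<omega>. \<bar>Y 0 \<omega>\<bar>)" using int by simp
    qed measurable
    then have "0 \<le> expectation (Y 0)"
      by (rule LIMSEQ_le_const) (use lindley_expectation_drift in auto)
    then show False using neg by simp
  qed
  ultimately have "prob (U 0) = 0" by blast
  then have "U 0 \<in> null_sets M" using U_sets by (simp add: null_sets_def emeasure_eq_measure)
  then have "AE \<omega> in M. \<omega> \<notin> U 0" by (rule AE_not_in)
  then show ?thesis
  proof (rule AE_mp, intro AE_I2 impI)
    fix \<omega> assume "\<omega> \<in> space M" "\<omega> \<notin> U 0"
    then obtain k :: nat where k: "\<And>n. ?L n 0 \<omega> \<le> real k" by (auto simp: U_def not_less)
    have "(\<Sum>i<n. Y i \<omega>) \<le> real k" for n
      using partial_sum_le_lindley[of n n "\<lambda>i. Y i \<omega>" 0] k[of n] by simp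
    then show "\<exists>b. \<forall>k. (\<Sum>i<k. Y i \<omega>) \<le> b" by blast
  qed
qed

end

text \<open>The variables r * Y - c have negative mean, so their partial sums are bounded above. The
  factor r lets one statement yield upper bounds (r = 1) and lower bounds (r = -1).\<close>

lemma AE_partial_sums_le_linear:
  fixes Y :: "nat \<Rightarrow> 'a \<Rightarrow> real"
  assumes indep: "indep_vars (\<lambda>_. borel) Y UNIV"
    and law: "\<And>i. distr M borel (Y i) = distr M borel (Y 0)"
    and int: "integrable M (Y 0)" and c: "r * expectation (Y 0) < c"
  shows "AE \<omega> in M. \<exists>b. \<forall>k. r * (\<Sum>i<k. Y i \<omega>) \<le> c * real k + b"
proof -
  have rv[measurable]: "Y i \<in> borel_measurable M" for i using indep unfolding indep_vars_def by simp
  have "AE \<omega> in M. \<exists>b. \<forall>k. (\<Sum>i<k. r * Y i \<omega> - c) \<le> b"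
  proof (rule AE_partial_sums_bdd_above)
    show "indep_vars (\<lambda>_. borel) (\<lambda>i \<omega>. r * Y i \<omega> - c) UNIV"
      by (rule indep_vars_compose2[OF indep]) simp
    have *: "distr M borel (\<lambda>\<omega>. r * Y i \<omega> - c) = distr (distr M borel (Y i)) borel (\<lambda>x. r * x - c)" for i
      by (subst distr_distr) (auto simp: comp_def)
    show "distr M borel (\<lambda>\<omega>. r * Y i \<omega> - c) = distr M borel (\<lambda>\<omega>. r * Y 0 \<omega> - c)" for i
      by (simp only: * law[of i])
    show "integrable M (\<lambda>\<omega>. r * Y 0 \<omega> - c)" using int by (intro Bochner_Integration.integrable_diff integrable_mult_right) auto
    have "expectation (\<lambda>\<omega>. r * Y 0 \<omega> - c) = expectation (\<lambda>\<omega>. r * Y 0 \<omega>) - expectation (\<lambda>_. c)"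
      using int by (intro Bochner_Integration.integral_diff) auto
    then show "expectation (\<lambda>\<omega>. r * Y 0 \<omega> - c) < 0" using c prob_space by simp
  qed
  then show ?thesis
  proof eventually_elim
    case (elim \<omega>)
    then obtain b where b: "\<And>k. (\<Sum>i<k. r * Y i \<omega> - c) \<le> b" by blast
    have "r * (\<Sum>i<k. Y i \<omega>) \<le> c * real k + b" for k
      using b[of k] by (simp add: sum_subtractf sum_distrib_left mult.commute)
    then show ?case by blast
  qed
qed

text \<open>Linear bounds with slopes off by 1 / (m + 1) hold on both sides for all m at once
  outside one null set, and they squeeze the averages.\<close>

lemma strong_law_of_large_numbers:
  fixes Y :: "nat \<Rightarrow> 'a \<Rightarrow> real"
  assumes indep: "indep_vars (\<lambda>_. borel) Y UNIV"
    and law: "\<And>i. distr M borel (Y i) = distr M borel (Y 0)"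
    and int: "integrable M (Y 0)"
  shows "AE \<omega> in M. (\<lambda>k. (\<Sum>i<k. Y i \<omega>) / real k) \<longlonglongrightarrow> expectation (Y 0)"
proof -
  let ?\<mu> = "expectation (Y 0)"
  have "AE \<omega> in M. \<exists>b. \<forall>k. r * (\<Sum>i<k. Y i \<omega>) \<le> (r * ?\<mu> + 1 / real (Suc m)) * real k + b"
    for r and m :: nat
    by (rule AE_partial_sums_le_linear[OF indep law int]) simp
  then have *: "AE \<omega> in M. \<forall>m. \<exists>b. \<forall>k. r * (\<Sum>i<k. Y i \<omega>) \<le> (r * ?\<mu> + 1 / real (Suc m)) * real k + b"
    for r
    unfolding AE_all_countable by blast
  from *[of 1] *[of "-1"] have
    "AE \<omega> in M. \<forall>m. \<exists>b. \<forall>k. 1 * (\<Sum>i<k. Y i \<omega>) \<le> (1 * ?\<mu> + 1 / real (Suc m)) * real k + b"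
    "AE \<omega> in M. \<forall>m. \<exists>b. \<forall>k. -1 * (\<Sum>i<k. Y i \<omega>) \<le> (-1 * ?\<mu> + 1 / real (Suc m)) * real k + b"
    by simp_all
  then show ?thesis
  proof eventually_elim
    case (elim \<omega>)
    show ?case
    proof (rule LIMSEQ_I)
      fix e :: real assume e: "e > 0"
      obtain m where m: "1 / real (Suc m) < e / 2" using nat_approx_posE[of "e/2"] e by auto
      obtain b where b: "\<And>k. (\<Sum>i<k. Y i \<omega>) \<le> (?\<mu> + 1 / real (Suc m)) * real k + b"
        using elim(1)[rule_format, of m] by auto
      obtain b' where b': "\<And>k. - (\<Sum>i<k. Y i \<omega>) \<le> (- ?\<mu> + 1 / real (Suc m)) * real k + b'"
        using elim(2)[rule_format, of m] by auto
      \<comment> \<open>After division by k >= k0 + 1 the intercepts b and b' take less than half of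
        e; the slope error takes the other half.\<close>
      obtain k0 :: nat where k0: "(\<bar>b\<bar> + \<bar>b'\<bar> + 1) / (e / 2) < real k0" using reals_Archimedean2 by blast
      have "norm ((\<Sum>i<k. Y i \<omega>) / real k - ?\<mu>) < e" if k: "k \<ge> Suc k0" for k
      proof -
        have kp: "real k > 0" using k by simp
        have "(\<bar>b\<bar> + \<bar>b'\<bar> + 1) / (e / 2) < real k" using k0 k by linarith
        then have "\<bar>b\<bar> + \<bar>b'\<bar> + 1 < e / 2 * real k" using e by (simp add: field_simps)
        moreover have "1 / real (Suc m) * real k \<le> e / 2 * real k" using m by (intro mult_right_mono) auto
        moreover have "(\<Sum>i<k. Y i \<omega>) \<le> ?\<mu> * real k + 1 / real (Suc m) * real k + b"
          using b[of k] by (simp only: distrib_right)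
        moreover have "- (\<Sum>i<k. Y i \<omega>) \<le> - (?\<mu> * real k) + 1 / real (Suc m) * real k + b'"
          using b'[of k] by (simp only: distrib_right mult_minus_left)
        moreover have "e * real k = e / 2 * real k + e / 2 * real k" by simp
        ultimately have "\<bar>(\<Sum>i<k. Y i \<omega>) - ?\<mu> * real k\<bar> < e * real k"
          by (simp only: abs_less_iff) linarith
        moreover have "(\<Sum>i<k. Y i \<omega>) / real k - ?\<mu> = ((\<Sum>i<k. Y i \<omega>) - ?\<mu> * real k) / real k"
          using kp by (simp add: field_simps)
        ultimately show ?thesis using kp by (simp add: abs_divide divide_less_eq)
      qed
      then show "\<exists>k0. \<forall>k\<ge>k0. norm ((\<Sum>i<k. Y i \<omega>) / real k - ?\<mu>) < e" by blast
    qed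
  qed
qed

end

section \<open>Exponential weights\<close>

lemma exp_diff_le: "p \<le> r \<Longrightarrow> q \<le> r \<Longrightarrow> \<bar>exp p - exp q\<bar> \<le> \<bar>p - q\<bar> * exp (r :: real)"
proof (induction p q rule: linorder_wlog)
  case (le p q)
  have "1 - exp (p - q) \<le> q - p" using exp_ge_add_one_self[of "p - q"] by linarith
  then have "exp q * (1 - exp (p - q)) \<le> exp q * (q - p)" by (intro mult_left_mono) auto
  then have "exp q - exp p \<le> exp q * (q - p)" by (simp add: exp_diff right_diff_distrib)
  also have "\<dots> \<le> exp r * (q - p)" using le by (intro mult_right_mono) auto
  finally show ?case using le by (simp add: mult.commute)
next
  case (sym p q)
  then show ?case by (simp add: abs_minus_commute)
qed

lemma sum_sq_le: "(x + y)\<^sup>2 \<le> 2 * x\<^sup>2 + 2 * (y::real)\<^sup>2"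
  using sum_squares_bound[of x y] by (simp add: power2_sum)

lemma diff_sq_le: "(x - y)\<^sup>2 \<le> 2 * x\<^sup>2 + 2 * (y::real)\<^sup>2"
  using sum_sq_le[of x "- y"] by simp

text \<open>The summand 4 / a^2 bounds x^2 * exp (- a * x) for nonnegative x; the summand exp (2 *
  c) serves for x between -1 and 0.\<close>

definition exp_lip_const :: "real \<Rightarrow> real \<Rightarrow> real" where
  "exp_lip_const a c = 4 / a\<^sup>2 + exp (2 * c)"

lemma exp_lip_const_nonneg: "exp_lip_const a c \<ge> 0"
  by (simp add: exp_lip_const_def)

lemma exp_param_diff_sq:
  assumes a: "0 < a" and u: "u \<in> {a..c}" and v: "v \<in> {a..c}" and x: "x \<ge> -1"
  shows "(exp (- (u * x)) - exp (- (v * x)))\<^sup>2 \<le> exp_lip_const a c * exp (- (a * x)) * (u - v)\<^sup>2"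
proof (cases "x \<ge> 0")
  case True
  have "\<bar>exp (- (u * x)) - exp (- (v * x))\<bar> \<le> \<bar>- (u * x) - - (v * x)\<bar> * exp (- (a * x))"
    using u v True by (intro exp_diff_le) (auto intro: mult_right_mono)
  also have "\<bar>- (u * x) - - (v * x)\<bar> = \<bar>u - v\<bar> * x"
    using True by (simp add: left_diff_distrib[symmetric] abs_mult abs_minus_commute)
  finally have "(exp (- (u * x)) - exp (- (v * x)))\<^sup>2 \<le> (\<bar>u - v\<bar> * x * exp (- (a * x)))\<^sup>2"
    by (meson abs_le_square_iff abs_ge_self order_trans)
  also have "\<dots> = (u - v)\<^sup>2 * (x\<^sup>2 * exp (- (a * x))) * exp (- (a * x))"
    by (simp add: power_mult_distrib power2_eq_square mult_ac)
  also have "x\<^sup>2 * exp (- (a * x)) \<le> 4 / a\<^sup>2"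
  proof -
    have "a * x / 2 \<le> exp (a * x / 2)" using exp_ge_add_one_self[of "a * x / 2"] by linarith
    then have "(a * x / 2)\<^sup>2 \<le> (exp (a * x / 2))\<^sup>2" using True a by (intro power_mono) auto
    also have "(exp (a * x / 2))\<^sup>2 = exp (a * x)" by (simp add: power2_eq_square exp_add[symmetric])
    finally show ?thesis using a by (simp add: exp_minus field_simps power2_eq_square)
  qed
  then have "(u - v)\<^sup>2 * (x\<^sup>2 * exp (- (a * x))) * exp (- (a * x)) \<le> (u - v)\<^sup>2 * exp_lip_const a c * exp (- (a * x))"
    unfolding exp_lip_const_def by (intro mult_left_mono mult_right_mono) (auto intro: add_increasing2)
  finally show ?thesis by (simp add: mult_ac)
next
  case False
  have c: "c \<ge> 0" using a u by auto
  have le: "- (w * x) \<le> c" if "w \<in> {a..c}" for w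
  proof -
    have "w * (- x) \<le> c * 1" using that False x a by (intro mult_mono) auto
    then show ?thesis by simp
  qed
  have "\<bar>exp (- (u * x)) - exp (- (v * x))\<bar> \<le> \<bar>- (u * x) - - (v * x)\<bar> * exp c"
    using u v le by (intro exp_diff_le) auto
  also have "\<bar>- (u * x) - - (v * x)\<bar> = \<bar>u - v\<bar> * \<bar>x\<bar>"
    by (simp add: left_diff_distrib[symmetric] abs_mult abs_minus_commute)
  also have "\<dots> \<le> \<bar>u - v\<bar> * 1" using False x by (intro mult_left_mono) auto
  finally have "\<bar>exp (- (u * x)) - exp (- (v * x))\<bar> \<le> \<bar>u - v\<bar> * exp c" by (simp add: mult_right_mono)
  then have "(exp (- (u * x)) - exp (- (v * x)))\<^sup>2 \<le> (\<bar>u - v\<bar> * exp c)\<^sup>2"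
    by (meson abs_le_square_iff abs_ge_self order_trans)
  also have "\<dots> = exp (2 * c) * 1 * (u - v)\<^sup>2"
    by (simp add: power_mult_distrib exp_double)
  also have "\<dots> \<le> exp_lip_const a c * exp (- (a * x)) * (u - v)\<^sup>2"
  proof (intro mult_right_mono mult_mono)
    show "1 \<le> exp (- (a * x))" using False a by (simp add: mult_nonneg_nonpos mult_le_0_iff)
  qed (auto simp: exp_lip_const_def)
  finally show ?thesis .
qed

text \<open>The weight w is either 1 or an indicator, so that full integrals and integrals over
  \<open>{0..}\<close> are treated together.\<close>

lemma nn_integral_sq_triangle:
  fixes f g h :: "'a \<Rightarrow> real"
  assumes [measurable]: "f \<in> borel_measurable M" "g \<in> borel_measurable M" "h \<in> borel_measurable M"
    "w \<in> borel_measurable M"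
  shows "(\<integral>\<^sup>+x. ennreal ((f x - h x)\<^sup>2) * w x \<partial>M) \<le>
    2 * (\<integral>\<^sup>+x. ennreal ((f x - g x)\<^sup>2) * w x \<partial>M) + 2 * (\<integral>\<^sup>+x. ennreal ((g x - h x)\<^sup>2) * w x \<partial>M)"
proof -
  have "(\<integral>\<^sup>+x. ennreal ((f x - h x)\<^sup>2) * w x \<partial>M) \<le>
    (\<integral>\<^sup>+x. 2 * (ennreal ((f x - g x)\<^sup>2) * w x) + 2 * (ennreal ((g x - h x)\<^sup>2) * w x) \<partial>M)"
  proof (rule nn_integral_mono)
    fix x
    have "ennreal ((f x - h x)\<^sup>2) \<le> ennreal (2 * (f x - g x)\<^sup>2 + 2 * (g x - h x)\<^sup>2)"
      using sum_sq_le[of "f x - g x" "g x - h x"] by (intro ennreal_leI) simp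
    also have "\<dots> = 2 * ennreal ((f x - g x)\<^sup>2) + 2 * ennreal ((g x - h x)\<^sup>2)"
      by (simp add: ennreal_mult)
    finally have "ennreal ((f x - h x)\<^sup>2) * w x \<le> (2 * ennreal ((f x - g x)\<^sup>2) + 2 * ennreal ((g x - h x)\<^sup>2)) * w x"
      by (rule mult_right_mono) simp
    then show "ennreal ((f x - h x)\<^sup>2) * w x \<le> 2 * (ennreal ((f x - g x)\<^sup>2) * w x) + 2 * (ennreal ((g x - h x)\<^sup>2) * w x)"
      by (simp add: distrib_right mult.assoc)
  qed
  also have "\<dots> = 2 * (\<integral>\<^sup>+x. ennreal ((f x - g x)\<^sup>2) * w x \<partial>M) + 2 * (\<integral>\<^sup>+x. ennreal ((g x - h x)\<^sup>2) * w x \<partial>M)"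
    by (subst nn_integral_add) (auto simp: nn_integral_cmult)
  finally show ?thesis .
qed

section \<open>Predictably weighted sums along a random walk\<close>

text \<open>A Riemann sum for the integral 1 / l of exp (- l * y), with a bound that is uniform for
  d <= 1. It rests on 1 - exp (- x) >= x / (1 + x).\<close>

lemma geometric_exp_series:
  assumes l: "l > 0" and d: "d > 0"
  shows "summable (\<lambda>k. exp (- (l * d * real k)))" "d * (\<Sum>k. exp (- (l * d * real k))) \<le> d + 1 / l"
proof -
  have eq: "exp (- (l * d * real k)) = exp (- (l * d)) ^ k" for k
    by (simp add: exp_of_nat_mult[symmetric] mult_ac)
  have lt: "exp (- (l * d)) < 1" using l d by simp
  show "summable (\<lambda>k. exp (- (l * d * real k)))" unfolding eq using lt by (intro summable_geometric) simp
  have "1 + l * d \<le> exp (l * d)" by (rule exp_ge_add_one_self)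
  then have "exp (- (l * d)) \<le> 1 / (1 + l * d)" using l d by (simp add: exp_minus field_simps add_pos_pos)
  moreover have "1 - 1 / (1 + l * d) = l * d / (1 + l * d)"
    using mult_pos_pos[OF l d] by (simp add: field_simps)
  ultimately have ge: "1 - exp (- (l * d)) \<ge> l * d / (1 + l * d)" by linarith
  have "d * (\<Sum>k. exp (- (l * d * real k))) = d / (1 - exp (- (l * d)))"
    unfolding eq using lt by (subst suminf_geometric) auto
  also have "\<dots> \<le> d / (l * d / (1 + l * d))"
    using ge l d lt by (intro divide_left_mono mult_pos_pos) (auto intro!: divide_pos_pos mult_pos_pos add_pos_pos)
  also have "\<dots> = d + 1 / l" using l d by (simp add: field_simps)
  finally show "d * (\<Sum>k. exp (- (l * d * real k))) \<le> d + 1 / l" .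
qed

text \<open>Toeplitz averaging: the weights d * exp (- l * d * k) have bounded total mass, while
  each finite set of indices loses its mass as d tends to 0.\<close>

lemma weighted_average_small:
  fixes \<tau> :: "nat \<Rightarrow> real"
  assumes \<tau>: "\<tau> \<longlonglongrightarrow> 0" "\<And>k. 0 \<le> \<tau> k" "\<And>k. \<tau> k \<le> 1" and l: "l > 0" and e: "e > 0"
  shows "\<forall>\<^sub>F d in at_right 0. summable (\<lambda>k. \<tau> k * exp (- (l * d * real k))) \<and>
    d * (\<Sum>k. \<tau> k * exp (- (l * d * real k))) \<le> e"
proof -
  \<comment> \<open>For d <= 1 the total mass is at most 1 + 1 / l, so terms with \<tau> below e'
    contribute at most e / 2.\<close>
  define e' where "e' = e / (2 * (1 + 1 / l))"
  have e': "e' > 0" using e l by (auto simp: e'_def intro!: divide_pos_pos mult_pos_pos add_pos_pos)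
  obtain k0 where k0: "\<And>k. k \<ge> k0 \<Longrightarrow> \<tau> k \<le> e'"
    using order_tendstoD(2)[OF \<tau>(1) e'] by (auto simp: eventually_sequentially intro: less_imp_le)
  \<comment> \<open>The k0 remaining terms are at most 1 each and contribute at most d * k0, hence
    at most e / 2.\<close>
  define d0 where "d0 = min 1 (e / (2 * (real k0 + 1)))"
  have d0: "d0 > 0" using e by (simp add: d0_def)
  have "summable (\<lambda>k. \<tau> k * exp (- (l * d * real k))) \<and> d * (\<Sum>k. \<tau> k * exp (- (l * d * real k))) \<le> e"
    if d: "0 < d" "d < d0" for d
  proof
    let ?E = "\<lambda>k. exp (- (l * d * real k))"
    note g = geometric_exp_series[OF l d(1)]
    show s: "summable (\<lambda>k. \<tau> k * ?E k)"
      by (rule summable_comparison_test'[OF g(1), of 0]) (use \<tau> in \<open>auto simp: abs_mult intro!: mult_left_le_one_le\<close>)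
    have "\<tau> k * ?E k \<le> (if k \<in> {..<k0} then 1 else 0) + e' * ?E k" for k
    proof (cases "k < k0")
      case True
      have "\<tau> k * ?E k \<le> 1 * 1" using \<tau> l d by (intro mult_mono) auto
      then show ?thesis using True e' by (simp add: add_increasing2)
    next
      case False
      then show ?thesis using k0[of k] by (simp add: mult_right_mono)
    qed
    moreover have s1: "summable (\<lambda>k. if k \<in> {..<k0} then 1 else (0::real))"
      by (rule summable_If_finite_set) simp
    moreover have s2: "summable (\<lambda>k. e' * ?E k)" by (rule summable_mult[OF g(1)])
    ultimately have "(\<Sum>k. \<tau> k * ?E k) \<le> (\<Sum>k. (if k \<in> {..<k0} then 1 else 0) + e' * ?E k)"
      by (intro suminf_le s summable_add) auto
    also have "\<dots> = (\<Sum>k. (if k \<in> {..<k0} then 1 else (0::real))) + (\<Sum>k. e' * ?E k)"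
      by (rule suminf_add[OF s1 s2, symmetric])
    also have "(\<Sum>k. (if k \<in> {..<k0} then 1 else (0::real))) = real k0"
      by (subst suminf_finite[of "{..<k0}"]) auto
    also have "(\<Sum>k. e' * ?E k) = e' * (\<Sum>k. ?E k)" by (rule suminf_mult[OF g(1)])
    finally have "d * (\<Sum>k. \<tau> k * ?E k) \<le> d * (real k0 + e' * (\<Sum>k. ?E k))"
      using d by (intro mult_left_mono) auto
    also have "\<dots> = d * real k0 + e' * (d * (\<Sum>k. ?E k))" by (simp add: algebra_simps)
    also have "\<dots> \<le> e / 2 + e / 2"
    proof (rule add_mono)
      have "d * real k0 \<le> e / (2 * (real k0 + 1)) * (real k0 + 1)"
        using d e by (intro mult_mono) (auto simp: d0_def)
      also have "\<dots> = e / 2" by (simp add: divide_simps)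
      finally show "d * real k0 \<le> e / 2" .
      have "e' * (d * (\<Sum>k. ?E k)) \<le> e' * (1 + 1 / l)"
        using g(2) d e' by (intro mult_left_mono) (auto simp: d0_def)
      also have "\<dots> = e / 2"
      proof -
        have "x > 0 \<Longrightarrow> e / (2 * x) * x = e / 2" for x :: real by simp
        moreover have "1 + 1 / l > 0" using l by (simp add: add_pos_pos)
        ultimately show ?thesis unfolding e'_def by blast
      qed
      finally show "e' * (d * (\<Sum>k. ?E k)) \<le> e / 2" .
    qed
    finally show "d * (\<Sum>k. \<tau> k * ?E k) \<le> e" by simp
  qed
  then show ?thesis
    using d0 by (auto simp: eventually_at_right[OF zero_less_one] intro!: exI[of _ d0])
qed

section \<open>General Dirichlet series with subexponential coefficients\<close>

definition subexponential :: "(nat \<Rightarrow> real) \<Rightarrow> bool" where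
  "subexponential y \<longleftrightarrow> (\<forall>r. 0 < r \<longrightarrow> r < 1 \<longrightarrow> summable (\<lambda>k. r ^ k * \<bar>y k\<bar>))"

context
  fixes x y :: "nat \<Rightarrow> real" and c R :: real
  assumes y: "subexponential y" and x: "\<And>k. c * real k - R \<le> x k" and c: "c > 0" and R: "R \<ge> 0"
begin

text \<open>One majorant for all u in \<open>{a..b}\<close>: the slope c gives geometric decay
  already at the smallest exponent a, and the intercept costs at most exp (b * R).\<close>

lemma exp_series_bound:
  assumes "0 < a" "u \<in> {a..b}"
  shows "norm (exp (- (u * x k)) * y k) \<le> exp (b * R) * (exp (- (a * c)) ^ k * \<bar>y k\<bar>)"
proof -
  have "a * (c * real k) \<le> u * (c * real k)" using assms c by (intro mult_right_mono) auto
  moreover have "u * (c * real k - R) \<le> u * x k" using assms x[of k] by (intro mult_left_mono) auto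
  moreover have "u * R \<le> b * R" using assms R by (intro mult_right_mono) auto
  ultimately have "- (u * x k) \<le> b * R + real k * (- (a * c))" by (simp add: algebra_simps)
  then have "exp (- (u * x k)) \<le> exp (b * R) * exp (- (a * c)) ^ k"
    by (simp add: exp_add[symmetric] exp_of_nat_mult[symmetric])
  then show ?thesis by (simp add: abs_mult mult.assoc[symmetric] mult_right_mono)
qed

lemma exp_series_majorant: "0 < a \<Longrightarrow> summable (\<lambda>k. exp (b * R) * (exp (- (a * c)) ^ k * \<bar>y k\<bar>))"
  using y[unfolded subexponential_def, rule_format, of "exp (- (a * c))"] c by (intro summable_mult) simp

lemma exp_series_summable: "0 < u \<Longrightarrow> summable (\<lambda>k. exp (- (u * x k)) * y k)"
  by (rule summable_comparison_test'[OF exp_series_majorant[of u u], of 0])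
    (use exp_series_bound[of u u u] in auto)

lemma exp_series_continuous: "continuous_on {0<..} (\<lambda>u. \<Sum>k. exp (- (u * x k)) * y k)"
proof (rule continuous_at_imp_continuous_on, rule ballI)
  fix u :: real assume u: "u \<in> {0<..}"
  \<comment> \<open>The majorant requires u to stay away from 0 and from infinity; continuity is
    local, so any interval with u in its interior will do.\<close>
  define a b where "a = u / 2" and "b = 2 * u"
  have ab: "0 < a" "u \<in> {a<..<b}" using u by (auto simp: a_def b_def)
  have "uniform_limit {a..b} (\<lambda>n u. \<Sum>k<n. exp (- (u * x k)) * y k) (\<lambda>u. \<Sum>k. exp (- (u * x k)) * y k) sequentially"
    by (rule Weierstrass_m_test[OF exp_series_bound[OF ab(1)] exp_series_majorant[OF ab(1)]])
  then have "continuous_on {a..b} (\<lambda>u. \<Sum>k. exp (- (u * x k)) * y k)"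
    by (rule uniform_limit_theorem[rotated]) (auto intro!: always_eventually continuous_intros)
  then have "continuous_on {a<..<b} (\<lambda>u. \<Sum>k. exp (- (u * x k)) * y k)"
    by (rule continuous_on_subset) auto
  then show "isCont (\<lambda>u. \<Sum>k. exp (- (u * x k)) * y k) u"
    using ab(2) by (simp add: continuous_on_eq_continuous_at)
qed

end

text \<open>Independence is that of the pairs, whereas identical distribution is stated for each
  component: how \<xi> and \<eta> depend on each other within a pair stays arbitrary.\<close>

locale perturbed_walk = prob_space M for M :: "'a measure" +
  fixes \<xi> \<eta> :: "nat \<Rightarrow> 'a \<Rightarrow> real" and \<mu> s :: real
  assumes indep: "indep_vars (\<lambda>_. borel) (\<lambda>k \<omega>. (\<xi> k \<omega>, \<eta> k \<omega>)) {1..}"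
    and \<xi>_law: "\<And>k. 1 \<le> k \<Longrightarrow> distr M borel (\<xi> k) = distr M borel (\<xi> 1)"
    and \<eta>_law: "\<And>k. 1 \<le> k \<Longrightarrow> distr M borel (\<eta> k) = distr M borel (\<eta> 1)"
    and \<xi>_int: "integrable M (\<xi> 1)" and \<xi>_mean: "expectation (\<xi> 1) = \<mu>" and \<mu>_pos: "\<mu> > 0"
    and \<eta>_sq_int: "integrable M (\<lambda>\<omega>. (\<eta> 1 \<omega>)\<^sup>2)" and \<eta>_mean: "expectation (\<eta> 1) = 0"
    and \<eta>_sq: "expectation (\<lambda>\<omega>. (\<eta> 1 \<omega>)\<^sup>2) = s\<^sup>2"
begin

lemma pair_measurable: "1 \<le> k \<Longrightarrow> (\<lambda>\<omega>. (\<xi> k \<omega>, \<eta> k \<omega>)) \<in> M \<rightarrow>\<^sub>M borel \<Otimes>\<^sub>M borel"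
  using indep unfolding indep_vars_def borel_prod by simp

lemma \<xi>_measurable: "1 \<le> k \<Longrightarrow> \<xi> k \<in> borel_measurable M"
  using measurable_comp[OF pair_measurable measurable_fst] by (simp add: comp_def)

lemma \<eta>_measurable: "1 \<le> k \<Longrightarrow> \<eta> k \<in> borel_measurable M"
  using measurable_comp[OF pair_measurable measurable_snd] by (simp add: comp_def)

lemma \<eta>_Suc_measurable[measurable]: "\<eta> (Suc k) \<in> borel_measurable M"
  by (rule \<eta>_measurable) simp

lemma walk_measurable[measurable]: "random_walk \<xi> k \<in> borel_measurable M"
  unfolding random_walk_def[abs_def] by (intro borel_measurable_sum \<xi>_measurable) auto

lemma \<eta>_transfer:
  assumes k: "1 \<le> k" and g[measurable]: "g \<in> borel_measurable borel"
  shows "integrable M (\<lambda>\<omega>. g (\<eta> k \<omega>)) \<longleftrightarrow> integrable M (\<lambda>\<omega>. g (\<eta> 1 \<omega>))"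
    "expectation (\<lambda>\<omega>. g (\<eta> k \<omega>)) = expectation (\<lambda>\<omega>. g (\<eta> 1 \<omega>) :: real)"
proof -
  have [measurable]: "\<eta> k \<in> borel_measurable M" "\<eta> 1 \<in> borel_measurable M"
    using k by (auto intro: \<eta>_measurable)
  show "integrable M (\<lambda>\<omega>. g (\<eta> k \<omega>)) \<longleftrightarrow> integrable M (\<lambda>\<omega>. g (\<eta> 1 \<omega>))"
    using \<eta>_law[OF k] integrable_distr_eq[of "\<eta> k" M borel g] integrable_distr_eq[of "\<eta> 1" M borel g] by simp
  show "expectation (\<lambda>\<omega>. g (\<eta> k \<omega>)) = expectation (\<lambda>\<omega>. g (\<eta> 1 \<omega>))"
    using \<eta>_law[OF k] integral_distr[of "\<eta> k" M borel g] integral_distr[of "\<eta> 1" M borel g] by simp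
qed

lemma \<eta>_sq_integrable: "1 \<le> k \<Longrightarrow> integrable M (\<lambda>\<omega>. (\<eta> k \<omega>)\<^sup>2)"
  using \<eta>_transfer(1)[of k "\<lambda>x. x\<^sup>2"] \<eta>_sq_int by simp

lemma \<eta>_integrable: "1 \<le> k \<Longrightarrow> integrable M (\<eta> k)"
  using square_integrable_imp_integrable[OF \<eta>_measurable \<eta>_sq_integrable] by simp

lemma \<eta>_expectation: "1 \<le> k \<Longrightarrow> expectation (\<eta> k) = 0"
  using \<eta>_transfer(2)[of k "\<lambda>x. x"] \<eta>_mean by simp

lemma \<eta>_second_moment: "1 \<le> k \<Longrightarrow> expectation (\<lambda>\<omega>. (\<eta> k \<omega>)\<^sup>2) = s\<^sup>2"
  using \<eta>_transfer(2)[of k "\<lambda>x. x\<^sup>2"] \<eta>_sq by simp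

text \<open>The first n pairs and the innovation of index n + 1 involve disjoint index sets. G
  stands for whatever has been computed from the past.\<close>

lemma past_indep:
  assumes G[measurable]: "G \<in> borel_measurable (PiM {1..n} (\<lambda>_. borel))"
  shows "indep_var borel (\<lambda>\<omega>. G (\<lambda>i\<in>{1..n}. (\<xi> i \<omega>, \<eta> i \<omega>)) :: real) borel (\<eta> (Suc n))"
proof -
  have "indep_var (PiM {1..n} (\<lambda>_. borel)) (\<lambda>\<omega>. restrict (\<lambda>i. (\<xi> i \<omega>, \<eta> i \<omega>)) {1..n})
      (PiM {Suc n} (\<lambda>_. borel)) (\<lambda>\<omega>. restrict (\<lambda>i. (\<xi> i \<omega>, \<eta> i \<omega>)) {Suc n})"
    by (rule indep_var_restrict[OF indep]) auto
  then have "indep_var borel (G \<circ> (\<lambda>\<omega>. restrict (\<lambda>i. (\<xi> i \<omega>, \<eta> i \<omega>)) {1..n}))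
      borel ((\<lambda>p. snd (p (Suc n))) \<circ> (\<lambda>\<omega>. restrict (\<lambda>i. (\<xi> i \<omega>, \<eta> i \<omega>)) {Suc n}))"
  proof (rule indep_var_compose)
    have "(\<lambda>p. p (Suc n)) \<in> PiM {Suc n} (\<lambda>_. borel) \<rightarrow>\<^sub>M (borel \<Otimes>\<^sub>M borel :: (real \<times> real) measure)"
      using measurable_component_singleton[of "Suc n" "{Suc n}" "\<lambda>_. borel :: (real \<times> real) measure"]
      by (simp add: borel_prod)
    from measurable_compose[OF this measurable_snd]
    show "(\<lambda>p. snd (p (Suc n) :: real \<times> real)) \<in> PiM {Suc n} (\<lambda>_. borel) \<rightarrow>\<^sub>M borel" .
  qed (rule G)
  then show ?thesis by (simp add: comp_def)
qed

text \<open>The weights are predictable: \<open>g k\<close> is evaluated at the walk before time \<open>k + 1\<close>.\<close>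

definition weighted_sum :: "(nat \<Rightarrow> real \<Rightarrow> real) \<Rightarrow> nat \<Rightarrow> 'a \<Rightarrow> real" where
  "weighted_sum g n \<omega> = (\<Sum>k<n. g k (random_walk \<xi> k \<omega>) * \<eta> (Suc k) \<omega>)"

context
  fixes g :: "nat \<Rightarrow> real \<Rightarrow> real" and C :: "nat \<Rightarrow> real"
  assumes g_meas[measurable]: "\<And>k. g k \<in> borel_measurable borel"
    and g_bound: "\<And>k x. \<bar>g k x\<bar> \<le> C k"
begin

lemma weighted_sum_measurable[measurable]: "weighted_sum g n \<in> borel_measurable M"
  unfolding weighted_sum_def[abs_def] by measurable

lemma weighted_sum_past_indep:
  "indep_var borel (\<lambda>\<omega>. weighted_sum g n \<omega> * g n (random_walk \<xi> n \<omega>)) borel (\<eta> (Suc n))"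
  "indep_var borel (\<lambda>\<omega>. (g n (random_walk \<xi> n \<omega>))\<^sup>2) borel (\<eta> (Suc n))"
proof -
  \<comment> \<open>Walk and partial sum are rewritten as functions of the tuple of pairs, which
    exhibits them as depending on the first n pairs only.\<close>
  define w where "w k p = (\<Sum>i=1..k. fst (p i) :: real)" for k and p :: "nat \<Rightarrow> real \<times> real"
  define T where "T p = (\<Sum>k<n. g k (w k p) * snd (p (Suc k)))" for p :: "nat \<Rightarrow> real \<times> real"
  have comp: "(\<lambda>p. p i) \<in> PiM {1..n} (\<lambda>_. borel) \<rightarrow>\<^sub>M (borel \<Otimes>\<^sub>M borel :: (real \<times> real) measure)"
    if "i \<in> {1..n}" for i
    using measurable_component_singleton[OF that, of "\<lambda>_. borel :: (real \<times> real) measure"] by (simp add: borel_prod)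
  have wm: "w k \<in> borel_measurable (PiM {1..n} (\<lambda>_. borel))" if "k \<le> n" for k
    unfolding w_def[abs_def] using that
    by (intro borel_measurable_sum measurable_compose[OF comp measurable_fst]) auto
  have gm: "(\<lambda>p. g k (w k p)) \<in> borel_measurable (PiM {1..n} (\<lambda>_. borel))" if "k \<le> n" for k
    by (rule measurable_compose[OF wm[OF that] g_meas])
  have Tm: "T \<in> borel_measurable (PiM {1..n} (\<lambda>_. borel))"
    unfolding T_def[abs_def]
    by (intro borel_measurable_sum borel_measurable_times gm measurable_compose[OF comp measurable_snd]) auto
  have w: "w k (\<lambda>i\<in>{1..n}. (\<xi> i \<omega>, \<eta> i \<omega>)) = random_walk \<xi> k \<omega>" if "k \<le> n" for k \<omega>
    unfolding w_def random_walk_def using that by (intro sum.cong) auto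
  have T: "T (\<lambda>i\<in>{1..n}. (\<xi> i \<omega>, \<eta> i \<omega>)) = weighted_sum g n \<omega>" for \<omega>
    unfolding T_def weighted_sum_def by (intro sum.cong) (auto simp: w[unfolded One_nat_def])
  show "indep_var borel (\<lambda>\<omega>. weighted_sum g n \<omega> * g n (random_walk \<xi> n \<omega>)) borel (\<eta> (Suc n))"
    using past_indep[OF borel_measurable_times[OF Tm gm[OF order_refl]]] unfolding T w[OF order_refl] .
  show "indep_var borel (\<lambda>\<omega>. (g n (random_walk \<xi> n \<omega>))\<^sup>2) borel (\<eta> (Suc n))"
    using past_indep[OF borel_measurable_power[OF gm[OF order_refl], of 2]] unfolding w[OF order_refl] .
qed

text \<open>Martingale differences are orthogonal: past sum times weight is independent of the
  centered next innovation, so the cross term has mean zero. Boundedness of the weights supplies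
  integrability.\<close>

lemma weighted_sum_second_moment:
  "integrable M (\<lambda>\<omega>. (weighted_sum g n \<omega>)\<^sup>2) \<and>
   expectation (\<lambda>\<omega>. (weighted_sum g n \<omega>)\<^sup>2) = s\<^sup>2 * (\<Sum>k<n. expectation (\<lambda>\<omega>. (g k (random_walk \<xi> k \<omega>))\<^sup>2))"
proof (induction n)
  case 0
  then show ?case by (simp add: weighted_sum_def)
next
  case (Suc n)
  let ?T = "weighted_sum g n" and ?g = "\<lambda>\<omega>. g n (random_walk \<xi> n \<omega>)" and ?e = "\<eta> (Suc n)"
  have Ti: "integrable M ?T"
    by (rule square_integrable_imp_integrable[OF weighted_sum_measurable conjunct1[OF Suc.IH]])
  have gb: "AE \<omega> in M. norm (?g \<omega>) \<le> C n" using g_bound by (intro AE_I2) simp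
  have gi: "integrable M (\<lambda>\<omega>. (?g \<omega>)\<^sup>2)"
  proof (rule integrable_const_bound[of _ "(C n)\<^sup>2"])
    show "AE \<omega> in M. norm ((?g \<omega>)\<^sup>2) \<le> (C n)\<^sup>2"
    proof (rule AE_I2)
      fix \<omega>
      have "\<bar>?g \<omega>\<bar>\<^sup>2 \<le> (C n)\<^sup>2" using g_bound[of n] by (intro power_mono) auto
      then show "norm ((?g \<omega>)\<^sup>2) \<le> (C n)\<^sup>2" by simp
    qed
  qed measurable
  have Tgi: "integrable M (\<lambda>\<omega>. ?T \<omega> * ?g \<omega>)"
  proof (rule Bochner_Integration.integrable_bound[OF integrable_mult_right[OF Ti, of "C n"]])
    show "AE \<omega> in M. norm (?T \<omega> * ?g \<omega>) \<le> norm (C n * ?T \<omega>)"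
    proof (rule AE_I2)
      fix \<omega>
      have "\<bar>?T \<omega>\<bar> * \<bar>?g \<omega>\<bar> \<le> \<bar>?T \<omega>\<bar> * \<bar>C n\<bar>"
        using g_bound[of n "random_walk \<xi> n \<omega>"] by (intro mult_left_mono) auto
      then show "norm (?T \<omega> * ?g \<omega>) \<le> norm (C n * ?T \<omega>)" by (simp add: abs_mult mult.commute)
    qed
  qed measurable
  note ip = weighted_sum_past_indep[of n]
  have e: "integrable M ?e" "integrable M (\<lambda>\<omega>. (?e \<omega>)\<^sup>2)" by (auto intro: \<eta>_integrable \<eta>_sq_integrable)
  have ip2: "indep_var borel (\<lambda>\<omega>. (?g \<omega>)\<^sup>2) borel (\<lambda>\<omega>. (?e \<omega>)\<^sup>2)"
    using indep_var_compose[OF ip(2), of "\<lambda>x. x" borel "\<lambda>x. x\<^sup>2" borel] by (simp add: comp_def)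
  have cross: "integrable M (\<lambda>\<omega>. ?T \<omega> * ?g \<omega> * ?e \<omega>)" "expectation (\<lambda>\<omega>. ?T \<omega> * ?g \<omega> * ?e \<omega>) = 0"
    using indep_var_integrable[OF ip(1) Tgi e(1)] indep_var_lebesgue_integral[OF ip(1) Tgi e(1)] \<eta>_expectation[of "Suc n"]
    by auto
  have diag: "integrable M (\<lambda>\<omega>. (?g \<omega>)\<^sup>2 * (?e \<omega>)\<^sup>2)"
      "expectation (\<lambda>\<omega>. (?g \<omega>)\<^sup>2 * (?e \<omega>)\<^sup>2) = expectation (\<lambda>\<omega>. (?g \<omega>)\<^sup>2) * s\<^sup>2"
    using indep_var_integrable[OF ip2 gi e(2)] indep_var_lebesgue_integral[OF ip2 gi e(2)] \<eta>_second_moment[of "Suc n"]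
    by auto
  have eq: "(\<lambda>\<omega>. (weighted_sum g (Suc n) \<omega>)\<^sup>2) = (\<lambda>\<omega>. (?T \<omega>)\<^sup>2 + 2 * (?T \<omega> * ?g \<omega> * ?e \<omega>) + (?g \<omega>)\<^sup>2 * (?e \<omega>)\<^sup>2)"
    by (simp add: fun_eq_iff weighted_sum_def power2_eq_square algebra_simps)
  have i2: "integrable M (\<lambda>\<omega>. 2 * (?T \<omega> * ?g \<omega> * ?e \<omega>))" using cross by simp
  have T2: "integrable M (\<lambda>\<omega>. (?T \<omega>)\<^sup>2)" by (rule conjunct1[OF Suc.IH])
  have "expectation (\<lambda>\<omega>. (?T \<omega>)\<^sup>2 + 2 * (?T \<omega> * ?g \<omega> * ?e \<omega>) + (?g \<omega>)\<^sup>2 * (?e \<omega>)\<^sup>2) =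
      expectation (\<lambda>\<omega>. (?T \<omega>)\<^sup>2) + 2 * 0 + expectation (\<lambda>\<omega>. (?g \<omega>)\<^sup>2) * s\<^sup>2"
    using T2 i2 diag cross(2) by simp
  then show ?case
    unfolding eq using T2 i2 diag(1) by (simp add: conjunct2[OF Suc.IH] distrib_left mult.commute)
qed

text \<open>Fatou's lemma carries the bound from partial sums to the almost sure limit.\<close>

lemma weighted_series_second_moment:
  assumes q: "\<And>k. expectation (\<lambda>\<omega>. (g k (random_walk \<xi> k \<omega>))\<^sup>2) \<le> q k" "summable q"
    and D: "AE \<omega> in M. (\<lambda>n. weighted_sum g n \<omega>) \<longlonglongrightarrow> D \<omega>"
  shows "(\<integral>\<^sup>+\<omega>. ennreal ((D \<omega>)\<^sup>2) \<partial>M) \<le> ennreal (s\<^sup>2 * suminf q)"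
proof -
  have "(\<integral>\<^sup>+\<omega>. ennreal ((D \<omega>)\<^sup>2) \<partial>M) = (\<integral>\<^sup>+\<omega>. liminf (\<lambda>n. ennreal ((weighted_sum g n \<omega>)\<^sup>2)) \<partial>M)"
  proof (rule nn_integral_cong_AE)
    show "AE \<omega> in M. ennreal ((D \<omega>)\<^sup>2) = liminf (\<lambda>n. ennreal ((weighted_sum g n \<omega>)\<^sup>2))"
      using D
    proof eventually_elim
      case (elim \<omega>)
      then have "(\<lambda>n. ennreal ((weighted_sum g n \<omega>)\<^sup>2)) \<longlonglongrightarrow> ennreal ((D \<omega>)\<^sup>2)"
        by (intro tendsto_ennrealI tendsto_power)
      then show ?case by (intro lim_imp_Liminf[symmetric]) auto
    qed
  qed
  also have "\<dots> \<le> liminf (\<lambda>n. \<integral>\<^sup>+\<omega>. ennreal ((weighted_sum g n \<omega>)\<^sup>2) \<partial>M)"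
    by (rule nn_integral_liminf) measurable
  also have "\<dots> \<le> ennreal (s\<^sup>2 * suminf q)"
  proof (intro Liminf_le always_eventually allI)
    fix n
    have q0: "0 \<le> q k" for k using q(1)[of k] by (rule order_trans[rotated]) simp
    have "(\<integral>\<^sup>+\<omega>. ennreal ((weighted_sum g n \<omega>)\<^sup>2) \<partial>M) = ennreal (expectation (\<lambda>\<omega>. (weighted_sum g n \<omega>)\<^sup>2))"
      using weighted_sum_second_moment[of n] by (intro nn_integral_eq_integral) auto
    also have "\<dots> \<le> ennreal (s\<^sup>2 * suminf q)"
    proof (rule ennreal_leI)
      have "(\<Sum>k<n. expectation (\<lambda>\<omega>. (g k (random_walk \<xi> k \<omega>))\<^sup>2)) \<le> (\<Sum>k<n. q k)" by (intro sum_mono q)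
      also have "\<dots> \<le> suminf q" by (rule sum_le_suminf[OF q(2)]) (auto simp: q0)
      finally show "expectation (\<lambda>\<omega>. (weighted_sum g n \<omega>)\<^sup>2) \<le> s\<^sup>2 * suminf q"
        using weighted_sum_second_moment[of n] by (simp add: mult_left_mono)
    qed
    finally show "(\<integral>\<^sup>+\<omega>. ennreal ((weighted_sum g n \<omega>)\<^sup>2) \<partial>M) \<le> ennreal (s\<^sup>2 * suminf q)" .
  qed simp
  finally show ?thesis .
qed

end

section \<open>Almost sure behaviour of the walk and of the innovations\<close>

lemma walk_eq: "random_walk \<xi> k \<omega> = (\<Sum>i<k. \<xi> (Suc i) \<omega>)"
  by (simp add: random_walk_def sum.atLeast1_atMost_eq)

text \<open>Moves the first index from 1 to 0, the indexing of the law of large numbers and of the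
  central limit theorem.\<close>

lemma pairs_shift: "indep_vars (\<lambda>_. borel) (\<lambda>i \<omega>. (\<xi> (Suc i) \<omega>, \<eta> (Suc i) \<omega>)) UNIV"
proof -
  have "indep_vars (\<lambda>j. PiM {Suc j} (\<lambda>_. borel)) (\<lambda>j \<omega>. restrict (\<lambda>i. (\<xi> i \<omega>, \<eta> i \<omega>)) {Suc j}) UNIV"
    by (rule indep_vars_restrict[OF indep]) (auto simp: disjoint_family_on_def)
  from indep_vars_compose2[OF this, of "\<lambda>j p. p (Suc j)" "\<lambda>_. borel"]
  show ?thesis by (simp add: measurable_component_singleton)
qed

lemma \<xi>_iid:
  "indep_vars (\<lambda>_. borel) (\<lambda>i. \<xi> (Suc i)) UNIV"
  "distr M borel (\<xi> (Suc i)) = distr M borel (\<xi> (Suc 0))"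
  "integrable M (\<xi> (Suc 0))"
proof -
  show "indep_vars (\<lambda>_. borel) (\<lambda>i. \<xi> (Suc i)) UNIV"
    using indep_vars_compose2[OF pairs_shift, of "\<lambda>_. fst" "\<lambda>_. borel"] by (simp add: borel_prod[symmetric])
  show "distr M borel (\<xi> (Suc i)) = distr M borel (\<xi> (Suc 0))"
    using \<xi>_law[of "Suc i"] by simp
  show "integrable M (\<xi> (Suc 0))" using \<xi>_int by simp
qed

lemma \<eta>_iid: "indep_vars (\<lambda>_. borel) (\<lambda>i. \<eta> (Suc i)) UNIV"
  using indep_vars_compose2[OF pairs_shift, of "\<lambda>_. snd" "\<lambda>_. borel"] by (simp add: borel_prod[symmetric])

lemma walk_lln: "AE \<omega> in M. (\<lambda>k. random_walk \<xi> k \<omega> / real k) \<longlonglongrightarrow> \<mu>"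
  using strong_law_of_large_numbers[OF \<xi>_iid] \<xi>_mean by (simp add: walk_eq)

text \<open>Any slope below \<mu> would do. The intercept is rounded up to a natural number so that
  the exceptional events form a sequence in R.\<close>

lemma walk_lower_bound: "AE \<omega> in M. \<exists>R::nat. \<forall>k. \<mu> / 2 * real k - real R \<le> random_walk \<xi> k \<omega>"
proof -
  have "AE \<omega> in M. \<exists>b. \<forall>k. - 1 * (\<Sum>i<k. \<xi> (Suc i) \<omega>) \<le> (- \<mu> / 2) * real k + b"
    using \<mu>_pos \<xi>_mean by (intro AE_partial_sums_le_linear[OF \<xi>_iid]) auto
  then show ?thesis
  proof eventually_elim
    case (elim \<omega>)
    then obtain b where b: "\<And>k. - 1 * (\<Sum>i<k. \<xi> (Suc i) \<omega>) \<le> (- \<mu> / 2) * real k + b" by blast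
    obtain R :: nat where "b \<le> real R" using real_arch_simple by blast
    then have "\<mu> / 2 * real k - real R \<le> random_walk \<xi> k \<omega>" for k
      using b[of k] by (simp add: walk_eq)
    then show ?case by blast
  qed
qed

text \<open>For fixed r the series has finite mean. Holding for all r outside one null set, the
  property gives convergence for every u and every \<delta> simultaneously.\<close>

lemma \<eta>_subexponential: "AE \<omega> in M. subexponential (\<lambda>k. \<eta> (Suc k) \<omega>)"
proof -
  let ?A = "expectation (\<lambda>\<omega>. \<bar>\<eta> 1 \<omega>\<bar>)"
  have *: "AE \<omega> in M. summable (\<lambda>k. r ^ k * \<bar>\<eta> (Suc k) \<omega>\<bar>)" if r: "0 < r" "r < 1" for r
  proof -
    have "(\<integral>\<^sup>+\<omega>. ennreal (r ^ k * \<bar>\<eta> (Suc k) \<omega>\<bar>) \<partial>M) = ennreal (r ^ k * ?A)" for k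
    proof -
      have "integrable M (\<lambda>\<omega>. r ^ k * \<bar>\<eta> (Suc k) \<omega>\<bar>)"
        using \<eta>_integrable[of "Suc k"] by auto
      then have "(\<integral>\<^sup>+\<omega>. ennreal (r ^ k * \<bar>\<eta> (Suc k) \<omega>\<bar>) \<partial>M) = ennreal (expectation (\<lambda>\<omega>. r ^ k * \<bar>\<eta> (Suc k) \<omega>\<bar>))"
        using r by (intro nn_integral_eq_integral) auto
      then show ?thesis using \<eta>_transfer(2)[of "Suc k" abs] by simp
    qed
    then have "(\<integral>\<^sup>+\<omega>. (\<Sum>k. ennreal (r ^ k * \<bar>\<eta> (Suc k) \<omega>\<bar>)) \<partial>M) = (\<Sum>k. ennreal (r ^ k * ?A))"
      by (subst nn_integral_suminf) auto
    also have "\<dots> = ennreal (\<Sum>k. r ^ k * ?A)"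
      using r by (intro suminf_ennreal2) (auto intro!: summable_mult2 summable_geometric)
    finally have "(\<integral>\<^sup>+\<omega>. (\<Sum>k. ennreal (r ^ k * \<bar>\<eta> (Suc k) \<omega>\<bar>)) \<partial>M) \<noteq> \<infinity>" by simp
    then have "AE \<omega> in M. (\<Sum>k. ennreal (r ^ k * \<bar>\<eta> (Suc k) \<omega>\<bar>)) \<noteq> \<infinity>"
      by (intro nn_integral_PInf_AE) measurable
    then show ?thesis
      by eventually_elim (use r in \<open>auto intro!: summable_suminf_not_top\<close>)
  qed
  \<comment> \<open>Countably many radii approaching 1 suffice, since convergence for one radius
    implies it for all smaller ones.\<close>
  have "AE \<omega> in M. \<forall>i::nat. summable (\<lambda>k. (1 - 1 / (real i + 2)) ^ k * \<bar>\<eta> (Suc k) \<omega>\<bar>)"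
    unfolding AE_all_countable by (intro allI *) (simp_all add: divide_less_eq_1)
  then show ?thesis
  proof eventually_elim
    case (elim \<omega>)
    show ?case
      unfolding subexponential_def
    proof (intro allI impI)
      fix r :: real assume r: "0 < r" "r < 1"
      obtain i :: nat where i: "1 / (1 - r) < real i" using reals_Archimedean2 by blast
      then have "1 < (1 - r) * real i" using r by (simp add: field_simps)
      also have "\<dots> \<le> (1 - r) * (real i + 2)" using r by (intro mult_left_mono) auto
      finally have le: "r \<le> 1 - 1 / (real i + 2)" by (simp add: field_simps)
      show "summable (\<lambda>k. r ^ k * \<bar>\<eta> (Suc k) \<omega>\<bar>)"
        by (rule summable_comparison_test'[OF elim[rule_format, of i], of 0])
          (use r le in \<open>auto simp: abs_mult intro!: mult_right_mono power_mono\<close>)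
    qed
  qed
qed

end

section \<open>Approximation by block sums\<close>

text \<open>Cutting the walk off below a line of slope \<open>\<mu> / 2\<close> keeps the weights predictable and makes
  all second moments finite; by the law of large numbers it changes nothing with probability close
  to one.\<close>

definition cutoff :: "real \<Rightarrow> real \<Rightarrow> nat \<Rightarrow> real \<Rightarrow> real" where
  "cutoff \<mu> R k x = max x (\<mu> / 2 * real k - R)"

text \<open>On the scale \<delta> * S_k a step advances by \<mu> * \<delta> on average, so a block
  corresponds to a time span of about 1 / m.\<close>

definition block_length :: "real \<Rightarrow> nat \<Rightarrow> real \<Rightarrow> nat" where
  "block_length \<mu> m \<delta> = nat \<lfloor>1 / (real m * \<delta> * \<mu>)\<rfloor>"

text \<open>The left end of the block is used as time, and the weight vanishes beyond the horizon.
  If the block length is 0, the first case is empty and the division by 0 is never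
  evaluated.\<close>

definition block_weight :: "real \<Rightarrow> nat \<Rightarrow> real \<Rightarrow> real \<Rightarrow> nat \<Rightarrow> real" where
  "block_weight \<mu> m \<delta> u k = (if k < m * m * block_length \<mu> m \<delta>
     then exp (- (u * (real (k div block_length \<mu> m \<delta>) / real m))) else 0)"

text \<open>The factor (1 - b^2)^(1/2) for b = exp (- \<delta>).\<close>

definition norming :: "real \<Rightarrow> real" where
  "norming \<delta> = sqrt (1 - exp (- (2 * \<delta>)))"

lemma norming_sq: "\<delta> > 0 \<Longrightarrow> (norming \<delta>)\<^sup>2 \<le> 2 * \<delta>"
  using exp_ge_add_one_self[of "- (2 * \<delta>)"] by (simp add: norming_def)

section \<open>Deterministic estimates for the weights\<close>

lemma block_length_bounds:
  assumes "m \<ge> 1" "\<delta> > 0" "\<mu> > 0"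
  shows "real (block_length \<mu> m \<delta>) * (\<delta> * \<mu>) \<le> 1 / real m"
    "1 / real m - \<delta> * \<mu> < real (block_length \<mu> m \<delta>) * (\<delta> * \<mu>)"
proof -
  define x where "x = 1 / (real m * \<delta> * \<mu>)"
  have x: "x \<ge> 0" "x * (\<delta> * \<mu>) = 1 / real m" using assms by (auto simp: x_def)
  have "real (nat \<lfloor>x\<rfloor>) = of_int \<lfloor>x\<rfloor>" using x(1) by simp
  then have n: "real (nat \<lfloor>x\<rfloor>) \<le> x" "x - 1 < real (nat \<lfloor>x\<rfloor>)" by linarith+
  have p: "\<delta> * \<mu> > 0" using assms by simp
  show "real (block_length \<mu> m \<delta>) * (\<delta> * \<mu>) \<le> 1 / real m"
    using mult_right_mono[OF n(1), of "\<delta> * \<mu>"] p x(2) by (simp add: block_length_def x_def)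
  have "(x - 1) * (\<delta> * \<mu>) < real (nat \<lfloor>x\<rfloor>) * (\<delta> * \<mu>)" using n(2) p by (rule mult_strict_right_mono)
  then show "1 / real m - \<delta> * \<mu> < real (block_length \<mu> m \<delta>) * (\<delta> * \<mu>)"
    using x(2) by (simp add: block_length_def x_def left_diff_distrib)
qed

text \<open>Block time lags by at most one block, hence the 1 / m. Rounding the block length down
  loses at most \<delta> * \<mu> per block, and there are at most m * m blocks.\<close>

lemma block_div_bounds:
  assumes m: "m \<ge> 1" and d: "\<delta> > 0" and \<mu>: "\<mu> > 0" and n: "block_length \<mu> m \<delta> > 0"
  shows "\<delta> * \<mu> * real k \<le> real (k div block_length \<mu> m \<delta>) / real m + 1 / real m"
    "k < m * m * block_length \<mu> m \<delta> \<Longrightarrow>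
      real (k div block_length \<mu> m \<delta>) / real m - real (m * m) * (\<delta> * \<mu>) \<le> \<delta> * \<mu> * real k"
proof -
  let ?n = "block_length \<mu> m \<delta>"
  define q where "q = k div ?n"
  note b = block_length_bounds[OF m d \<mu>]
  have p: "\<delta> * \<mu> > 0" using d \<mu> by simp
  have "k < (q + 1) * ?n" unfolding q_def using n by (metis Suc_eq_plus1 dividend_less_div_times mult.commute mult_Suc add.commute)
  then have k: "real k \<le> (real q + 1) * real ?n" by (metis less_imp_le of_nat_1 of_nat_add of_nat_le_iff of_nat_mult)
  have "\<delta> * \<mu> * real k \<le> \<delta> * \<mu> * ((real q + 1) * real ?n)" using k p by (intro mult_left_mono) auto
  also have "\<dots> = (real q + 1) * (real ?n * (\<delta> * \<mu>))" by (simp add: mult_ac)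
  also have "\<dots> \<le> (real q + 1) * (1 / real m)" by (intro mult_left_mono b) auto
  finally show "\<delta> * \<mu> * real k \<le> real (k div ?n) / real m + 1 / real m"
    by (simp add: q_def add_divide_distrib)
  assume "k < m * m * ?n"
  then have qm: "q < m * m" unfolding q_def using n by (simp add: less_mult_imp_div_less)
  have "q * ?n \<le> k" unfolding q_def by simp
  then have "real q * real ?n \<le> real k" by (metis of_nat_le_iff of_nat_mult)
  then have "\<delta> * \<mu> * (real q * real ?n) \<le> \<delta> * \<mu> * real k" using p by (intro mult_left_mono) auto
  moreover have "real q * (1 / real m - \<delta> * \<mu>) \<le> real q * (real ?n * (\<delta> * \<mu>))"
    using b(2) by (intro mult_left_mono) auto
  moreover have "real q * (\<delta> * \<mu>) \<le> real (m * m) * (\<delta> * \<mu>)"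
    using qm p by (intro mult_right_mono) (simp_all only: of_nat_le_iff less_imp_le)
  moreover have "\<delta> * \<mu> * (real q * real ?n) = real q * (real ?n * (\<delta> * \<mu>))" by (simp only: mult_ac)
  moreover have "real q * (1 / real m - \<delta> * \<mu>) = real q / real m - real q * (\<delta> * \<mu>)"
    by (simp add: right_diff_distrib)
  ultimately show "real (k div ?n) / real m - real (m * m) * (\<delta> * \<mu>) \<le> \<delta> * \<mu> * real k"
    unfolding q_def by linarith
qed

lemma cutoff_ge: "\<mu> / 2 * real k - R \<le> cutoff \<mu> R k x"
  by (simp add: cutoff_def)

text \<open>Block time trails \<delta> * \<mu> * k by at most 1, which costs the factor exp a. The
  decay rate is halved to agree with \<open>cutoff_weight_increment\<close>, so that one geometric
  series serves both.\<close>

lemma block_weight_increment: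
  assumes m: "m \<ge> 1" and d: "\<delta> > 0" and \<mu>: "\<mu> > 0" and a: "0 < a" and u: "u \<in> {a..c}" and v: "v \<in> {a..c}"
  shows "(block_weight \<mu> m \<delta> u k - block_weight \<mu> m \<delta> v k)\<^sup>2 \<le>
    exp_lip_const a c * (exp a * exp (- (a * \<mu> / 2 * \<delta> * real k))) * (u - v)\<^sup>2"
proof (cases "k < m * m * block_length \<mu> m \<delta>")
  case False
  then show ?thesis using exp_lip_const_nonneg[of a c] by (simp add: block_weight_def)
next
  case True
  then have n: "block_length \<mu> m \<delta> > 0" by (cases "block_length \<mu> m \<delta>") auto
  let ?y = "real (k div block_length \<mu> m \<delta>) / real m"
  have bw: "block_weight \<mu> m \<delta> w k = exp (- (w * ?y))" for w
    using True by (simp only: block_weight_def if_True)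
  have "?y \<ge> 0" by simp
  then have "?y \<ge> -1" by linarith
  then have "(block_weight \<mu> m \<delta> u k - block_weight \<mu> m \<delta> v k)\<^sup>2 \<le> exp_lip_const a c * exp (- (a * ?y)) * (u - v)\<^sup>2"
    unfolding bw by (rule exp_param_diff_sq[OF a u v])
  also have "\<dots> \<le> exp_lip_const a c * (exp a * exp (- (a * \<mu> / 2 * \<delta> * real k))) * (u - v)\<^sup>2"
  proof -
    have "1 / real m \<le> 1" using m by simp
    then have "\<delta> * \<mu> * real k - 1 \<le> ?y" using block_div_bounds(1)[OF m d \<mu> n, of k] by linarith
    moreover have "\<delta> * \<mu> * real k / 2 \<le> \<delta> * \<mu> * real k" using d \<mu> by simp
    ultimately have "a * (\<delta> * \<mu> * real k / 2 - 1) \<le> a * ?y" using a by (intro mult_left_mono) auto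
    then have "exp (- (a * ?y)) \<le> exp a * exp (- (a * \<mu> / 2 * \<delta> * real k))"
      unfolding exp_add[symmetric] by (simp add: algebra_simps)
    then show ?thesis
      using exp_lip_const_nonneg[of a c] by (intro mult_left_mono mult_right_mono) auto
  qed
  finally show ?thesis .
qed

text \<open>The condition \<open>\<delta> * R \<le> 1\<close> keeps the scaled cut-off walk above
  -1, as \<open>exp_param_diff_sq\<close> demands. The bound does not involve the value x of the
  walk.\<close>

lemma cutoff_weight_increment:
  assumes d: "\<delta> > 0" and \<mu>: "\<mu> > 0" and dR: "\<delta> * R \<le> 1" and a: "0 < a" and u: "u \<in> {a..c}" and v: "v \<in> {a..c}"
  shows "(exp (- (u * (\<delta> * cutoff \<mu> R k x))) - exp (- (v * (\<delta> * cutoff \<mu> R k x))))\<^sup>2 \<le>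
    exp_lip_const a c * (exp a * exp (- (a * \<mu> / 2 * \<delta> * real k))) * (u - v)\<^sup>2"
proof -
  let ?y = "\<delta> * cutoff \<mu> R k x"
  have "\<delta> * (\<mu> / 2 * real k - R) \<le> ?y" using d by (intro mult_left_mono cutoff_ge) auto
  then have y: "\<delta> * (\<mu> / 2 * real k) - 1 \<le> ?y" using dR by (simp add: right_diff_distrib)
  moreover have "0 \<le> \<delta> * (\<mu> / 2 * real k)" using d \<mu> by simp
  ultimately have "-1 \<le> ?y" by linarith
  then have "(exp (- (u * ?y)) - exp (- (v * ?y)))\<^sup>2 \<le> exp_lip_const a c * exp (- (a * ?y)) * (u - v)\<^sup>2"
    by (rule exp_param_diff_sq[OF a u v])
  also have "\<dots> \<le> exp_lip_const a c * (exp a * exp (- (a * \<mu> / 2 * \<delta> * real k))) * (u - v)\<^sup>2"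
  proof -
    have "a * (\<delta> * (\<mu> / 2 * real k) - 1) \<le> a * ?y" using a y by (intro mult_left_mono) auto
    then have "exp (- (a * ?y)) \<le> exp a * exp (- (a * \<mu> / 2 * \<delta> * real k))"
      unfolding exp_add[symmetric] by (simp add: algebra_simps)
    then show ?thesis
      using exp_lip_const_nonneg[of a c] by (intro mult_left_mono mult_right_mono) auto
  qed
  finally show ?thesis .
qed

text \<open>Of two bounds for the difference of the exponentials, one is proportional to the
  deviation of x / k from \<mu> and one ignores it; together they give the truncated square, whose
  mean tends to 0 without a second moment of \<xi>.\<close>

lemma cutoff_weight_close:
  assumes d: "\<delta> > 0" and \<mu>: "\<mu> > 0" and R: "R \<ge> 0" and dR: "\<delta> * R \<le> 1" and u: "u > 0"
    and x0: "k = 0 \<Longrightarrow> x = 0"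
  shows "(exp (- (u * (\<delta> * cutoff \<mu> R k x))) - exp (- (u * (\<delta> * \<mu> * real k))))\<^sup>2 \<le>
    exp (2 * u) * (1 + 16 / \<mu>\<^sup>2) * (min 1 ((x / real k - \<mu>)\<^sup>2) * exp (- (u * \<mu> / 2 * \<delta> * real k)))"
proof (cases "k = 0")
  \<comment> \<open>For k = 0 the quotient x / k is the default 0, but both weights equal 1.\<close>
  case True
  then show ?thesis using R x0 by (simp add: cutoff_def)
next
  case False
  then have k: "real k > 0" by simp
  define y where "y = cutoff \<mu> R k x"
  define D where "D = \<bar>x / real k - \<mu>\<bar>"
  define t where "t = u * \<delta> * real k"
  \<comment> \<open>A common upper bound for both exponents: the cutoff line has slope \<mu> / 2,
    and its scaled intercept \<delta> * R costs at most u.\<close>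
  define r where "r = u - t * \<mu> / 2"
  have t: "t > 0" using u d k by (simp add: t_def)
  have e1: "- (u * (\<delta> * \<mu> * real k)) = - (t * \<mu>)" by (simp add: t_def mult_ac)
  have "t * \<mu> > 0" using t \<mu> by simp
  then have le1: "- (t * \<mu>) \<le> r" using u by (simp add: r_def)
  have le2: "- (u * (\<delta> * y)) \<le> r"
  proof -
    have "u * \<delta> * (\<mu> / 2 * real k - R) \<le> u * \<delta> * y"
      unfolding y_def using u d by (intro mult_left_mono cutoff_ge) auto
    moreover have "u * (\<delta> * R) \<le> u * 1" using dR u by (intro mult_left_mono) auto
    ultimately show ?thesis by (simp add: r_def t_def algebra_simps)
  qed
  have dist: "\<bar>y - \<mu> * real k\<bar> \<le> real k * D"
  proof -
    \<comment> \<open>The cutoff line lies below \<mu> * k, so raising the walk to it cannot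
      increase the distance from \<mu> * k.\<close>
    have "\<mu> / 2 * real k - R \<le> \<mu> * real k" using mult_pos_pos[OF \<mu> k] R by simp
    then have "\<bar>y - \<mu> * real k\<bar> \<le> \<bar>x - \<mu> * real k\<bar>" by (auto simp: y_def cutoff_def max_def)
    also have "x - \<mu> * real k = real k * (x / real k - \<mu>)" using k by (simp add: field_simps)
    finally show ?thesis using k by (simp add: abs_mult D_def)
  qed
  let ?diff = "\<bar>exp (- (u * (\<delta> * y))) - exp (- (t * \<mu>))\<bar>"
  have "?diff \<le> \<bar>- (u * (\<delta> * y)) - - (t * \<mu>)\<bar> * exp r" by (rule exp_diff_le[OF le2 le1])
  also have "- (u * (\<delta> * y)) - - (t * \<mu>) = - (u * \<delta> * (y - \<mu> * real k))" by (simp add: t_def algebra_simps)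
  also have "\<bar>- (u * \<delta> * (y - \<mu> * real k))\<bar> \<le> u * \<delta> * (real k * D)"
    using dist u d by (simp add: abs_mult mult_left_mono)
  finally have b1: "?diff \<le> t * D * exp r" by (simp add: t_def mult_ac mult_right_mono)
  have "exp (- (u * (\<delta> * y))) \<le> exp r" "exp (- (t * \<mu>)) \<le> exp r" using le1 le2 by simp_all
  then have b2: "?diff \<le> exp r" using exp_gt_zero[of "- (u * (\<delta> * y))"] exp_gt_zero[of "- (t * \<mu>)"] by linarith
  have "?diff\<^sup>2 \<le> (1 + t\<^sup>2) * min 1 (D\<^sup>2) * (exp r)\<^sup>2"
  proof (cases "D\<^sup>2 \<le> 1")
    case True
    have "?diff\<^sup>2 \<le> (t * D * exp r)\<^sup>2" using b1 by (intro power_mono) auto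
    also have "\<dots> = t\<^sup>2 * D\<^sup>2 * (exp r)\<^sup>2" by (simp add: power_mult_distrib)
    also have "\<dots> \<le> (1 + t\<^sup>2) * D\<^sup>2 * (exp r)\<^sup>2" by (intro mult_right_mono) auto
    finally show ?thesis using True by simp
  next
    case False
    have "?diff\<^sup>2 \<le> (exp r)\<^sup>2" using b2 by (intro power_mono) auto
    also have "\<dots> \<le> (1 + t\<^sup>2) * (exp r)\<^sup>2" by (simp add: distrib_right)
    finally show ?thesis using False by simp
  qed
  also have "\<dots> = exp (2 * u) * min 1 (D\<^sup>2) * ((1 + t\<^sup>2) * exp (- (t * \<mu> / 2)) * exp (- (t * \<mu> / 2)))"
  proof -
    have "(exp r)\<^sup>2 = exp (2 * u) * (exp (- (t * \<mu> / 2)) * exp (- (t * \<mu> / 2)))"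
      unfolding power2_eq_square exp_add[symmetric] by (simp add: r_def)
    then show ?thesis by (simp add: mult_ac)
  qed
  also have "\<dots> \<le> exp (2 * u) * min 1 (D\<^sup>2) * ((1 + 16 / \<mu>\<^sup>2) * exp (- (t * \<mu> / 2)))"
  proof (intro mult_left_mono mult_right_mono)
    \<comment> \<open>Half of the exponential decay is spent on the factor 1 + t^2; the other half
      remains for the sum over k.\<close>
    have "t * \<mu> / 4 \<le> exp (t * \<mu> / 4)" using exp_ge_add_one_self[of "t * \<mu> / 4"] by linarith
    then have "(t * \<mu> / 4)\<^sup>2 \<le> (exp (t * \<mu> / 4))\<^sup>2" using t \<mu> by (intro power_mono) auto
    also have "(exp (t * \<mu> / 4))\<^sup>2 = exp (t * \<mu> / 2)" by (simp add: power2_eq_square exp_add[symmetric])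
    finally have "t\<^sup>2 \<le> 16 / \<mu>\<^sup>2 * exp (t * \<mu> / 2)" using \<mu> by (simp add: field_simps power2_eq_square)
    moreover have "1 \<le> exp (t * \<mu> / 2)" using t \<mu> by simp
    ultimately have "1 + t\<^sup>2 \<le> (1 + 16 / \<mu>\<^sup>2) * exp (t * \<mu> / 2)"
      unfolding distrib_right mult_1_left by linarith
    then show "(1 + t\<^sup>2) * exp (- (t * \<mu> / 2)) \<le> 1 + 16 / \<mu>\<^sup>2"
      by (simp add: exp_minus field_simps)
  qed auto
  finally show ?thesis by (simp add: D_def y_def t_def mult_ac)
qed

text \<open>Within the horizon the two times differ by at most 2 / m: one block of lag plus the
  accumulated rounding, which \<open>small\<close> keeps below 1 / m. Beyond it the time already
  exceeds m / 2, and half of the squared exponential is given up to make this small.\<close>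

lemma block_weight_close:
  assumes m: "m \<ge> 2" and d: "\<delta> > 0" and \<mu>: "\<mu> > 0" and small: "real (m * m) * (\<delta> * \<mu>) \<le> 1 / real m" and u: "u > 0"
  shows "(exp (- (u * (\<delta> * \<mu> * real k))) - block_weight \<mu> m \<delta> u k)\<^sup>2 \<le>
    (if k \<in> {..<m * m * block_length \<mu> m \<delta>} then 4 * u\<^sup>2 / (real m)\<^sup>2 else 0) +
      exp (- (u * (real m / 2))) * exp (- (u * \<mu> * \<delta> * real k))"
proof (cases "k < m * m * block_length \<mu> m \<delta>")
  case True
  then have n: "block_length \<mu> m \<delta> > 0" by (cases "block_length \<mu> m \<delta>") auto
  have m1: "m \<ge> 1" using m by simp
  define y where "y = real (k div block_length \<mu> m \<delta>) / real m"
  have y: "\<bar>\<delta> * \<mu> * real k - y\<bar> \<le> 2 / real m"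
    using block_div_bounds(1)[OF m1 d \<mu> n, of k] block_div_bounds(2)[OF m1 d \<mu> n True] small
    by (simp add: y_def[symmetric] abs_le_iff)
  have "\<bar>exp (- (u * (\<delta> * \<mu> * real k))) - exp (- (u * y))\<bar> \<le> \<bar>- (u * (\<delta> * \<mu> * real k)) - - (u * y)\<bar> * exp 0"
    using u d \<mu> by (intro exp_diff_le) (auto simp: y_def)
  also have "- (u * (\<delta> * \<mu> * real k)) - - (u * y) = - (u * (\<delta> * \<mu> * real k - y))" by (simp only: right_diff_distrib)
  also have "\<bar>- (u * (\<delta> * \<mu> * real k - y))\<bar> = u * \<bar>\<delta> * \<mu> * real k - y\<bar>" using u by (simp only: abs_minus abs_mult)
  also have "\<dots> * exp 0 \<le> u * (2 / real m)" using y u by (simp add: mult_left_mono del: times_divide_eq_right)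
  finally have "\<bar>exp (- (u * (\<delta> * \<mu> * real k))) - exp (- (u * y))\<bar>\<^sup>2 \<le> (u * (2 / real m))\<^sup>2"
    by (intro power_mono) auto
  also have "\<dots> = 4 * u\<^sup>2 / (real m)\<^sup>2" by (simp add: power_mult_distrib power_divide)
  finally have "(exp (- (u * (\<delta> * \<mu> * real k))) - exp (- (u * y)))\<^sup>2 \<le> 4 * u\<^sup>2 / (real m)\<^sup>2" by simp
  then show ?thesis using True by (simp add: block_weight_def y_def add_increasing2)
next
  case False
  have m1: "m \<ge> 1" using m by simp
  have "real (m * m) * (1 / real m - \<delta> * \<mu>) \<le> real (m * m) * (real (block_length \<mu> m \<delta>) * (\<delta> * \<mu>))"
    using block_length_bounds(2)[OF m1 d \<mu>] by (intro mult_left_mono) auto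
  also have "\<dots> = \<delta> * \<mu> * real (m * m * block_length \<mu> m \<delta>)" by (simp add: mult_ac)
  also have "\<dots> \<le> \<delta> * \<mu> * real k"
  proof (rule mult_left_mono)
    show "real (m * m * block_length \<mu> m \<delta>) \<le> real k" using False by (simp only: not_less of_nat_le_iff)
  qed (use d \<mu> in simp)
  finally have "real (m * m) * (1 / real m) - real (m * m) * (\<delta> * \<mu>) \<le> \<delta> * \<mu> * real k" by (simp only: right_diff_distrib)
  moreover have "real (m * m) * (1 / real m) = real m" using m by simp
  \<comment> \<open>The point where m >= 2 enters: the rounding loss takes at most half of the
    horizon.\<close>
  moreover have "1 / real m \<le> real m / 2"
  proof -
    have "1 / real m \<le> 1" "real m \<ge> 2" using m by auto
    then show ?thesis by linarith
  qed
  ultimately have "real m / 2 \<le> \<delta> * \<mu> * real k" using small by linarith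
  then have "u * (real m / 2) \<le> u * (\<delta> * \<mu> * real k)" using u by (intro mult_left_mono) auto
  then have "(exp (- (u * (\<delta> * \<mu> * real k))))\<^sup>2 \<le> exp (- (u * (real m / 2))) * exp (- (u * (\<delta> * \<mu> * real k)))"
    unfolding power2_eq_square by (intro mult_right_mono) auto
  then show ?thesis using False by (simp add: block_weight_def mult_ac)
qed

lemma four_sum_le_eight:
  "x \<le> e \<Longrightarrow> y \<le> Y \<Longrightarrow> z \<le> Z \<Longrightarrow> Y + Z < e \<Longrightarrow> 4 * (x + (y + z)) \<le> 8 * (e :: real)"
  by (smt (verit))

section \<open>Second moments of the difference between the two series\<close>

context perturbed_walk
begin

definition block_series :: "nat \<Rightarrow> real \<Rightarrow> real \<Rightarrow> 'a \<Rightarrow> real" where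
  "block_series m \<delta> u \<omega> = norming \<delta> *
     (\<Sum>k<m * m * block_length \<mu> m \<delta>. block_weight \<mu> m \<delta> u k * \<eta> (Suc k) \<omega>)"

definition cutoff_series :: "real \<Rightarrow> real \<Rightarrow> real \<Rightarrow> 'a \<Rightarrow> real" where
  "cutoff_series R \<delta> u \<omega> = norming \<delta> *
     (\<Sum>k. exp (- (u * (\<delta> * cutoff \<mu> R k (random_walk \<xi> k \<omega>)))) * \<eta> (Suc k) \<omega>)"

lemma cutoff_scaled_ge:
  "\<delta> > 0 \<Longrightarrow> \<delta> * \<mu> / 2 * real k - \<delta> * R \<le> \<delta> * cutoff \<mu> R k x"
  using mult_left_mono[OF cutoff_ge[of \<mu> k R x], of \<delta>] by (simp add: algebra_simps)

lemma cutoff_series_sums: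
  assumes "subexponential (\<lambda>k. \<eta> (Suc k) \<omega>)" "\<delta> > 0" "R \<ge> 0" "u > 0"
  shows "summable (\<lambda>k. exp (- (u * (\<delta> * cutoff \<mu> R k (random_walk \<xi> k \<omega>)))) * \<eta> (Suc k) \<omega>)"
  using assms \<mu>_pos by (intro exp_series_summable[OF assms(1) cutoff_scaled_ge]) auto

lemma cutoff_series_continuous:
  assumes "subexponential (\<lambda>k. \<eta> (Suc k) \<omega>)" "\<delta> > 0" "R \<ge> 0"
  shows "continuous_on {0<..} (\<lambda>u. cutoff_series R \<delta> u \<omega>)"
  unfolding cutoff_series_def
  using assms \<mu>_pos by (intro continuous_intros exp_series_continuous[OF assms(1) cutoff_scaled_ge]) auto

lemma block_series_measurable[measurable]: "block_series m \<delta> u \<in> borel_measurable M"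
  unfolding block_series_def[abs_def] by measurable

lemma cutoff_series_measurable[measurable]: "cutoff_series R \<delta> u \<in> borel_measurable M"
  unfolding cutoff_series_def[abs_def] cutoff_def by measurable

lemma block_series_continuous: "continuous_on S (\<lambda>u. block_series m \<delta> u \<omega>)"
  unfolding block_series_def block_weight_def by (auto intro!: continuous_intros)

text \<open>The finite block sum is read as a series with vanishing tail, so that the difference is
  one series with predictable weights.\<close>

lemma series_difference_limit:
  assumes sub: "subexponential (\<lambda>k. \<eta> (Suc k) \<omega>)" and d: "\<delta> > 0" and R: "R \<ge> 0" and u: "u > 0"
  shows "(\<lambda>n. weighted_sum (\<lambda>k x. norming \<delta> * (exp (- (u * (\<delta> * cutoff \<mu> R k x))) - block_weight \<mu> m \<delta> u k)) n \<omega>)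
    \<longlonglongrightarrow> cutoff_series R \<delta> u \<omega> - block_series m \<delta> u \<omega>"
proof -
  let ?f = "\<lambda>k. exp (- (u * (\<delta> * cutoff \<mu> R k (random_walk \<xi> k \<omega>)))) * \<eta> (Suc k) \<omega>"
  let ?g = "\<lambda>k. block_weight \<mu> m \<delta> u k * \<eta> (Suc k) \<omega>"
  have "?f sums suminf ?f" by (rule summable_sums[OF cutoff_series_sums[OF sub d R u]])
  moreover have "?g sums (\<Sum>k<m * m * block_length \<mu> m \<delta>. ?g k)"
    by (rule sums_finite) (auto simp: block_weight_def)
  ultimately have "(\<lambda>k. norming \<delta> * (?f k - ?g k)) sums (norming \<delta> * (suminf ?f - (\<Sum>k<m * m * block_length \<mu> m \<delta>. ?g k)))"
    by (intro sums_mult sums_diff)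
  then show ?thesis
    by (simp add: sums_def weighted_sum_def cutoff_series_def block_series_def algebra_simps)
qed

lemma exp_cutoff_bound:
  assumes "\<delta> > 0" "R \<ge> 0" "\<delta> * R \<le> 1" "u > 0"
  shows "\<bar>exp (- (u * (\<delta> * cutoff \<mu> R k x)))\<bar> \<le> exp u"
proof -
  have "0 \<le> \<delta> * \<mu> / 2 * real k" using assms \<mu>_pos by simp
  then have "- 1 \<le> \<delta> * cutoff \<mu> R k x" using cutoff_scaled_ge[OF assms(1), of k R x] assms(3) by linarith
  then have "u * (- 1) \<le> u * (\<delta> * cutoff \<mu> R k x)" using assms(4) by (intro mult_left_mono) auto
  then show ?thesis by simp
qed

lemma block_weight_bound: "u > 0 \<Longrightarrow> \<bar>block_weight \<mu> m \<delta> u k\<bar> \<le> 1"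
  by (simp add: block_weight_def)

lemma cutoff_measurable[measurable]: "cutoff \<mu> R k \<in> borel_measurable borel"
  unfolding cutoff_def[abs_def] by measurable

text \<open>The bound involves neither m nor \<delta> nor R. This uniformity is what allows the
  chaining grid to be chosen before m and \<delta>.\<close>

lemma series_difference_increment:
  assumes m: "m \<ge> 1" and d: "\<delta> > 0" "\<delta> \<le> 1" and R: "R \<ge> 0" and dR: "\<delta> * R \<le> 1"
    and a: "0 < a" and u: "u \<in> {a..c}" and v: "v \<in> {a..c}"
  shows "(\<integral>\<^sup>+\<omega>. ennreal (((cutoff_series R \<delta> u \<omega> - block_series m \<delta> u \<omega>) -
      (cutoff_series R \<delta> v \<omega> - block_series m \<delta> v \<omega>))\<^sup>2) \<partial>M) \<le>
    ennreal (s\<^sup>2 * 8 * exp_lip_const a c * exp a * (1 + 2 / (a * \<mu>)) * (u - v)\<^sup>2)"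
proof -
  define h where "h w k x = exp (- (w * (\<delta> * cutoff \<mu> R k x))) - block_weight \<mu> m \<delta> w k" for w k x
  define g where "g k x = norming \<delta> * h u k x - norming \<delta> * h v k x" for k x
  have uv: "u > 0" "v > 0" using u v a by auto
  define E where "E k = exp (- (a * \<mu> / 2 * \<delta> * real k))" for k
  define L where "L = exp_lip_const a c * exp a * (u - v)\<^sup>2"
  have L: "L \<ge> 0" using exp_lip_const_nonneg[of a c] by (simp add: L_def)
  have l: "a * \<mu> / 2 > 0" using a \<mu>_pos by simp
  note geo = geometric_exp_series[OF l d(1), folded E_def]
  have hb: "\<bar>h w k x\<bar> \<le> exp w + 1" if "w > 0" for w k x
    using exp_cutoff_bound[OF d(1) R dR that, of k x] block_weight_bound[OF that, of m \<delta> k] unfolding h_def by linarith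
  \<comment> \<open>The 8 consists of 2 from \<open>norming_sq\<close> and of 4 for two squares,
    each doubled by \<open>diff_sq_le\<close>.\<close>
  have gsq: "(g k x)\<^sup>2 \<le> 8 * \<delta> * L * E k" for k x
  proof -
    let ?A = "exp (- (u * (\<delta> * cutoff \<mu> R k x))) - exp (- (v * (\<delta> * cutoff \<mu> R k x)))"
    let ?B = "block_weight \<mu> m \<delta> u k - block_weight \<mu> m \<delta> v k"
    have "(g k x)\<^sup>2 = (norming \<delta>)\<^sup>2 * (?A - ?B)\<^sup>2"
      unfolding power_mult_distrib[symmetric] by (simp add: g_def h_def algebra_simps)
    also have "\<dots> \<le> (2 * \<delta>) * (2 * (L * E k) + 2 * (L * E k))"
    proof (rule mult_mono)
      have "(?A - ?B)\<^sup>2 \<le> 2 * ?A\<^sup>2 + 2 * ?B\<^sup>2" by (rule diff_sq_le)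
      also have "\<dots> \<le> 2 * (L * E k) + 2 * (L * E k)"
        using cutoff_weight_increment[OF d(1) \<mu>_pos dR a u v, of k x] block_weight_increment[OF m d(1) \<mu>_pos a u v, of k]
        by (simp add: L_def E_def mult_ac)
      finally show "(?A - ?B)\<^sup>2 \<le> 2 * (L * E k) + 2 * (L * E k)" .
    qed (use d norming_sq in auto)
    finally show ?thesis by (simp add: mult_ac)
  qed
  have "(\<integral>\<^sup>+\<omega>. ennreal (((cutoff_series R \<delta> u \<omega> - block_series m \<delta> u \<omega>) -
      (cutoff_series R \<delta> v \<omega> - block_series m \<delta> v \<omega>))\<^sup>2) \<partial>M) \<le> ennreal (s\<^sup>2 * suminf (\<lambda>k. 8 * \<delta> * L * E k))"
  proof (rule weighted_series_second_moment[of g "\<lambda>_. \<bar>norming \<delta>\<bar> * (exp u + 1) + \<bar>norming \<delta>\<bar> * (exp v + 1)"])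
    show "g k \<in> borel_measurable borel" for k
      unfolding g_def[abs_def] h_def by measurable
    show "\<bar>g k x\<bar> \<le> \<bar>norming \<delta>\<bar> * (exp u + 1) + \<bar>norming \<delta>\<bar> * (exp v + 1)" for k x
    proof -
      have "\<bar>g k x\<bar> \<le> \<bar>norming \<delta>\<bar> * \<bar>h u k x\<bar> + \<bar>norming \<delta>\<bar> * \<bar>h v k x\<bar>"
        unfolding g_def using abs_triangle_ineq4[of "norming \<delta> * h u k x" "norming \<delta> * h v k x"] by (simp add: abs_mult)
      also have "\<dots> \<le> \<bar>norming \<delta>\<bar> * (exp u + 1) + \<bar>norming \<delta>\<bar> * (exp v + 1)"
        by (intro add_mono mult_left_mono hb uv) auto
      finally show ?thesis .
    qed
    show "expectation (\<lambda>\<omega>. (g k (random_walk \<xi> k \<omega>))\<^sup>2) \<le> 8 * \<delta> * L * E k" for k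
    proof (rule integral_le_const)
      show "integrable M (\<lambda>\<omega>. (g k (random_walk \<xi> k \<omega>))\<^sup>2)"
        using gsq by (intro integrable_const_bound[of _ "8 * \<delta> * L * E k"]) (auto simp: g_def h_def)
    qed (use gsq in auto)
    show "summable (\<lambda>k. 8 * \<delta> * L * E k)" by (rule summable_mult[OF geo(1)])
    show "AE \<omega> in M. (\<lambda>n. weighted_sum g n \<omega>) \<longlonglongrightarrow>
        (cutoff_series R \<delta> u \<omega> - block_series m \<delta> u \<omega>) - (cutoff_series R \<delta> v \<omega> - block_series m \<delta> v \<omega>)"
      using \<eta>_subexponential
    proof eventually_elim
      case (elim \<omega>)
      have "weighted_sum g n \<omega> = weighted_sum (\<lambda>k x. norming \<delta> * h u k x) n \<omega> - weighted_sum (\<lambda>k x. norming \<delta> * h v k x) n \<omega>" for n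
        by (simp add: weighted_sum_def g_def sum_subtractf left_diff_distrib)
      then show ?case
        using tendsto_diff[OF series_difference_limit[OF elim d(1) R uv(1), of m] series_difference_limit[OF elim d(1) R uv(2), of m]]
        by (simp add: h_def)
    qed
  qed
  also have "\<dots> \<le> ennreal (s\<^sup>2 * 8 * exp_lip_const a c * exp a * (1 + 2 / (a * \<mu>)) * (u - v)\<^sup>2)"
  proof (rule ennreal_leI)
    have "suminf (\<lambda>k. 8 * \<delta> * L * E k) = 8 * L * (\<delta> * suminf E)"
      by (subst suminf_mult[OF geo(1)]) simp
    also have "\<dots> \<le> 8 * L * (1 + 2 / (a * \<mu>))"
      using geo(2) d(2) L by (intro mult_left_mono) auto
    finally have "s\<^sup>2 * suminf (\<lambda>k. 8 * \<delta> * L * E k) \<le> s\<^sup>2 * (8 * L * (1 + 2 / (a * \<mu>)))"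
      by (rule mult_left_mono) simp
    then show "s\<^sup>2 * suminf (\<lambda>k. 8 * \<delta> * L * E k) \<le> s\<^sup>2 * 8 * exp_lip_const a c * exp a * (1 + 2 / (a * \<mu>)) * (u - v)\<^sup>2"
      by (simp add: L_def mult_ac)
  qed
  finally show ?thesis .
qed

text \<open>Truncation at 1 lets dominated convergence turn the almost sure law of large numbers
  into convergence of means, although \<xi> may lack a second moment.\<close>

definition lln_error :: "nat \<Rightarrow> real" where
  "lln_error k = expectation (\<lambda>\<omega>. min 1 ((random_walk \<xi> k \<omega> / real k - \<mu>)\<^sup>2))"

lemma lln_error: "lln_error \<longlonglongrightarrow> 0" "0 \<le> lln_error k" "lln_error k \<le> 1"
proof -
  have "lln_error \<longlonglongrightarrow> expectation (\<lambda>_. 0)"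
    unfolding lln_error_def[abs_def]
  proof (rule integral_dominated_convergence[where w = "\<lambda>_. 1"])
    show "AE \<omega> in M. (\<lambda>k. min 1 ((random_walk \<xi> k \<omega> / real k - \<mu>)\<^sup>2)) \<longlonglongrightarrow> 0"
      using walk_lln
    proof eventually_elim
      case (elim \<omega>)
      have "(\<lambda>k. min 1 ((random_walk \<xi> k \<omega> / real k - \<mu>)\<^sup>2)) \<longlonglongrightarrow> min 1 ((\<mu> - \<mu>)\<^sup>2)"
        by (intro tendsto_intros elim)
      then show ?case by simp
    qed
  qed auto
  then show "lln_error \<longlonglongrightarrow> 0" by simp
  show "0 \<le> lln_error k" unfolding lln_error_def by (intro integral_nonneg_AE) auto
  show "lln_error k \<le> 1" unfolding lln_error_def
    by (intro integral_le_const integrable_const_bound[of _ 1]) auto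
qed

text \<open>There are three errors: the walk against its mean line, the mesh, and the horizon. The
  last two are governed by m. The first vanishes as \<delta> tends to 0, and the rounding of block
  lengths asks for \<delta> small depending on m; hence the order of the limits.\<close>

lemma series_difference_small:
  assumes R: "R \<ge> 0" and u: "u > 0" and \<kappa>: "\<kappa> > 0"
  shows "\<forall>\<^sub>F m in sequentially. \<forall>\<^sub>F \<delta> in at_right 0.
    (\<integral>\<^sup>+\<omega>. ennreal ((cutoff_series R \<delta> u \<omega> - block_series m \<delta> u \<omega>)\<^sup>2) \<partial>M) \<le> ennreal \<kappa>"
proof -
  define C where "C = exp (2 * u) * (1 + 16 / \<mu>\<^sup>2)"
  have C: "C > 0" by (auto simp: C_def intro!: mult_pos_pos add_pos_nonneg)
  \<comment> \<open>The final bound is s^2 * 8 * e. Adding 1 keeps the denominator positive even for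
    s = 0, which the locale admits.\<close>
  define e where "e = \<kappa> / (8 * (s\<^sup>2 + 1))"
  have s1: "s\<^sup>2 + 1 > 0" by (simp add: add_nonneg_pos)
  have e: "e > 0" using \<kappa> s1 by (simp add: e_def)
  have "(\<lambda>m. 4 * u\<^sup>2 / \<mu> * (1 / real m) + exp (- (u * (real m / 2))) * (1 + 1 / (u * \<mu>))) \<longlonglongrightarrow>
      4 * u\<^sup>2 / \<mu> * 0 + 0 * (1 + 1 / (u * \<mu>))"
  proof (intro tendsto_add tendsto_mult tendsto_const)
    show "(\<lambda>m. 1 / real m) \<longlonglongrightarrow> 0" by (rule lim_1_over_n)
    show "(\<lambda>m. exp (- (u * (real m / 2)))) \<longlonglongrightarrow> 0" using u by real_asymp
  qed
  then have "\<forall>\<^sub>F m in sequentially. 4 * u\<^sup>2 / \<mu> * (1 / real m) + exp (- (u * (real m / 2))) * (1 + 1 / (u * \<mu>)) < e"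
    by (rule order_tendstoD(2)) (use e in simp)
  then show ?thesis
    using eventually_ge_at_top[of 2]
  proof eventually_elim
    case (elim m)
    have mpos: "real m > 0" using elim by simp
    have l: "u * \<mu> / 2 > 0" "u * \<mu> > 0" using u \<mu>_pos by simp_all
    have e1: "\<forall>\<^sub>F \<delta> in at_right 0. summable (\<lambda>k. lln_error k * exp (- (u * \<mu> / 2 * \<delta> * real k))) \<and>
      \<delta> * (\<Sum>k. lln_error k * exp (- (u * \<mu> / 2 * \<delta> * real k))) \<le> e / C"
      by (rule weighted_average_small[OF lln_error(1) lln_error(2) lln_error(3) l(1)]) (use e C in simp)
    have "((\<lambda>\<delta>. \<delta> * R) \<longlongrightarrow> 0 * R) (at_right 0)" "((\<lambda>\<delta>. real (m * m) * (\<delta> * \<mu>)) \<longlongrightarrow> real (m * m) * (0 * \<mu>)) (at_right 0)"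
      by (intro tendsto_intros)+
    then have e2: "\<forall>\<^sub>F \<delta> in at_right 0. \<delta> * R < 1" "\<forall>\<^sub>F \<delta> in at_right 0. real (m * m) * (\<delta> * \<mu>) < 1 / real m"
      using mpos by (auto elim!: order_tendstoD(2) simp del: of_nat_mult)
    have e3: "\<forall>\<^sub>F \<delta>::real in at_right 0. 0 < \<delta> \<and> \<delta> < 1"
      using eventually_at_right_real[OF zero_less_one] by (auto elim!: eventually_mono)
    show ?case
      using e1 e2 e3
    proof eventually_elim
      case E: (elim \<delta>)
      have d: "\<delta> > 0" "\<delta> \<le> 1" and dR: "\<delta> * R \<le> 1" and small: "real (m * m) * (\<delta> * \<mu>) \<le> 1 / real m" using E by auto
      define g where "g k x = norming \<delta> * (exp (- (u * (\<delta> * cutoff \<mu> R k x))) - block_weight \<mu> m \<delta> u k)" for k x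
      let ?n = "m * m * block_length \<mu> m \<delta>"
      define q1 where "q1 k = lln_error k * exp (- (u * \<mu> / 2 * \<delta> * real k))" for k
      define q2 where "q2 k = (if k \<in> {..<?n} then 4 * u\<^sup>2 / (real m)\<^sup>2 else 0)" for k
      define q3 where "q3 k = exp (- (u * \<mu> * \<delta> * real k))" for k
      define A where "A = exp (- (u * (real m / 2)))"
      \<comment> \<open>Here \<open>q1\<close> is the deviation from the mean line,
        \<open>q2\<close> the mesh error inside the horizon and \<open>A * q3\<close> the part
        beyond it. The 4 is 2 from \<open>norming_sq\<close> times 2 from
        \<open>sum_sq_le\<close>.\<close>
      define q where "q k = 4 * \<delta> * (C * q1 k + (q2 k + A * q3 k))" for k
      note g3 = geometric_exp_series[OF l(2) d(1), folded q3_def]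
      have q1: "summable q1" "\<delta> * suminf q1 \<le> e / C" using E(1) by (auto simp: q1_def[abs_def])
      have q2: "summable q2" "suminf q2 = real ?n * (4 * u\<^sup>2 / (real m)\<^sup>2)"
        unfolding q2_def[abs_def] by (rule summable_If_finite_set, simp) (subst suminf_finite[of "{..<?n}"], auto)
      have sum_q: "summable q" "suminf q = 4 * (C * (\<delta> * suminf q1) + (\<delta> * suminf q2 + A * (\<delta> * suminf q3)))"
      proof -
        have "(\<lambda>k. 4 * \<delta> * (C * q1 k + (q2 k + A * q3 k))) sums (4 * \<delta> * (C * suminf q1 + (suminf q2 + A * suminf q3)))"
          by (intro sums_mult sums_add summable_sums q1 q2 g3)
        then have "q sums (4 * \<delta> * (C * suminf q1 + (suminf q2 + A * suminf q3)))" by (simp add: q_def[abs_def])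
        then show "summable q" "suminf q = 4 * (C * (\<delta> * suminf q1) + (\<delta> * suminf q2 + A * (\<delta> * suminf q3)))"
          by (auto simp: sums_iff algebra_simps)
      qed
      have "(\<integral>\<^sup>+\<omega>. ennreal ((cutoff_series R \<delta> u \<omega> - block_series m \<delta> u \<omega>)\<^sup>2) \<partial>M) \<le> ennreal (s\<^sup>2 * suminf q)"
      proof (rule weighted_series_second_moment[of g "\<lambda>_. \<bar>norming \<delta>\<bar> * (exp u + 1)"])
        show "g k \<in> borel_measurable borel" for k unfolding g_def[abs_def] by measurable
        show gb: "\<bar>g k x\<bar> \<le> \<bar>norming \<delta>\<bar> * (exp u + 1)" for k x
        proof -
          have "\<bar>exp (- (u * (\<delta> * cutoff \<mu> R k x))) - block_weight \<mu> m \<delta> u k\<bar> \<le> exp u + 1"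
            using exp_cutoff_bound[OF d(1) R dR u, of k x] block_weight_bound[OF u, of m \<delta> k] by linarith
          then show ?thesis unfolding g_def abs_mult by (rule mult_left_mono) simp
        qed
        show "summable q" by (rule sum_q)
        show "AE \<omega> in M. (\<lambda>n. weighted_sum g n \<omega>) \<longlonglongrightarrow> cutoff_series R \<delta> u \<omega> - block_series m \<delta> u \<omega>"
          using \<eta>_subexponential
          by eventually_elim (use series_difference_limit[OF _ d(1) R u] in \<open>simp add: g_def[abs_def]\<close>)
        show "expectation (\<lambda>\<omega>. (g k (random_walk \<xi> k \<omega>))\<^sup>2) \<le> q k" for k
        proof -
          let ?h = "\<lambda>\<omega>. min 1 ((random_walk \<xi> k \<omega> / real k - \<mu>)\<^sup>2)"
          let ?b = "\<lambda>\<omega>. 4 * \<delta> * (C * (?h \<omega> * exp (- (u * \<mu> / 2 * \<delta> * real k))) + (q2 k + A * q3 k))"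
          have "(g k (random_walk \<xi> k \<omega>))\<^sup>2 \<le> ?b \<omega>" for \<omega>
          proof -
            let ?x = "random_walk \<xi> k \<omega>"
            let ?X = "exp (- (u * (\<delta> * cutoff \<mu> R k ?x))) - exp (- (u * (\<delta> * \<mu> * real k)))"
            let ?Y = "exp (- (u * (\<delta> * \<mu> * real k))) - block_weight \<mu> m \<delta> u k"
            have "(g k ?x)\<^sup>2 = (norming \<delta>)\<^sup>2 * (?X + ?Y)\<^sup>2" by (simp add: g_def power_mult_distrib)
            also have "\<dots> \<le> (2 * \<delta>) * (2 * (C * (?h \<omega> * exp (- (u * \<mu> / 2 * \<delta> * real k)))) + 2 * (q2 k + A * q3 k))"
            proof (rule mult_mono)
              have "(?X + ?Y)\<^sup>2 \<le> 2 * ?X\<^sup>2 + 2 * ?Y\<^sup>2" by (rule sum_sq_le)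
              also have "\<dots> \<le> 2 * (C * (?h \<omega> * exp (- (u * \<mu> / 2 * \<delta> * real k)))) + 2 * (q2 k + A * q3 k)"
              proof (intro add_mono mult_left_mono)
                show "?X\<^sup>2 \<le> C * (?h \<omega> * exp (- (u * \<mu> / 2 * \<delta> * real k)))"
                  unfolding C_def by (rule cutoff_weight_close[OF d(1) \<mu>_pos R dR u]) (simp add: random_walk_def)
                show "?Y\<^sup>2 \<le> q2 k + A * q3 k"
                  unfolding q2_def A_def q3_def by (rule block_weight_close[OF elim(2) d(1) \<mu>_pos small u])
              qed auto
              finally show "(?X + ?Y)\<^sup>2 \<le> 2 * (C * (?h \<omega> * exp (- (u * \<mu> / 2 * \<delta> * real k)))) + 2 * (q2 k + A * q3 k)" .
            qed (use d norming_sq in auto)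
            finally show ?thesis by (simp add: algebra_simps)
          qed
          moreover have hi: "integrable M ?h" by (intro integrable_const_bound[of _ 1]) auto
          moreover have "integrable M (\<lambda>\<omega>. (g k (random_walk \<xi> k \<omega>))\<^sup>2)"
          proof (rule integrable_const_bound[of _ "(\<bar>norming \<delta>\<bar> * (exp u + 1))\<^sup>2"])
            show "AE \<omega> in M. norm ((g k (random_walk \<xi> k \<omega>))\<^sup>2) \<le> (\<bar>norming \<delta>\<bar> * (exp u + 1))\<^sup>2"
            proof (rule AE_I2)
              fix \<omega>
              have "\<bar>g k (random_walk \<xi> k \<omega>)\<bar>\<^sup>2 \<le> (\<bar>norming \<delta>\<bar> * (exp u + 1))\<^sup>2"
                using gb by (intro power_mono) auto
              then show "norm ((g k (random_walk \<xi> k \<omega>))\<^sup>2) \<le> (\<bar>norming \<delta>\<bar> * (exp u + 1))\<^sup>2" by simp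
            qed
          qed (simp add: g_def)
          ultimately have "expectation (\<lambda>\<omega>. (g k (random_walk \<xi> k \<omega>))\<^sup>2) \<le> expectation ?b"
            by (intro integral_mono) auto
          also have "\<dots> = q k"
            using hi by (simp add: q_def q1_def lln_error_def prob_space)
          finally show ?thesis .
        qed
      qed
      also have "\<dots> \<le> ennreal \<kappa>"
      proof (rule ennreal_leI)
        have "C * (\<delta> * suminf q1) \<le> e" using q1(2) C by (simp add: field_simps)
        moreover have "\<delta> * suminf q2 \<le> 4 * u\<^sup>2 / \<mu> * (1 / real m)"
        proof -
          \<comment> \<open>The m * m blocks cancel the factor 1 / m^2, and one block length is
            left, at most 1 / m after scaling.\<close>
          have "\<delta> * suminf q2 = (real (block_length \<mu> m \<delta>) * (\<delta> * \<mu>)) * (4 * u\<^sup>2 / \<mu>)"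
            using mpos \<mu>_pos by (simp add: q2(2) field_simps power2_eq_square)
          also have "\<dots> \<le> (1 / real m) * (4 * u\<^sup>2 / \<mu>)"
            using block_length_bounds(1)[of m \<delta> \<mu>] elim d \<mu>_pos by (intro mult_right_mono) auto
          finally show ?thesis by (simp add: mult.commute)
        qed
        moreover have "A * (\<delta> * suminf q3) \<le> A * (1 + 1 / (u * \<mu>))"
          using g3(2) d(2) by (intro mult_left_mono) (auto simp: A_def)
        ultimately have "suminf q \<le> 8 * e"
          using elim(1) unfolding sum_q(2) A_def by (intro four_sum_le_eight)
        then have "s\<^sup>2 * suminf q \<le> s\<^sup>2 * (8 * e)" by (rule mult_left_mono) simp
        also have "\<dots> \<le> (s\<^sup>2 + 1) * (8 * e)" using e by (intro mult_right_mono) auto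
        also have "\<dots> = \<kappa>" using s1 by (simp add: e_def divide_simps)
        finally show "s\<^sup>2 * suminf q \<le> \<kappa>" .
      qed
      finally show ?case .
    qed
  qed
qed

end

section \<open>Wiener integrals\<close>

lemma indicator_inner:
  assumes "a \<le> b" "c \<le> d"
  shows "has_bochner_integral lborel (\<lambda>y. indicator {a<..b} y * indicator {c<..d} y :: real)
    (max 0 (min b d - max a c))"
proof -
  have "has_bochner_integral lborel (\<lambda>y. indicator {max a c<..min b d} y :: real) (measure lborel {max a c<..min b d})"
  proof (rule has_bochner_integral_real_indicator)
    show "emeasure lborel {max a c<..min b d} < \<infinity>" by (cases "max a c \<le> min b d") auto
  qed simp
  moreover have "measure lborel {max a c<..min b d} = max 0 (min b d - max a c)"
    by (cases "max a c \<le> min b d") (auto simp: measure_def)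
  ultimately show ?thesis by (simp add: indicator_inter_arith[symmetric])
qed

lemma step_fun_nonpos: "0 \<le> t 0 \<Longrightarrow> mono t \<Longrightarrow> y \<le> 0 \<Longrightarrow> step_fun n c t y = 0"
proof -
  assume t: "0 \<le> t 0" "mono t" "y \<le> 0"
  have "0 \<le> t i" for i using t monoD[of t 0 i] by auto
  then show ?thesis unfolding step_fun_def using t(3) by (intro sum.neutral) (auto simp: indicator_def not_less intro: order_trans)
qed

lemma step_fun_measurable[measurable]: "step_fun n c t \<in> borel_measurable borel"
  unfolding step_fun_def[abs_def] by measurable

text \<open>The left-endpoint sum for the Wiener integral with mesh 1 / m and horizon m: the
  counterpart of the block series on the Brownian side.\<close>

definition bm_blocks :: "(real \<Rightarrow> 'b \<Rightarrow> real) \<Rightarrow> nat \<Rightarrow> real \<Rightarrow> 'b \<Rightarrow> real" where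
  "bm_blocks B m u = step_integral B (m * m) (\<lambda>i. exp (- (u * (real i / real m)))) (\<lambda>i. real i / real m)"

lemma grid_mono: "mono (\<lambda>i. real i / real m)"
  by (auto intro!: monoI divide_right_mono)

lemma step_fun_grid:
  assumes m: "m \<ge> 1" and y: "y > 0"
  shows "(y \<le> real n / real m \<longrightarrow> (\<exists>k<n. step_fun n c (\<lambda>i. real i / real m) y = c k \<and>
      real k / real m < y \<and> y \<le> real k / real m + 1 / real m)) \<and>
    (real n / real m < y \<longrightarrow> step_fun n c (\<lambda>i. real i / real m) y = 0)"
proof (intro conjI impI)
  assume yn: "y \<le> real n / real m"
  \<comment> \<open>The cells are open on the left and closed on the right, so the index is the
    ceiling minus one, not the floor.\<close>
  define k where "k = nat (\<lceil>real m * y\<rceil> - 1)"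
  have my: "real m * y > 0" using m y by simp
  have "\<lceil>real m * y\<rceil> \<ge> 1" using my by linarith
  then have rk: "real k = of_int \<lceil>real m * y\<rceil> - 1" by (simp add: k_def)
  have k: "real k < real m * y" "real m * y \<le> real k + 1" unfolding rk by linarith+
  have "real m * y \<le> real n" using yn m by (simp add: field_simps)
  then have kn: "k < n" using k(1) by linarith
  have in_iff: "y \<in> {real i / real m<..real (Suc i) / real m} \<longleftrightarrow> i = k" for i
  proof
    assume "y \<in> {real i / real m<..real (Suc i) / real m}"
    then have "real i < real m * y" "real m * y \<le> real i + 1" using m by (auto simp: field_simps)
    with k show "i = k" by linarith
  next
    assume "i = k"
    with k show "y \<in> {real i / real m<..real (Suc i) / real m}" using m by (auto simp: field_simps)
  qed
  have "step_fun n c (\<lambda>i. real i / real m) y = (\<Sum>i<n. if i = k then c i else 0)"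
  proof -
    have "indicator {real i / real m<..real (Suc i) / real m} y = (if i = k then 1 else 0 :: real)" for i
      using in_iff[of i] by (simp only: indicator_def of_bool_def)
    then show ?thesis unfolding step_fun_def by (intro sum.cong) simp_all
  qed
  also have "\<dots> = c k" using kn by simp
  finally have ck: "step_fun n c (\<lambda>i. real i / real m) y = c k" .
  have "real k / real m < y" "y \<le> real k / real m + 1 / real m"
    using k m by (auto simp: field_simps)
  then show "\<exists>k<n. step_fun n c (\<lambda>i. real i / real m) y = c k \<and>
      real k / real m < y \<and> y \<le> real k / real m + 1 / real m"
    by (intro exI[of _ k] conjI kn ck)
next
  assume yn: "real n / real m < y"
  have "real (Suc i) / real m < y" if "i < n" for i
  proof -
    have "real (Suc i) / real m \<le> real n / real m" using that by (intro divide_right_mono) auto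
    then show ?thesis using yn by linarith
  qed
  then have "indicator {real i / real m<..real (Suc i) / real m} y = (0 :: real)" if "i < n" for i
    using that by (metis greaterThanAtMost_iff indicator_simps(2) not_le)
  then show "step_fun n c (\<lambda>i. real i / real m) y = 0"
    unfolding step_fun_def by (intro sum.neutral) simp
qed

lemma nn_integral_exp_tail:
  assumes l: "l > 0" and A: "A \<ge> 0"
  shows "(\<integral>\<^sup>+y. ennreal (A * exp (- (l * y))) * indicator {a..} y \<partial>lborel) = ennreal (A * exp (- (l * a)) / l)"
proof -
  have "(\<integral>\<^sup>+y. ennreal (A * exp (- (l * y))) * indicator {a..} y \<partial>lborel) = ennreal (0 - (- (A * exp (- (l * a)) / l)))"
  proof (rule nn_integral_FTC_atLeast[where F = "\<lambda>y. - (A * exp (- (l * y)) / l)"])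
    show "((\<lambda>y. - (A * exp (- (l * y)) / l)) has_real_derivative A * exp (- (l * x))) (at x)" for x
      using l by (auto intro!: derivative_eq_intros)
    have "((\<lambda>y. exp (- (l * y))) \<longlongrightarrow> 0) at_top"
      using l by real_asymp
    then have "((\<lambda>y. - (A * exp (- (l * y)) / l)) \<longlongrightarrow> - (A * 0 / l)) at_top"
      using l by (intro tendsto_intros) auto
    then show "((\<lambda>y. - (A * exp (- (l * y)) / l)) \<longlongrightarrow> 0) at_top" by simp
  qed (use A in auto)
  then show ?thesis by simp
qed

section \<open>Brownian increments and the isometry\<close>

context
  fixes N :: "'b measure" and B :: "real \<Rightarrow> 'b \<Rightarrow> real"
  assumes BM: "standard_brownian_motion N B"
begin

interpretation N: prob_space N
  using BM by (simp add: standard_brownian_motion_def)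

lemma bm_measurable: "t \<ge> 0 \<Longrightarrow> B t \<in> borel_measurable N"
  using BM by (simp add: standard_brownian_motion_def)

lemma bm_normal:
  "0 \<le> r \<Longrightarrow> r < t \<Longrightarrow> distributed N lborel (\<lambda>\<omega>. B t \<omega> - B r \<omega>) (normal_density 0 (sqrt (t - r)))"
  using BM by (simp add: standard_brownian_motion_def)

text \<open>The absolute value frees the formula from the order of the times, which polarization
  requires. Equal times are separate, as the normal density needs a positive deviation.\<close>

lemma bm_increment_sq:
  assumes "0 \<le> r" "0 \<le> t"
  shows "has_bochner_integral N (\<lambda>\<omega>. (B t \<omega> - B r \<omega>)\<^sup>2) \<bar>t - r\<bar>"
  using assms
proof (induction r t rule: linorder_wlog)
  case (le r t)
  show ?case
  proof (cases "r = t")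
    case True
    then show ?thesis by (simp add: has_bochner_integral_zero)
  next
    case False
    with le have rt: "r < t" by simp
    note D = bm_normal[OF le(2) rt]
    have s: "0 < sqrt (t - r)" using rt by simp
    have "integrable lborel (\<lambda>x. normal_density 0 (sqrt (t - r)) x * x\<^sup>2)"
      using integrable_normal_moment[OF s, of 0 2] by simp
    then have i: "integrable N (\<lambda>\<omega>. (B t \<omega> - B r \<omega>)\<^sup>2)"
      by (subst distributed_integrable[OF D, of "\<lambda>x. x\<^sup>2", symmetric]) auto
    have "N.variance (\<lambda>\<omega>. B t \<omega> - B r \<omega>) = (sqrt (t - r))\<^sup>2"
      by (rule N.normal_distributed_variance[OF s D])
    then have "N.expectation (\<lambda>\<omega>. (B t \<omega> - B r \<omega>)\<^sup>2) = t - r"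
      using N.normal_distributed_expectation[OF s D] rt by simp
    with i rt show ?thesis by (simp add: has_bochner_integral_iff)
  qed
next
  case (sym r t)
  then show ?case by (simp add: power2_commute abs_minus_commute)
qed

text \<open>Polarization: a product of two increments is a combination of four squared increments,
  so only variances are needed, and the combination of lengths is the overlap of the two
  intervals.\<close>

lemma bm_increment_inner:
  assumes "0 \<le> a" "a \<le> b" "0 \<le> c" "c \<le> d"
  shows "has_bochner_integral N (\<lambda>\<omega>. (B b \<omega> - B a \<omega>) * (B d \<omega> - B c \<omega>))
    (max 0 (min b d - max a c))"
proof -
  have eq: "(\<lambda>\<omega>. (B b \<omega> - B a \<omega>) * (B d \<omega> - B c \<omega>)) =
    (\<lambda>\<omega>. ((B b \<omega> - B c \<omega>)\<^sup>2 + (B a \<omega> - B d \<omega>)\<^sup>2 - (B b \<omega> - B d \<omega>)\<^sup>2 - (B a \<omega> - B c \<omega>)\<^sup>2) / 2)"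
    by (simp add: fun_eq_iff power2_eq_square algebra_simps)
  have "has_bochner_integral N (\<lambda>\<omega>. ((B b \<omega> - B c \<omega>)\<^sup>2 + (B a \<omega> - B d \<omega>)\<^sup>2 - (B b \<omega> - B d \<omega>)\<^sup>2 - (B a \<omega> - B c \<omega>)\<^sup>2) / 2)
    ((\<bar>b - c\<bar> + \<bar>a - d\<bar> - \<bar>b - d\<bar> - \<bar>a - c\<bar>) / 2)"
    using assms by (intro has_bochner_integral_divide_zero has_bochner_integral_diff
      has_bochner_integral_add bm_increment_sq) auto
  moreover have "(\<bar>b - c\<bar> + \<bar>a - d\<bar> - \<bar>b - d\<bar> - \<bar>a - c\<bar>) / 2 = max 0 (min b d - max a c)"
    using assms by (auto simp: max_def min_def abs_if)
  ultimately show ?thesis by (simp add: eq)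
qed

text \<open>Bilinearity reduces both integrals to pairs of intervals, and each pair contributes its
  overlap on either side. Thus no common refinement of the two partitions is formed.\<close>

lemma step_integral_inner:
  assumes t: "0 \<le> t 0" "mono t" and t': "0 \<le> t' 0" "mono t'"
  shows "\<exists>I. has_bochner_integral N (\<lambda>\<omega>. step_integral B n c t \<omega> * step_integral B n' c' t' \<omega>) I \<and>
    has_bochner_integral lborel (\<lambda>y. step_fun n c t y * step_fun n' c' t' y) I"
proof -
  have p: "0 \<le> t i" "t i \<le> t (Suc i)" "0 \<le> t' i" "t' i \<le> t' (Suc i)" for i
    using t t' monoD[of t 0 i] monoD[of t' 0 i] monoD[of t i "Suc i"] monoD[of t' i "Suc i"] by auto
  define I where "I = (\<Sum>i<n. \<Sum>j<n'. c i * c' j * max 0 (min (t (Suc i)) (t' (Suc j)) - max (t i) (t' j)))"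
  have "(\<lambda>\<omega>. step_integral B n c t \<omega> * step_integral B n' c' t' \<omega>) = (\<lambda>\<omega>. \<Sum>i<n. \<Sum>j<n'. c i * c' j *
      ((B (t (Suc i)) \<omega> - B (t i) \<omega>) * (B (t' (Suc j)) \<omega> - B (t' j) \<omega>)))"
    by (simp add: step_integral_def sum_product mult_ac)
  moreover have "has_bochner_integral N (\<lambda>\<omega>. \<Sum>i<n. \<Sum>j<n'. c i * c' j *
      ((B (t (Suc i)) \<omega> - B (t i) \<omega>) * (B (t' (Suc j)) \<omega> - B (t' j) \<omega>))) I"
    unfolding I_def by (intro has_bochner_integral_sum has_bochner_integral_mult_right bm_increment_inner p)
  moreover have "(\<lambda>y. step_fun n c t y * step_fun n' c' t' y) = (\<lambda>y. \<Sum>i<n. \<Sum>j<n'. c i * c' j *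
      (indicator {t i<..t (Suc i)} y * indicator {t' j<..t' (Suc j)} y))"
    by (simp only: step_fun_def sum_product mult_ac)
  moreover have "has_bochner_integral lborel (\<lambda>y. \<Sum>i<n. \<Sum>j<n'. c i * c' j *
      (indicator {t i<..t (Suc i)} y * indicator {t' j<..t' (Suc j)} y)) I"
    unfolding I_def by (intro has_bochner_integral_sum has_bochner_integral_mult_right indicator_inner p)
  ultimately show ?thesis by (intro exI[of _ I] conjI) simp_all
qed

lemma step_integral_measurable:
  assumes t: "0 \<le> t 0" "mono t"
  shows "step_integral B n c t \<in> borel_measurable N"
proof -
  have [measurable]: "B (t i) \<in> borel_measurable N" for i
    using t monoD[of t 0 i] by (intro bm_measurable) auto
  show ?thesis unfolding step_integral_def[abs_def] by measurable
qed

lemma step_integral_isometry: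
  assumes t: "0 \<le> t 0" "mono t" and t': "0 \<le> t' 0" "mono t'"
  shows "(\<integral>\<^sup>+\<omega>. ennreal ((step_integral B n c t \<omega> - step_integral B n' c' t' \<omega>)\<^sup>2) \<partial>N) =
    (\<integral>\<^sup>+y\<in>{0..}. ennreal ((step_fun n c t y - step_fun n' c' t' y)\<^sup>2) \<partial>lborel)"
proof -
  let ?P = "step_integral B n c t" and ?P' = "step_integral B n' c' t'"
  let ?f = "step_fun n c t" and ?f' = "step_fun n' c' t'"
  obtain I1 where I1: "has_bochner_integral N (\<lambda>\<omega>. ?P \<omega> * ?P \<omega>) I1"
      "has_bochner_integral lborel (\<lambda>y. ?f y * ?f y) I1"
    using step_integral_inner[OF t t] by blast
  obtain I2 where I2: "has_bochner_integral N (\<lambda>\<omega>. ?P \<omega> * ?P' \<omega>) I2"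
      "has_bochner_integral lborel (\<lambda>y. ?f y * ?f' y) I2"
    using step_integral_inner[OF t t'] by blast
  obtain I3 where I3: "has_bochner_integral N (\<lambda>\<omega>. ?P' \<omega> * ?P' \<omega>) I3"
      "has_bochner_integral lborel (\<lambda>y. ?f' y * ?f' y) I3"
    using step_integral_inner[OF t' t'] by blast
  have "has_bochner_integral N (\<lambda>\<omega>. ?P \<omega> * ?P \<omega> - 2 * (?P \<omega> * ?P' \<omega>) + ?P' \<omega> * ?P' \<omega>) (I1 - 2 * I2 + I3)"
    by (intro has_bochner_integral_add has_bochner_integral_diff has_bochner_integral_mult_right I1 I2 I3)
  then have 1: "has_bochner_integral N (\<lambda>\<omega>. (?P \<omega> - ?P' \<omega>)\<^sup>2) (I1 - 2 * I2 + I3)"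
    by (simp add: power2_eq_square algebra_simps)
  have "has_bochner_integral lborel (\<lambda>y. ?f y * ?f y - 2 * (?f y * ?f' y) + ?f' y * ?f' y) (I1 - 2 * I2 + I3)"
    by (intro has_bochner_integral_add has_bochner_integral_diff has_bochner_integral_mult_right I1 I2 I3)
  then have 2: "has_bochner_integral lborel (\<lambda>y. (?f y - ?f' y)\<^sup>2) (I1 - 2 * I2 + I3)"
    by (simp add: power2_eq_square algebra_simps)
  have "(\<integral>\<^sup>+\<omega>. ennreal ((?P \<omega> - ?P' \<omega>)\<^sup>2) \<partial>N) = ennreal (I1 - 2 * I2 + I3)"
    using 1 by (subst nn_integral_eq_integral) (auto simp: has_bochner_integral_iff)
  also have "\<dots> = (\<integral>\<^sup>+y. ennreal ((?f y - ?f' y)\<^sup>2) \<partial>lborel)"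
    using 2 by (subst nn_integral_eq_integral) (auto simp: has_bochner_integral_iff)
  also have "\<dots> = (\<integral>\<^sup>+y\<in>{0..}. ennreal ((?f y - ?f' y)\<^sup>2) \<partial>lborel)"
    by (rule nn_integral_cong) (auto simp: indicator_def step_fun_nonpos t t')
  finally show ?thesis .
qed

text \<open>Pass from I to an approximating elementary integral, cross over by the isometry, and
  return to f. The two applications of the squared triangle inequality account for the 4.\<close>

lemma wiener_integral_step_dist:
  assumes W: "is_wiener_integral N B f I" and t: "0 \<le> t 0" "mono t"
  shows "(\<integral>\<^sup>+\<omega>. ennreal ((I \<omega> - step_integral B n c t \<omega>)\<^sup>2) \<partial>N) \<le>
    4 * (\<integral>\<^sup>+y\<in>{0..}. ennreal ((f y - step_fun n c t y)\<^sup>2) \<partial>lborel)"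
    (is "?L \<le> 4 * ?R")
proof -
  have [measurable]: "f \<in> borel_measurable borel" "I \<in> borel_measurable N"
    using W by (auto simp: is_wiener_integral_def)
  obtain k d r where r: "\<And>m. 0 \<le> r m (0::nat)" "\<And>m. mono (r m)"
    and lim1: "(\<lambda>m. \<integral>\<^sup>+y\<in>{0..}. ennreal ((f y - step_fun (k m) (d m) (r m) y)\<^sup>2) \<partial>lborel) \<longlonglongrightarrow> 0"
    and lim2: "(\<lambda>m. \<integral>\<^sup>+\<omega>. ennreal ((I \<omega> - step_integral B (k m) (d m) (r m) \<omega>)\<^sup>2) \<partial>N) \<longlonglongrightarrow> 0"
    using W unfolding is_wiener_integral_def by blast
  let ?A = "\<lambda>m. \<integral>\<^sup>+y\<in>{0..}. ennreal ((f y - step_fun (k m) (d m) (r m) y)\<^sup>2) \<partial>lborel"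
  let ?E = "\<lambda>m. \<integral>\<^sup>+\<omega>. ennreal ((I \<omega> - step_integral B (k m) (d m) (r m) \<omega>)\<^sup>2) \<partial>N"
  have [measurable]: "step_integral B n c t \<in> borel_measurable N" by (rule step_integral_measurable[OF t])
  have [measurable]: "step_integral B (k m) (d m) (r m) \<in> borel_measurable N" for m
    by (rule step_integral_measurable[OF r])
  have "?L \<le> 2 * ?E m + 2 * (2 * ?A m + 2 * ?R)" for m
  proof -
    have "?L \<le> 2 * ?E m + 2 * (\<integral>\<^sup>+\<omega>. ennreal ((step_integral B (k m) (d m) (r m) \<omega> - step_integral B n c t \<omega>)\<^sup>2) \<partial>N)"
      using nn_integral_sq_triangle[of I N "step_integral B (k m) (d m) (r m)" "step_integral B n c t" "\<lambda>_. 1"] by simp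
    also have "(\<integral>\<^sup>+\<omega>. ennreal ((step_integral B (k m) (d m) (r m) \<omega> - step_integral B n c t \<omega>)\<^sup>2) \<partial>N) =
       (\<integral>\<^sup>+y\<in>{0..}. ennreal ((step_fun (k m) (d m) (r m) y - step_fun n c t y)\<^sup>2) \<partial>lborel)"
      by (rule step_integral_isometry[OF r t])
    also have "\<dots> \<le> 2 * (\<integral>\<^sup>+y\<in>{0..}. ennreal ((step_fun (k m) (d m) (r m) y - f y)\<^sup>2) \<partial>lborel) + 2 * ?R"
      by (rule nn_integral_sq_triangle) measurable
    also have "(\<integral>\<^sup>+y\<in>{0..}. ennreal ((step_fun (k m) (d m) (r m) y - f y)\<^sup>2) \<partial>lborel) = ?A m"
      by (simp add: power2_commute)
    finally show ?thesis by (simp add: add_left_mono mult_left_mono)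
  qed
  moreover have "(\<lambda>m. 2 * ?E m + 2 * (2 * ?A m + 2 * ?R)) \<longlonglongrightarrow> 2 * 0 + 2 * (2 * 0 + 2 * ?R)"
    by (intro tendsto_add ennreal_tendsto_cmult tendsto_const lim1 lim2) auto
  ultimately have "?L \<le> 2 * 0 + 2 * (2 * 0 + 2 * ?R)"
    by (intro LIMSEQ_le_const) auto
  then show ?thesis by (simp add: mult.assoc[symmetric])
qed

lemma bm_blocks_measurable[measurable]: "bm_blocks B m u \<in> borel_measurable N"
  unfolding bm_blocks_def by (rule step_integral_measurable) (auto intro: grid_mono)

lemma bm_blocks_increment:
  assumes m: "m \<ge> 1" and a: "0 < a" and u: "u \<in> {a..c}" and v: "v \<in> {a..c}"
  shows "(\<integral>\<^sup>+\<omega>. ennreal ((bm_blocks B m u \<omega> - bm_blocks B m v \<omega>)\<^sup>2) \<partial>N) \<le>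
    ennreal (exp_lip_const a c * exp a / a * (u - v)\<^sup>2)"
proof -
  let ?f = "\<lambda>u. step_fun (m * m) (\<lambda>i. exp (- (u * (real i / real m)))) (\<lambda>i. real i / real m)"
  let ?K = "exp_lip_const a c * exp a * (u - v)\<^sup>2"
  have K: "?K \<ge> 0" using exp_lip_const_nonneg[of a c] by simp
  have "(\<integral>\<^sup>+\<omega>. ennreal ((bm_blocks B m u \<omega> - bm_blocks B m v \<omega>)\<^sup>2) \<partial>N) =
      (\<integral>\<^sup>+y\<in>{0..}. ennreal ((?f u y - ?f v y)\<^sup>2) \<partial>lborel)"
    unfolding bm_blocks_def by (rule step_integral_isometry) (auto intro: grid_mono)
  also have "\<dots> \<le> (\<integral>\<^sup>+y. ennreal (?K * exp (- (a * y))) * indicator {0..} y \<partial>lborel)"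
  proof (rule nn_integral_mono)
    fix y :: real
    show "ennreal ((?f u y - ?f v y)\<^sup>2) * indicator {0..} y \<le> ennreal (?K * exp (- (a * y))) * indicator {0..} y"
    proof (cases "y > 0")
      case False
      then have "?f u y = 0" "?f v y = 0" by (auto intro!: step_fun_nonpos grid_mono)
      then show ?thesis by simp
    next
      case True
      \<comment> \<open>Both step functions live on the same grid, so their difference takes a
        single difference of exponentials on each cell.\<close>
      have sd: "?f u y - ?f v y = step_fun (m * m) (\<lambda>i. exp (- (u * (real i / real m))) - exp (- (v * (real i / real m)))) (\<lambda>i. real i / real m) y"
        by (simp add: step_fun_def sum_subtractf left_diff_distrib)
      have "(?f u y - ?f v y)\<^sup>2 \<le> ?K * exp (- (a * y))"
      proof (cases "y \<le> real (m * m) / real m")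
        case le: True
        then obtain k where k: "?f u y - ?f v y = exp (- (u * (real k / real m))) - exp (- (v * (real k / real m)))"
          "y \<le> real k / real m + 1 / real m"
          unfolding sd using step_fun_grid[OF m True] by blast
        have "(?f u y - ?f v y)\<^sup>2 \<le> exp_lip_const a c * exp (- (a * (real k / real m))) * (u - v)\<^sup>2"
          unfolding k(1) by (rule exp_param_diff_sq[OF a u v]) (auto intro: order_trans[of _ 0])
        also have "\<dots> \<le> exp_lip_const a c * (exp a * exp (- (a * y))) * (u - v)\<^sup>2"
        proof -
          have "1 / real m \<le> 1" using m by simp
          then have "y - 1 \<le> real k / real m" using k(2) by linarith
          then have "a * (y - 1) \<le> a * (real k / real m)" using a by (intro mult_left_mono) auto
          then have "exp (- (a * (real k / real m))) \<le> exp a * exp (- (a * y))"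
            unfolding exp_add[symmetric] by (simp add: algebra_simps)
          then show ?thesis
            using exp_lip_const_nonneg[of a c] by (intro mult_left_mono mult_right_mono) auto
        qed
        finally show ?thesis by (simp add: mult_ac)
      next
        case False
        then have "?f u y - ?f v y = 0" unfolding sd using step_fun_grid[OF m True] by auto
        then show ?thesis using K by simp
      qed
      then show ?thesis by (intro mult_right_mono ennreal_leI) auto
    qed
  qed
  also have "\<dots> = ennreal (?K * exp (- (a * 0)) / a)" by (rule nn_integral_exp_tail[OF a K])
  finally show ?thesis by (simp add: mult_ac)
qed

text \<open>On \<open>{0..m}\<close> the left endpoint is within 1 / m, giving u^2 / m^2 over a
  length m; beyond m the step function is 0 and the squared exponential is integrated.\<close>

lemma bm_blocks_close:
  assumes m: "m \<ge> 1" and u: "u > 0" and W: "is_wiener_integral N B (\<lambda>y. exp (- u * y)) I"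
  shows "(\<integral>\<^sup>+\<omega>. ennreal ((I \<omega> - bm_blocks B m u \<omega>)\<^sup>2) \<partial>N) \<le>
    ennreal (4 * (u\<^sup>2 / real m + exp (- (2 * u * real m)) / (2 * u)))"
proof -
  let ?f = "step_fun (m * m) (\<lambda>i. exp (- (u * (real i / real m)))) (\<lambda>i. real i / real m)"
  have mm: "real (m * m) / real m = real m" using m by simp
  have "(\<integral>\<^sup>+y\<in>{0..}. ennreal ((exp (- u * y) - ?f y)\<^sup>2) \<partial>lborel) \<le>
    (\<integral>\<^sup>+y. ennreal (u\<^sup>2 / (real m)\<^sup>2) * indicator {0..real m} y + ennreal (1 * exp (- (2 * u * y))) * indicator {real m..} y \<partial>lborel)"
  proof (rule nn_integral_mono_AE)
    \<comment> \<open>At y = 0 the step function vanishes, its first cell being open there, so this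
      point is excluded.\<close>
    have "AE y in lborel. y \<noteq> (0::real)" by (rule AE_lborel_singleton)
    then show "AE y in lborel. ennreal ((exp (- u * y) - ?f y)\<^sup>2) * indicator {0..} y \<le>
       ennreal (u\<^sup>2 / (real m)\<^sup>2) * indicator {0..real m} y + ennreal (1 * exp (- (2 * u * y))) * indicator {real m..} y"
    proof eventually_elim
      case (elim y)
      consider "y < 0" | "0 < y" "y \<le> real m" | "real m < y" using elim by linarith
      then show ?case
      proof cases
        case 2
        then obtain k where k: "?f y = exp (- (u * (real k / real m)))" "real k / real m < y" "y \<le> real k / real m + 1 / real m"
          using step_fun_grid[OF m 2(1), of "m * m" "\<lambda>i. exp (- (u * (real i / real m)))"] mm by auto
        have "\<bar>exp (- (u * y)) - exp (- (u * (real k / real m)))\<bar> \<le> \<bar>- (u * y) - - (u * (real k / real m))\<bar> * exp 0"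
          using u 2 by (intro exp_diff_le) auto
        also have "\<bar>- (u * y) - - (u * (real k / real m))\<bar> = u * (y - real k / real m)"
        proof -
          have "- (u * y) - - (u * (real k / real m)) = - (u * (y - real k / real m))"
            by (simp only: right_diff_distrib)
          then show ?thesis using u k(2) by (simp only: abs_minus abs_mult)
        qed
        also have "\<dots> \<le> u * (1 / real m)" using u k(3) by (intro mult_left_mono) auto
        finally have "\<bar>exp (- (u * y)) - exp (- (u * (real k / real m)))\<bar> \<le> u * (1 / real m)" by simp
        then have "(exp (- (u * y)) - exp (- (u * (real k / real m))))\<^sup>2 \<le> (u * (1 / real m))\<^sup>2"
          by (meson abs_le_square_iff abs_ge_self order_trans)
        then have "ennreal ((exp (- u * y) - ?f y)\<^sup>2) \<le> ennreal (u\<^sup>2 / (real m)\<^sup>2)"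
          using k(1) by (intro ennreal_leI) (simp add: power_divide)
        then show ?thesis using 2 by (simp add: add_increasing2)
      next
        case 3
        then have "?f y = 0" using step_fun_grid[OF m, of y "m * m" "\<lambda>i. exp (- (u * (real i / real m)))"] mm by auto
        then have "(exp (- u * y) - ?f y)\<^sup>2 = exp (- (2 * u * y))"
          by (simp add: power2_eq_square exp_add[symmetric])
        then show ?thesis using 3 by simp
      qed simp
    qed
  qed
  also have "\<dots> = ennreal (u\<^sup>2 / (real m)\<^sup>2) * ennreal (real m) + ennreal (1 * exp (- (2 * u * real m)) / (2 * u))"
    using u by (subst nn_integral_add) (auto simp: nn_integral_cmult nn_integral_exp_tail[of "2 * u" 1, simplified])
  also have "\<dots> = ennreal (u\<^sup>2 / real m + exp (- (2 * u * real m)) / (2 * u))"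
    using u m by (simp add: ennreal_mult[symmetric] ennreal_plus[symmetric] power2_eq_square del: ennreal_plus)
  finally have *: "(\<integral>\<^sup>+y\<in>{0..}. ennreal ((exp (- u * y) - ?f y)\<^sup>2) \<partial>lborel) \<le> ennreal (u\<^sup>2 / real m + exp (- (2 * u * real m)) / (2 * u))" .
  have "(\<integral>\<^sup>+\<omega>. ennreal ((I \<omega> - bm_blocks B m u \<omega>)\<^sup>2) \<partial>N) \<le> 4 * (\<integral>\<^sup>+y\<in>{0..}. ennreal ((exp (- u * y) - ?f y)\<^sup>2) \<partial>lborel)"
    unfolding bm_blocks_def by (rule wiener_integral_step_dist[OF W]) (auto intro: grid_mono)
  also have "\<dots> \<le> 4 * ennreal (u\<^sup>2 / real m + exp (- (2 * u * real m)) / (2 * u))"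
    by (intro mult_left_mono *) auto
  also have "\<dots> = ennreal (4 * (u\<^sup>2 / real m + exp (- (2 * u * real m)) / (2 * u)))"
    using u by (subst ennreal_mult) auto
  finally show ?thesis .
qed

end

section \<open>Weak convergence of the block sums\<close>

definition block_path :: "nat \<Rightarrow> (nat \<Rightarrow> real) \<Rightarrow> real \<Rightarrow> real" where
  "block_path m v u = (\<Sum>j<m * m. exp (- (u * (real j / real m))) * v j)"

lemma block_path_continuous: "continuous_on S (block_path m v)"
  unfolding block_path_def[abs_def] by (auto intro!: continuous_intros)

text \<open>For positive u the weights are at most 1. Convergence of paths is thereby reduced to
  that of m * m real coordinates.\<close>

lemma block_path_dist: "path_dist (block_path m v) (block_path m w) \<le> (\<Sum>j<m * m. \<bar>v j - w j\<bar>)"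
proof (rule path_dist_least)
  fix u :: real assume u: "u > 0"
  have "\<bar>block_path m v u - block_path m w u\<bar> = \<bar>\<Sum>j<m * m. exp (- (u * (real j / real m))) * (v j - w j)\<bar>"
    by (simp add: block_path_def sum_subtractf right_diff_distrib)
  also have "\<dots> \<le> (\<Sum>j<m * m. \<bar>v j - w j\<bar>)"
    using u by (intro order_trans[OF sum_abs] sum_mono) (auto simp: abs_mult intro!: mult_left_le_one_le)
  finally show "min \<bar>block_path m v u - block_path m w u\<bar> (min u (1 / u)) \<le> (\<Sum>j<m * m. \<bar>v j - w j\<bar>)"
    by simp
qed

lemma block_path_measurable:
  assumes h: "path_lipschitz L h" and sets: "\<And>j. j < m * m \<Longrightarrow> sets (M j) = sets borel"
  shows "(\<lambda>v. h (block_path m (\<lambda>j. c * v j))) \<in> borel_measurable (PiM {..<m * m} M)"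
proof (rule borel_measurable_path_lipschitz[where X = "\<lambda>u v. block_path m (\<lambda>j. c * v j) u", OF _ _ h])
  fix u :: real
  have "(\<lambda>v. v j) \<in> borel_measurable (PiM {..<m * m} M)" if "j < m * m" for j
    using measurable_component_singleton[of j "{..<m * m}" M] sets[OF that] that
    by (simp cong: measurable_cong_sets)
  then show "(\<lambda>v. block_path m (\<lambda>j. c * v j) u) \<in> borel_measurable (PiM {..<m * m} M)"
    unfolding block_path_def by (intro borel_measurable_sum borel_measurable_times borel_measurable_const) auto
qed (rule block_path_continuous)

text \<open>By Skorokhod's representation theorem in each coordinate, the independent block sums may be
  taken to converge pointwise.\<close>

lemma product_weak_convergence:
  fixes \<nu> :: "nat \<Rightarrow> real measure" and \<nu>0 :: "real measure"
  assumes \<nu>: "\<And>n. real_distribution (\<nu> n)" "real_distribution \<nu>0" "weak_conv_m \<nu> \<nu>0"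
    and h: "path_lipschitz L h" "\<And>f. continuous_on {0<..} f \<Longrightarrow> \<bar>h f\<bar> \<le> K"
    and n: "filterlim n at_top sequentially" and c: "c \<longlonglongrightarrow> c0"
  shows "(\<lambda>i. \<integral>v. h (block_path m (\<lambda>j. c i * v j)) \<partial>PiM {..<m * m} (\<lambda>_. \<nu> (n i))) \<longlonglongrightarrow>
    (\<integral>v. h (block_path m (\<lambda>j. c0 * v j)) \<partial>PiM {..<m * m} (\<lambda>_. \<nu>0))"
proof -
  obtain \<Omega> :: "real measure" and Yq Y where \<Omega>: "prob_space \<Omega>"
    and Yq[measurable]: "\<And>k. Yq k \<in> \<Omega> \<rightarrow>\<^sub>M borel" and Yq_law: "\<And>k. distr \<Omega> borel (Yq k) = \<nu> k"
    and Y: "Y \<in> \<Omega> \<rightarrow>\<^sub>M lborel" and Y_law: "distr \<Omega> borel Y = \<nu>0"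
    and conv: "\<And>x. x \<in> space \<Omega> \<Longrightarrow> (\<lambda>k. Yq k x) \<longlonglongrightarrow> Y x"
    using Skorohod[OF \<nu>] by blast
  have Y'[measurable]: "Y \<in> \<Omega> \<rightarrow>\<^sub>M borel" using Y by (simp cong: measurable_cong_sets)
  let ?I = "{..<m * m}"
  \<comment> \<open>Independent copies of one coupling, one for each block: independence is restored
    by the product, and convergence holds in every coordinate.\<close>
  let ?P = "PiM ?I (\<lambda>_. \<Omega>)"
  interpret P: prob_space ?P by (rule prob_space_PiM) (rule \<Omega>)
  have transfer: "(\<integral>v. h (block_path m (\<lambda>j. d * v j)) \<partial>PiM ?I (\<lambda>_. \<rho>)) =
      (\<integral>w. h (block_path m (\<lambda>j. d * compose ?I f w j)) \<partial>?P)"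
    and meas: "(\<lambda>w. h (block_path m (\<lambda>j. d * compose ?I f w j))) \<in> borel_measurable ?P"
    if f[measurable]: "f \<in> \<Omega> \<rightarrow>\<^sub>M borel" and law: "distr \<Omega> borel f = \<rho>" for f \<rho> d
  proof -
    have s: "sets \<rho> = sets borel" using law by auto
    have pr: "prob_space \<rho>" using prob_space.prob_space_distr[OF \<Omega> f] law by simp
    have f': "f \<in> \<Omega> \<rightarrow>\<^sub>M \<rho>" using f s by (simp cong: measurable_cong_sets)
    have "distr \<Omega> \<rho> f = distr \<Omega> borel f" by (rule distr_cong) (simp_all add: s)
    then have "distr \<Omega> \<rho> f = \<rho>" unfolding law .
    then have "PiM ?I (\<lambda>_. \<rho>) = distr ?P (PiM ?I (\<lambda>_. \<rho>)) (compose ?I f)"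
      using distr_PiM_finite_prob_space'[of ?I "\<lambda>_. \<Omega>" "\<lambda>_. \<rho>" f] \<Omega> pr f' by simp
    moreover have cm: "compose ?I f \<in> ?P \<rightarrow>\<^sub>M PiM ?I (\<lambda>_. \<rho>)"
      unfolding compose_def using f' by (intro measurable_restrict) (auto intro!: measurable_compose[OF measurable_component_singleton])
    moreover have hm: "(\<lambda>v. h (block_path m (\<lambda>j. d * v j))) \<in> borel_measurable (PiM ?I (\<lambda>_. \<rho>))"
      by (rule block_path_measurable[OF h(1)]) (rule s)
    ultimately show "(\<integral>v. h (block_path m (\<lambda>j. d * v j)) \<partial>PiM ?I (\<lambda>_. \<rho>)) =
      (\<integral>w. h (block_path m (\<lambda>j. d * compose ?I f w j)) \<partial>?P)"
      using integral_distr[OF cm hm] by simp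
    show "(\<lambda>w. h (block_path m (\<lambda>j. d * compose ?I f w j))) \<in> borel_measurable ?P"
      by (rule measurable_compose[OF cm hm])
  qed
  have "(\<lambda>i. \<integral>w. h (block_path m (\<lambda>j. c i * compose ?I (Yq (n i)) w j)) \<partial>?P) \<longlonglongrightarrow>
    (\<integral>w. h (block_path m (\<lambda>j. c0 * compose ?I Y w j)) \<partial>?P)"
  proof (rule integral_dominated_convergence[where w = "\<lambda>_. K"])
    show "(\<lambda>w. h (block_path m (\<lambda>j. c0 * compose ?I Y w j))) \<in> borel_measurable ?P"
      by (rule meas[OF Y' refl])
    show "(\<lambda>w. h (block_path m (\<lambda>j. c i * compose ?I (Yq (n i)) w j))) \<in> borel_measurable ?P" for i
      by (rule meas[OF Yq refl])
    show "AE w in ?P. norm (h (block_path m (\<lambda>j. c i * compose ?I (Yq (n i)) w j))) \<le> K" for i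
      using h(2)[OF block_path_continuous] by (intro AE_I2) simp
    show "AE w in ?P. (\<lambda>i. h (block_path m (\<lambda>j. c i * compose ?I (Yq (n i)) w j))) \<longlonglongrightarrow>
        h (block_path m (\<lambda>j. c0 * compose ?I Y w j))"
    proof (rule AE_I2)
      fix w assume w: "w \<in> space ?P"
      have lim: "(\<lambda>i. \<Sum>j<m * m. \<bar>c i * compose ?I (Yq (n i)) w j - c0 * compose ?I Y w j\<bar>) \<longlonglongrightarrow>
          (\<Sum>j<m * m. \<bar>c0 * Y (w j) - c0 * Y (w j)\<bar>)"
      proof (rule tendsto_sum)
        fix j assume j: "j \<in> {..<m * m}"
        have "w j \<in> space \<Omega>" using w j by (auto simp: space_PiM)
        then have "(\<lambda>i. Yq (n i) (w j)) \<longlonglongrightarrow> Y (w j)"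
          using filterlim_compose[OF conv n] by blast
        then have "(\<lambda>i. \<bar>c i * Yq (n i) (w j) - c0 * Y (w j)\<bar>) \<longlonglongrightarrow> \<bar>c0 * Y (w j) - c0 * Y (w j)\<bar>"
          by (intro tendsto_intros c)
        then show "(\<lambda>i. \<bar>c i * compose ?I (Yq (n i)) w j - c0 * compose ?I Y w j\<bar>) \<longlonglongrightarrow> \<bar>c0 * Y (w j) - c0 * Y (w j)\<bar>"
          using j by (simp add: compose_def)
      qed
      have L: "L \<ge> 0" using h(1) by (simp add: path_lipschitz_def)
      have "(\<lambda>i. h (block_path m (\<lambda>j. c i * compose ?I (Yq (n i)) w j)) - h (block_path m (\<lambda>j. c0 * compose ?I Y w j))) \<longlonglongrightarrow> 0"
      proof (rule Lim_null_comparison)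
        show "(\<lambda>i. L * (\<Sum>j<m * m. \<bar>c i * compose ?I (Yq (n i)) w j - c0 * compose ?I Y w j\<bar>)) \<longlonglongrightarrow> 0"
          using tendsto_mult[OF tendsto_const[of L] lim] by simp
        show "\<forall>\<^sub>F i in sequentially. norm (h (block_path m (\<lambda>j. c i * compose ?I (Yq (n i)) w j)) - h (block_path m (\<lambda>j. c0 * compose ?I Y w j)))
           \<le> L * (\<Sum>j<m * m. \<bar>c i * compose ?I (Yq (n i)) w j - c0 * compose ?I Y w j\<bar>)"
        proof (intro always_eventually allI)
          fix i
          have "norm (h (block_path m (\<lambda>j. c i * compose ?I (Yq (n i)) w j)) - h (block_path m (\<lambda>j. c0 * compose ?I Y w j)))
            \<le> L * path_dist (block_path m (\<lambda>j. c i * compose ?I (Yq (n i)) w j)) (block_path m (\<lambda>j. c0 * compose ?I Y w j))"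
            using h(1) block_path_continuous by (simp add: path_lipschitz_def)
          also have "\<dots> \<le> L * (\<Sum>j<m * m. \<bar>c i * compose ?I (Yq (n i)) w j - c0 * compose ?I Y w j\<bar>)"
            by (intro mult_left_mono block_path_dist L)
          finally show "norm (h (block_path m (\<lambda>j. c i * compose ?I (Yq (n i)) w j)) - h (block_path m (\<lambda>j. c0 * compose ?I Y w j)))
            \<le> L * (\<Sum>j<m * m. \<bar>c i * compose ?I (Yq (n i)) w j - c0 * compose ?I Y w j\<bar>)" .
        qed
      qed
      then show "(\<lambda>i. h (block_path m (\<lambda>j. c i * compose ?I (Yq (n i)) w j))) \<longlonglongrightarrow> h (block_path m (\<lambda>j. c0 * compose ?I Y w j))"
        by (simp add: LIM_zero_iff)
    qed
  qed simp
  then show ?thesis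
    unfolding transfer[OF Yq Yq_law] transfer[OF Y' Y_law] .
qed

lemma (in prob_space) indep_block_path_law:
  assumes V: "indep_vars (\<lambda>_. borel) V {..<m * m}" and m: "m \<ge> 1" and law: "\<And>j. j < m * m \<Longrightarrow> distr M borel (V j) = \<rho>"
    and h: "path_lipschitz L h"
  shows "expectation (\<lambda>\<omega>. h (block_path m (\<lambda>j. c * V j \<omega>))) = (\<integral>v. h (block_path m (\<lambda>j. c * v j)) \<partial>PiM {..<m * m} (\<lambda>_. \<rho>))"
proof -
  let ?I = "{..<m * m}"
  have rv: "j \<in> ?I \<Longrightarrow> V j \<in> borel_measurable M" for j using V unfolding indep_vars_def by simp
  have hm: "(\<lambda>v. h (block_path m (\<lambda>j. c * v j))) \<in> borel_measurable (PiM ?I (\<lambda>_. borel))"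
    by (rule block_path_measurable[OF h]) simp
  \<comment> \<open>The description of independence by a product law is applied with a nonempty
    index set.\<close>
  have "0 < m * m" using m by simp
  then have ne: "?I \<noteq> {}" by blast
  have "distr M (PiM ?I (\<lambda>_. borel)) (\<lambda>\<omega>. \<lambda>j\<in>?I. V j \<omega>) = PiM ?I (\<lambda>j. distr M borel (V j))"
    by (rule iffD1[OF indep_vars_iff_distr_eq_PiM'[OF ne rv] V])
  also have "\<dots> = PiM ?I (\<lambda>_. \<rho>)" by (rule PiM_cong) (auto simp: law)
  finally have "(\<integral>v. h (block_path m (\<lambda>j. c * v j)) \<partial>PiM ?I (\<lambda>_. \<rho>)) =
      expectation (\<lambda>\<omega>. h (block_path m (\<lambda>j. c * (\<lambda>j\<in>?I. V j \<omega>) j)))"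
    using integral_distr[OF _ hm, of "\<lambda>\<omega>. \<lambda>j\<in>?I. V j \<omega>" M] rv by (auto intro!: measurable_restrict)
  also have "\<dots> = expectation (\<lambda>\<omega>. h (block_path m (\<lambda>j. c * V j \<omega>)))"
  proof -
    have "block_path m (\<lambda>j. c * (\<lambda>j\<in>?I. V j \<omega>) j) = block_path m (\<lambda>j. c * V j \<omega>)" for \<omega>
      unfolding block_path_def by (intro ext sum.cong) auto
    then show ?thesis by simp
  qed
  finally show ?thesis by simp
qed

lemma bm_blocks_law:
  assumes BM: "standard_brownian_motion N B" and m: "m \<ge> 1" and h: "path_lipschitz L h"
  shows "(\<integral>\<omega>. h (\<lambda>u. \<sigma> * bm_blocks B m u \<omega>) \<partial>N) =
    (\<integral>v. h (block_path m (\<lambda>j. \<sigma> / sqrt (real m) * v j)) \<partial>PiM {..<m * m} (\<lambda>_. std_normal_distribution))"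
proof -
  interpret N: prob_space N using BM by (simp add: standard_brownian_motion_def)
  \<comment> \<open>Increments over length 1 / m become standard normal after multiplication by sqrt
    m; the inverse factor reappears in front of the coordinates.\<close>
  define V where "V j \<omega> = (B (real (Suc j) / real m) \<omega> - B (real j / real m) \<omega>) * sqrt (real m)" for j \<omega>
  have sm: "sqrt (real m) > 0" using m by simp
  have indep: "N.indep_vars (\<lambda>_. borel) (\<lambda>i \<omega>. B (real (Suc i) / real m) \<omega> - B (real i / real m) \<omega>) {..<m * m}"
  proof -
    have *: "\<forall>(t :: nat \<Rightarrow> real) n. 0 \<le> t 0 \<longrightarrow> mono t \<longrightarrow>
      N.indep_vars (\<lambda>_. borel) (\<lambda>i \<omega>. B (t (Suc i)) \<omega> - B (t i) \<omega>) {..<n}"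
      using BM unfolding standard_brownian_motion_def by (elim conjE)
    show ?thesis
      by (rule *[rule_format, of "\<lambda>i. real i / real m"]) (auto intro: grid_mono)
  qed
  have "N.indep_vars (\<lambda>_. borel) V {..<m * m}"
    using N.indep_vars_compose2[OF indep, of "\<lambda>_ x. x * sqrt (real m)" "\<lambda>_. borel"] by (simp add: V_def[abs_def])
  moreover have "distr N borel (V j) = std_normal_distribution" for j
  proof -
    have "0 \<le> real j / real m" "real j / real m < real (Suc j) / real m" using m by (auto simp: divide_strict_right_mono)
    from bm_normal[OF BM this]
    have "distributed N lborel (\<lambda>\<omega>. B (real (Suc j) / real m) \<omega> - B (real j / real m) \<omega>) (normal_density 0 (1 / sqrt (real m)))"
      using m by (simp add: diff_divide_distrib[symmetric] real_sqrt_divide)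
    then have "distributed N lborel (V j) std_normal_density"
      using N.normal_standard_normal_convert[of "1 / sqrt (real m)" "\<lambda>\<omega>. B (real (Suc j) / real m) \<omega> - B (real j / real m) \<omega>" 0] sm
      by (simp add: V_def[abs_def])
    then show ?thesis
      using distributed_distr_eq_density[of N lborel "V j" "\<lambda>x. ennreal (std_normal_density x)"]
      distr_cong[of N N borel lborel "V j" "V j"] by simp
  qed
  ultimately have "N.expectation (\<lambda>\<omega>. h (block_path m (\<lambda>j. \<sigma> / sqrt (real m) * V j \<omega>))) =
    (\<integral>v. h (block_path m (\<lambda>j. \<sigma> / sqrt (real m) * v j)) \<partial>PiM {..<m * m} (\<lambda>_. std_normal_distribution))"
    by (intro N.indep_block_path_law[OF _ m _ h]) auto
  moreover have "block_path m (\<lambda>j. \<sigma> / sqrt (real m) * V j \<omega>) = (\<lambda>u. \<sigma> * bm_blocks B m u \<omega>)" for \<omega>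
    using sm by (auto simp: fun_eq_iff block_path_def bm_blocks_def step_integral_def V_def sum_distrib_left intro!: sum.cong)
  ultimately show ?thesis by simp
qed

section \<open>Laws of the block sums\<close>

context perturbed_walk
begin

text \<open>By induction the law is that of a sum of two independent parts, neither of whose laws
  depends on the shift j.\<close>

lemma \<eta>_sum_law:
  "distr M borel (\<lambda>\<omega>. \<Sum>i<n. \<eta> (Suc (j + i)) \<omega>) = distr M borel (\<lambda>\<omega>. \<Sum>i<n. \<eta> (Suc i) \<omega>)"
proof (induction n)
  case (Suc n)
  have *: "distr M borel (\<lambda>\<omega>. \<Sum>i<Suc n. \<eta> (Suc (j + i)) \<omega>) =
      distr (distr M borel (\<lambda>\<omega>. \<Sum>i<n. \<eta> (Suc (j + i)) \<omega>) \<Otimes>\<^sub>M distr M borel (\<eta> 1)) borel (\<lambda>(a, b). a + b)" for j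
  proof -
    have "indep_var (PiM {j..<j + n} (\<lambda>_. borel)) (\<lambda>\<omega>. restrict (\<lambda>i. \<eta> (Suc i) \<omega>) {j..<j + n})
        (PiM {j + n} (\<lambda>_. borel)) (\<lambda>\<omega>. restrict (\<lambda>i. \<eta> (Suc i) \<omega>) {j + n})"
      by (rule indep_var_restrict[OF \<eta>_iid]) auto
    then have "indep_var borel ((\<lambda>p. \<Sum>i<n. p (j + i)) \<circ> (\<lambda>\<omega>. restrict (\<lambda>i. \<eta> (Suc i) \<omega>) {j..<j + n}))
        borel ((\<lambda>p. p (j + n)) \<circ> (\<lambda>\<omega>. restrict (\<lambda>i. \<eta> (Suc i) \<omega>) {j + n}))"
      by (rule indep_var_compose) (auto intro!: borel_measurable_sum measurable_component_singleton)
    then have "indep_var borel (\<lambda>\<omega>. \<Sum>i<n. \<eta> (Suc (j + i)) \<omega>) borel (\<eta> (Suc (j + n)))"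
      by (simp add: comp_def)
    then have d: "distr M (borel \<Otimes>\<^sub>M borel) (\<lambda>\<omega>. (\<Sum>i<n. \<eta> (Suc (j + i)) \<omega>, \<eta> (Suc (j + n)) \<omega>)) =
      distr M borel (\<lambda>\<omega>. \<Sum>i<n. \<eta> (Suc (j + i)) \<omega>) \<Otimes>\<^sub>M distr M borel (\<eta> (Suc (j + n)))"
      by (simp add: indep_var_distribution_eq)
    have "distr M borel (\<lambda>\<omega>. \<Sum>i<Suc n. \<eta> (Suc (j + i)) \<omega>) =
      distr (distr M (borel \<Otimes>\<^sub>M borel) (\<lambda>\<omega>. (\<Sum>i<n. \<eta> (Suc (j + i)) \<omega>, \<eta> (Suc (j + n)) \<omega>))) borel (\<lambda>(a, b). a + b)"
      by (subst distr_distr) (auto simp: comp_def)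
    then show ?thesis unfolding d using \<eta>_law[of "Suc (j + n)"] by simp
  qed
  show ?case using *[of j] *[of 0] Suc.IH by simp
qed simp

definition block_sum :: "nat \<Rightarrow> nat \<Rightarrow> 'a \<Rightarrow> real" where
  "block_sum n j \<omega> = (\<Sum>i<n. \<eta> (Suc (j * n + i)) \<omega>) / sqrt (real n * s\<^sup>2)"

lemma block_sum_indep: "indep_vars (\<lambda>_. borel) (block_sum n) L"
proof -
  have K: "disjoint_family_on (\<lambda>j. {j * n..<j * n + n}) L"
  proof -
    \<comment> \<open>Division by n recovers the number of the block, also when n = 0, since the
      blocks are then empty.\<close>
    have *: "i = j" if "k \<in> {i * n..<i * n + n}" "k \<in> {j * n..<j * n + n}" for i j k
    proof -
      have "k div n = i" "k div n = j" using that by (auto intro!: div_nat_eqI simp: mult.commute)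
      then show ?thesis by simp
    qed
    show ?thesis
      unfolding disjoint_family_on_def
    proof (intro ballI impI, rule equals0I)
      fix i j k assume "i \<noteq> j" "k \<in> {i * n..<i * n + n} \<inter> {j * n..<j * n + n}"
      then show False using *[of k i j] by blast
    qed
  qed
  have "indep_vars (\<lambda>j. PiM {j * n..<j * n + n} (\<lambda>_. borel)) (\<lambda>j \<omega>. restrict (\<lambda>i. \<eta> (Suc i) \<omega>) {j * n..<j * n + n}) L"
    by (rule indep_vars_restrict[OF \<eta>_iid _ K]) auto
  then have "indep_vars (\<lambda>_. borel) (\<lambda>j \<omega>. (\<Sum>i<n. restrict (\<lambda>i. \<eta> (Suc i) \<omega>) {j * n..<j * n + n} (j * n + i)) / sqrt (real n * s\<^sup>2)) L"
    by (rule indep_vars_compose2[where Y = "\<lambda>j p. (\<Sum>i<n. p (j * n + i)) / sqrt (real n * s\<^sup>2)"])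
      (auto intro!: borel_measurable_sum borel_measurable_divide measurable_component_singleton)
  then show ?thesis by (simp add: block_sum_def[abs_def])
qed

lemma block_sum_law: "distr M borel (block_sum n j) = distr M borel (\<lambda>\<omega>. (\<Sum>i<n. \<eta> (Suc i) \<omega>) / sqrt (real n * s\<^sup>2))"
proof -
  have "distr M borel (\<lambda>\<omega>. (\<Sum>i<n. \<eta> (Suc (j + i)) \<omega>) / sqrt (real n * s\<^sup>2)) =
    distr (distr M borel (\<lambda>\<omega>. \<Sum>i<n. \<eta> (Suc (j + i)) \<omega>)) borel (\<lambda>x. x / sqrt (real n * s\<^sup>2))" for j
    by (subst distr_distr) (auto simp: comp_def)
  from this[of "j * n"] this[of 0] show ?thesis
    by (simp add: block_sum_def[abs_def] \<eta>_sum_law[of "j * n"])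
qed

lemma block_sum_clt:
  assumes s: "s\<^sup>2 > 0"
  shows "weak_conv_m (\<lambda>n. distr M borel (\<lambda>\<omega>. (\<Sum>i<n. \<eta> (Suc i) \<omega>) / sqrt (real n * s\<^sup>2))) std_normal_distribution"
proof -
  \<comment> \<open>The theorem asks for a positive standard deviation, whereas only s^2 is known to
    be positive; hence |s|.\<close>
  have "weak_conv_m (\<lambda>n. distr M borel (\<lambda>\<omega>. (\<Sum>i<n. \<eta> (Suc i) \<omega>) / sqrt (real n * \<bar>s\<bar>\<^sup>2))) std_normal_distribution"
  proof (rule central_limit_theorem_zero_mean[OF \<eta>_iid])
    show "expectation (\<eta> (Suc n)) = 0" for n by (rule \<eta>_expectation) simp
    show "\<bar>s\<bar> > 0" using s by auto
    show "integrable M (\<lambda>\<omega>. (\<eta> (Suc n) \<omega>)\<^sup>2)" for n by (rule \<eta>_sq_integrable) simp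
    show "variance (\<eta> (Suc n)) = \<bar>s\<bar>\<^sup>2" for n
      using \<eta>_expectation[of "Suc n"] \<eta>_second_moment[of "Suc n"] by simp
    show "distr M borel (\<eta> (Suc n)) = distr M borel (\<eta> 1)" for n by (rule \<eta>_law) simp
  qed
  then show ?thesis by simp
qed

text \<open>All indices of one block share a weight, so the sum groups into blocks. Positivity of
  block length and variance allows the normalization of \<open>block_sum\<close> to be
  undone.\<close>

lemma block_series_path:
  assumes n: "block_length \<mu> m \<delta> > 0" and s: "s\<^sup>2 > 0"
  shows "(\<lambda>u. block_series m \<delta> u \<omega>) = block_path m (\<lambda>j. norming \<delta> * sqrt (real (block_length \<mu> m \<delta>) * s\<^sup>2) *
    block_sum (block_length \<mu> m \<delta>) j \<omega>)"
proof
  fix u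
  let ?n = "block_length \<mu> m \<delta>"
  let ?f = "\<lambda>k. block_weight \<mu> m \<delta> u k * \<eta> (Suc k) \<omega>"
  have q: "sqrt (real ?n * s\<^sup>2) > 0" using n s by simp
  have "(\<Sum>k<m * m * ?n. ?f k) = (\<Sum>j<m * m. \<Sum>k\<in>{j * ?n..<j * ?n + ?n}. ?f k)"
    by (rule sum.nat_group[symmetric])
  also have "\<dots> = (\<Sum>j<m * m. exp (- (u * (real j / real m))) * (sqrt (real ?n * s\<^sup>2) * block_sum ?n j \<omega>))"
  proof (rule sum.cong[OF refl])
    fix j assume j: "j \<in> {..<m * m}"
    have "?f k = exp (- (u * (real j / real m))) * \<eta> (Suc k) \<omega>" if k: "k \<in> {j * ?n..<j * ?n + ?n}" for k
    proof -
      have "k div ?n = j" using k by (auto intro!: div_nat_eqI simp: mult.commute)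
      moreover have "k < m * m * ?n"
      proof -
        have "k < Suc j * ?n" using k by simp
        also have "Suc j * ?n \<le> m * m * ?n" using j by (intro mult_right_mono) auto
        finally show ?thesis .
      qed
      ultimately show ?thesis by (simp add: block_weight_def)
    qed
    then have "(\<Sum>k\<in>{j * ?n..<j * ?n + ?n}. ?f k) = exp (- (u * (real j / real m))) * (\<Sum>k\<in>{j * ?n..<j * ?n + ?n}. \<eta> (Suc k) \<omega>)"
      unfolding sum_distrib_left by (rule sum.cong[OF refl])
    also have "(\<Sum>k\<in>{j * ?n..<j * ?n + ?n}. \<eta> (Suc k) \<omega>) = (\<Sum>i<?n. \<eta> (Suc (j * ?n + i)) \<omega>)"
      using sum.shift_bounds_nat_ivl[of "\<lambda>k. \<eta> (Suc k) \<omega>" 0 "j * ?n" ?n] by (simp add: atLeast0LessThan add.commute)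
    also have "\<dots> = sqrt (real ?n * s\<^sup>2) * block_sum ?n j \<omega>"
    proof -
      have "r > 0 \<Longrightarrow> x = r * (x / r)" for x r :: real by simp
      then show ?thesis unfolding block_sum_def using q by blast
    qed
    finally show "(\<Sum>k\<in>{j * ?n..<j * ?n + ?n}. ?f k) = exp (- (u * (real j / real m))) * (sqrt (real ?n * s\<^sup>2) * block_sum ?n j \<omega>)" .
  qed
  finally show "block_series m \<delta> u \<omega> = block_path m (\<lambda>j. norming \<delta> * sqrt (real ?n * s\<^sup>2) * block_sum ?n j \<omega>) u"
    by (simp add: block_series_def block_path_def sum_distrib_left mult_ac)
qed

lemma block_series_weak_convergence:
  assumes m: "m \<ge> 1" and s: "s\<^sup>2 > 0"
    and h: "path_lipschitz L h" "\<And>f. continuous_on {0<..} f \<Longrightarrow> \<bar>h f\<bar> \<le> K"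
    and BM: "standard_brownian_motion N B"
  shows "((\<lambda>\<delta>. expectation (\<lambda>\<omega>. h (\<lambda>u. block_series m \<delta> u \<omega>))) \<longlongrightarrow>
    (\<integral>\<omega>. h (\<lambda>u. sqrt (2 * s\<^sup>2 / \<mu>) * bm_blocks B m u \<omega>) \<partial>N)) (at_right 0)"
proof (rule tendsto_at_right_sequentially[OF zero_less_one])
  \<comment> \<open>The coupling and dominated convergence are sequential, so \<delta> tends to 0
    along an arbitrary sequence.\<close>
  fix d :: "nat \<Rightarrow> real"
  assume d: "\<And>i. 0 < d i" "\<And>i. d i < 1" and lim: "d \<longlonglongrightarrow> 0"
  let ?\<nu> = "\<lambda>n. distr M borel (\<lambda>\<omega>. (\<Sum>i<n. \<eta> (Suc i) \<omega>) / sqrt (real n * s\<^sup>2))"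
  define n where "n i = block_length \<mu> m (d i)" for i
  define c where "c i = norming (d i) * sqrt (real (n i) * s\<^sup>2)" for i
  have mpos: "real m > 0" using m by simp
  have dat: "filterlim d (at_right 0) sequentially"
    using d(1) by (intro tendsto_imp_filterlim_at_right lim always_eventually) auto
  have b: "real (n i) * (d i * \<mu>) \<le> 1 / real m" "1 / real m - d i * \<mu> < real (n i) * (d i * \<mu>)" for i
    unfolding n_def using block_length_bounds[OF m d(1) \<mu>_pos] by auto
  have nd: "(\<lambda>i. real (n i) * (d i * \<mu>)) \<longlonglongrightarrow> 1 / real m"
  proof (rule tendsto_sandwich)
    have "(\<lambda>i. 1 / real m - d i * \<mu>) \<longlonglongrightarrow> 1 / real m - 0 * \<mu>" by (intro tendsto_intros lim)
    then show "(\<lambda>i. 1 / real m - d i * \<mu>) \<longlonglongrightarrow> 1 / real m" by simp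
    show "\<forall>\<^sub>F i in sequentially. 1 / real m - d i * \<mu> \<le> real (n i) * (d i * \<mu>)"
      by (intro always_eventually allI less_imp_le b(2))
    show "\<forall>\<^sub>F i in sequentially. real (n i) * (d i * \<mu>) \<le> 1 / real m"
      by (intro always_eventually allI b(1))
  qed simp
  have nlim: "filterlim n at_top sequentially"
  proof -
    have "filterlim (\<lambda>i. d i * \<mu>) (at_right 0) sequentially"
      using tendsto_mult[OF lim tendsto_const[of \<mu>]] d(1) \<mu>_pos
      by (intro tendsto_imp_filterlim_at_right always_eventually) auto
    then have "filterlim (\<lambda>i. inverse (d i * \<mu>)) at_top sequentially"
      by (rule filterlim_compose[OF filterlim_inverse_at_top_right])
    then have at_top: "filterlim (\<lambda>i. real (n i) * (d i * \<mu>) * inverse (d i * \<mu>)) at_top sequentially"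
      by (rule filterlim_tendsto_pos_mult_at_top[OF nd, rotated]) (use mpos in simp)
    have eq: "real (n i) * (d i * \<mu>) * inverse (d i * \<mu>) = real (n i)" for i
    proof -
      have "x \<noteq> 0 \<Longrightarrow> y * x * inverse x = y" for x y :: real by simp
      moreover have "d i * \<mu> \<noteq> 0" using d(1)[of i] \<mu>_pos by simp
      ultimately show ?thesis by blast
    qed
    show ?thesis using at_top unfolding eq filterlim_sequentially_iff_filterlim_real[symmetric] .
  qed
  \<comment> \<open>The square of c is (1 - exp (- 2 * d)) / d times n * d * \<mu> times s^2 /
    \<mu>, with limits 2 and 1 / m for the first two factors.\<close>
  have clim: "c \<longlonglongrightarrow> sqrt (2 * s\<^sup>2 / \<mu>) / sqrt (real m)"
  proof -
    have "((\<lambda>x::real. (1 - exp (- (2 * x))) / x) \<longlongrightarrow> 2) (at_right 0)" by real_asymp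
    then have "(\<lambda>i. (1 - exp (- (2 * d i))) / d i) \<longlonglongrightarrow> 2" by (rule filterlim_compose[OF _ dat])
    then have "(\<lambda>i. sqrt ((1 - exp (- (2 * d i))) / d i * (real (n i) * (d i * \<mu>)) * (s\<^sup>2 / \<mu>))) \<longlonglongrightarrow>
      sqrt (2 * (1 / real m) * (s\<^sup>2 / \<mu>))" by (intro tendsto_intros nd)
    moreover have "sqrt ((1 - exp (- (2 * d i))) / d i * (real (n i) * (d i * \<mu>)) * (s\<^sup>2 / \<mu>)) = c i" for i
      unfolding c_def norming_def real_sqrt_mult[symmetric] using d(1)[of i] \<mu>_pos by simp
    moreover have "sqrt (2 * (1 / real m) * (s\<^sup>2 / \<mu>)) = sqrt (2 * s\<^sup>2 / \<mu>) / sqrt (real m)"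
      unfolding real_sqrt_divide[symmetric] by simp
    ultimately show ?thesis by simp
  qed
  have rd: "real_distribution (?\<nu> k)" for k
    by (rule real_distribution_distr) simp
  have "(\<lambda>i. \<integral>v. h (block_path m (\<lambda>j. c i * v j)) \<partial>PiM {..<m * m} (\<lambda>_. ?\<nu> (n i))) \<longlonglongrightarrow>
    (\<integral>v. h (block_path m (\<lambda>j. sqrt (2 * s\<^sup>2 / \<mu>) / sqrt (real m) * v j)) \<partial>PiM {..<m * m} (\<lambda>_. std_normal_distribution))"
    by (rule product_weak_convergence[OF rd real_dist_normal_dist block_sum_clt[OF s] h nlim clim])
  also have "(\<integral>v. h (block_path m (\<lambda>j. sqrt (2 * s\<^sup>2 / \<mu>) / sqrt (real m) * v j)) \<partial>PiM {..<m * m} (\<lambda>_. std_normal_distribution)) =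
    (\<integral>\<omega>. h (\<lambda>u. sqrt (2 * s\<^sup>2 / \<mu>) * bm_blocks B m u \<omega>) \<partial>N)"
    by (rule bm_blocks_law[OF BM m h(1), symmetric])
  finally show "(\<lambda>i. expectation (\<lambda>\<omega>. h (\<lambda>u. block_series m (d i) u \<omega>))) \<longlonglongrightarrow>
    (\<integral>\<omega>. h (\<lambda>u. sqrt (2 * s\<^sup>2 / \<mu>) * bm_blocks B m u \<omega>) \<partial>N)"
  proof (rule Lim_transform_eventually)
    have "\<forall>\<^sub>F i in sequentially. n i \<ge> 1" using nlim by (simp add: filterlim_at_top)
    then show "\<forall>\<^sub>F i in sequentially. (\<integral>v. h (block_path m (\<lambda>j. c i * v j)) \<partial>PiM {..<m * m} (\<lambda>_. ?\<nu> (n i))) =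
      expectation (\<lambda>\<omega>. h (\<lambda>u. block_series m (d i) u \<omega>))"
    proof eventually_elim
      case (elim i)
      then have "block_length \<mu> m (d i) > 0" by (simp add: n_def)
      from block_series_path[OF this s]
      have "expectation (\<lambda>\<omega>. h (\<lambda>u. block_series m (d i) u \<omega>)) = expectation (\<lambda>\<omega>. h (block_path m (\<lambda>j. c i * block_sum (n i) j \<omega>)))"
        by (simp add: c_def n_def)
      also have "\<dots> = (\<integral>v. h (block_path m (\<lambda>j. c i * v j)) \<partial>PiM {..<m * m} (\<lambda>_. ?\<nu> (n i)))"
        by (rule indep_block_path_law[OF block_sum_indep m block_sum_law h(1)])
      finally show ?case by simp
    qed
  qed
qed

end

section \<open>The limit theorem\<close>

lemma (in prob_space) expectation_close:
  fixes f g :: "'a \<Rightarrow> real"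
  assumes [measurable]: "f \<in> borel_measurable M" "g \<in> borel_measurable M"
    and f: "\<And>\<omega>. \<omega> \<in> space M \<Longrightarrow> \<bar>f \<omega>\<bar> \<le> K" and g: "\<And>\<omega>. \<omega> \<in> space M \<Longrightarrow> \<bar>g \<omega>\<bar> \<le> K"
    and A[measurable]: "A \<in> sets M" "emeasure M A \<le> ennreal p" and p: "p \<ge> 0" and r: "r \<ge> 0"
    and close: "\<And>\<omega>. \<omega> \<in> space M - A \<Longrightarrow> \<bar>f \<omega> - g \<omega>\<bar> \<le> r"
  shows "\<bar>expectation f - expectation g\<bar> \<le> r + 2 * K * p"
proof -
  have fi: "integrable M f" and gi: "integrable M g"
    using f g by (auto intro!: integrable_const_bound[of _ K] AE_I2)
  obtain \<omega> where "\<omega> \<in> space M" using not_empty by blast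
  then have K: "K \<ge> 0" using f[of \<omega>] by simp
  have ii: "integrable M (\<lambda>\<omega>. r + 2 * K * indicator A \<omega>)"
    by (intro Bochner_Integration.integrable_add integrable_mult_right) (auto simp: less_top[symmetric])
  have "\<bar>expectation f - expectation g\<bar> = \<bar>expectation (\<lambda>\<omega>. f \<omega> - g \<omega>)\<bar>" using fi gi by simp
  also have "\<dots> \<le> expectation (\<lambda>\<omega>. \<bar>f \<omega> - g \<omega>\<bar>)" by (rule integral_abs_bound)
  also have "\<dots> \<le> expectation (\<lambda>\<omega>. r + 2 * K * indicator A \<omega>)"
  proof (rule integral_mono[OF _ ii])
    show "integrable M (\<lambda>\<omega>. \<bar>f \<omega> - g \<omega>\<bar>)" using fi gi by simp
    fix \<omega> assume w: "\<omega> \<in> space M"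
    show "\<bar>f \<omega> - g \<omega>\<bar> \<le> r + 2 * K * indicator A \<omega>"
      using f[OF w] g[OF w] close[of \<omega>] w r by (cases "\<omega> \<in> A") auto
  qed
  also have "\<dots> = r + 2 * K * prob A"
    using A(1) by (simp add: prob_space Bochner_Integration.integral_add less_top[symmetric])
  also have "\<dots> \<le> r + 2 * K * p"
    using A(2) p K by (intro add_left_mono mult_left_mono) (auto simp: emeasure_eq_measure)
  finally show ?thesis .
qed

lemma AE_obtain_event:
  assumes "AE \<omega> in M. P \<omega>"
  obtains A where "A \<in> sets M" "AE \<omega> in M. \<omega> \<in> A" "\<And>\<omega>. \<omega> \<in> A \<Longrightarrow> P \<omega>"
proof -
  obtain A where A: "A \<in> null_sets M" "{\<omega>\<in>space M. \<not> P \<omega>} \<subseteq> A"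
    using assms by (auto simp: eventually_ae_filter)
  show ?thesis
  proof (rule that)
    show "space M - A \<in> sets M" using A by auto
    show "AE \<omega> in M. \<omega> \<in> space M - A" using AE_not_in[OF A(1)] AE_space by eventually_elim simp
    show "P \<omega>" if "\<omega> \<in> space M - A" for \<omega> using A(2) that by blast
  qed
qed

text \<open>One number serves as edge of the window, as distance of the paths on it, and with factor
  2 as probability of failure; the sum is the bound of \<open>expectation_close\<close>. Being below
  1 makes the window nondegenerate.\<close>

lemma lipschitz_tolerance:
  fixes K L e :: real
  assumes "e > 0" "K \<ge> 0" "L \<ge> 0"
  obtains e1 where "0 < e1" "e1 < 1" "L * e1 + 2 * K * (2 * e1) \<le> e"
proof -
  define e1 where "e1 = min (1 / 2) (e / (L + 4 * K + 1))"
  have p: "L + 4 * K + 1 > 0" using assms by simp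
  have "(L + 4 * K) * e1 \<le> (L + 4 * K + 1) * (e / (L + 4 * K + 1))"
    using assms p by (intro mult_mono) (auto simp: e1_def)
  also have "\<dots> = e" using p by simp
  finally have "L * e1 + 2 * K * (2 * e1) \<le> e" by (simp add: algebra_simps)
  moreover have "0 < e1" "e1 < 1" using assms p by (auto simp: e1_def)
  ultimately show ?thesis using that by blast
qed

section \<open>From the walk to the block sums\<close>

context perturbed_walk
begin

text \<open>Setting the series to 0 off \<Omega> makes every path continuous, not merely almost
  every one.\<close>

definition walk_series :: "'a set \<Rightarrow> real \<Rightarrow> real \<Rightarrow> 'a \<Rightarrow> real" where
  "walk_series \<Omega> \<delta> u \<omega> = (if \<omega> \<in> \<Omega> then norming \<delta> *
     (\<Sum>k. exp (- (u * (\<delta> * random_walk \<xi> k \<omega>))) * \<eta> (Suc k) \<omega>) else 0)"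

context
  fixes \<Omega> :: "'a set"
  assumes \<Omega>_sets[measurable]: "\<Omega> \<in> sets M" and \<Omega>_AE: "AE \<omega> in M. \<omega> \<in> \<Omega>"
    and \<Omega>_sub: "\<And>\<omega>. \<omega> \<in> \<Omega> \<Longrightarrow> subexponential (\<lambda>k. \<eta> (Suc k) \<omega>)"
    and \<Omega>_low: "\<And>\<omega>. \<omega> \<in> \<Omega> \<Longrightarrow> \<exists>R::nat. \<forall>k. \<mu> / 2 * real k - real R \<le> random_walk \<xi> k \<omega>"
begin

lemma walk_series_measurable[measurable]: "walk_series \<Omega> \<delta> u \<in> borel_measurable M"
  unfolding walk_series_def[abs_def] by measurable

lemma walk_series_continuous:
  assumes d: "\<delta> > 0"
  shows "continuous_on {0<..} (\<lambda>u. walk_series \<Omega> \<delta> u \<omega>)"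
proof (cases "\<omega> \<in> \<Omega>")
  case True
  obtain R :: nat where R: "\<And>k. \<mu> / 2 * real k - real R \<le> random_walk \<xi> k \<omega>" using \<Omega>_low[OF True] by blast
  have "\<delta> * \<mu> / 2 * real k - \<delta> * real R \<le> \<delta> * random_walk \<xi> k \<omega>" for k
    using mult_left_mono[OF R[of k], of \<delta>] d by (simp add: algebra_simps)
  from exp_series_continuous[OF \<Omega>_sub[OF True] this] d \<mu>_pos
  have "continuous_on {0<..} (\<lambda>u. \<Sum>k. exp (- (u * (\<delta> * random_walk \<xi> k \<omega>))) * \<eta> (Suc k) \<omega>)" by simp
  then show ?thesis using True by (simp add: walk_series_def continuous_on_mult_left)
qed (simp add: walk_series_def)

lemma discounted_series_version:
  assumes b: "0 < b" "b < 1"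
  shows "continuous_version M (\<lambda>u \<omega>. sqrt (1 - b\<^sup>2) * discounted_series \<xi> \<eta> b u \<omega>) (walk_series \<Omega> (- ln b))"
  unfolding continuous_version_def
proof (intro conjI allI impI ballI)
  have d: "- ln b > 0" using b by simp
  show "continuous_on {0<..} (\<lambda>u. walk_series \<Omega> (- ln b) u \<omega>)" for \<omega> by (rule walk_series_continuous[OF d])
  show "AE \<omega> in M. \<forall>u>0. sqrt (1 - b\<^sup>2) * discounted_series \<xi> \<eta> b u \<omega> = walk_series \<Omega> (- ln b) u \<omega>"
    using \<Omega>_AE
  proof eventually_elim
    case (elim \<omega>)
    have "exp (- (2 * - ln b)) = b\<^sup>2" using b by (simp add: exp_double)
    then have "norming (- ln b) = sqrt (1 - b\<^sup>2)" by (simp add: norming_def)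
    moreover have "b powr (u * random_walk \<xi> k \<omega>) = exp (- (u * (- ln b * random_walk \<xi> k \<omega>)))" for u k
      using b by (simp add: powr_def mult_ac)
    ultimately show ?case using elim by (simp add: walk_series_def discounted_series_def)
  qed
qed simp

lemma cutoff_series_eq_walk_series:
  assumes "\<omega> \<in> \<Omega>" "\<And>k. \<mu> / 2 * real k - R \<le> random_walk \<xi> k \<omega>"
  shows "cutoff_series R \<delta> u \<omega> = walk_series \<Omega> \<delta> u \<omega>"
proof -
  have "cutoff \<mu> R k (random_walk \<xi> k \<omega>) = random_walk \<xi> k \<omega>" for k
    using assms(2)[of k] by (simp add: cutoff_def)
  then show ?thesis using assms(1) by (simp add: cutoff_series_def walk_series_def)
qed

text \<open>The events decrease in R and by \<open>walk_lower_bound\<close> have a null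
  intersection; continuity from above gives R.\<close>

lemma cutoff_event:
  assumes e: "e > 0"
  obtains R :: nat where "emeasure M {\<omega>\<in>space M. \<not> (\<forall>k. \<mu> / 2 * real k - real R \<le> random_walk \<xi> k \<omega>)} \<le> ennreal e"
proof -
  define A where "A R = {\<omega>\<in>space M. \<not> (\<forall>k. \<mu> / 2 * real k - real R \<le> random_walk \<xi> k \<omega>)}" for R :: nat
  have A[measurable]: "A R \<in> sets M" for R unfolding A_def by measurable
  have dec: "decseq A"
  proof (rule decseq_SucI)
    fix R show "A (Suc R) \<le> A R" by (force simp: A_def not_le intro: less_le_trans)
  qed
  have "(\<Inter>R. A R) \<in> null_sets M"
  proof -
    have "AE \<omega> in M. \<omega> \<notin> (\<Inter>R. A R)" using walk_lower_bound by eventually_elim (auto simp: A_def)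
    then show ?thesis by (subst AE_iff_null_sets) auto
  qed
  then have "prob (\<Inter>R. A R) = 0" by (rule measure_eq_0_null_sets)
  moreover have "(\<lambda>R. prob (A R)) \<longlonglongrightarrow> prob (\<Inter>R. A R)"
    by (rule finite_Lim_measure_decseq[OF _ dec]) auto
  ultimately have "(\<lambda>R. prob (A R)) \<longlonglongrightarrow> 0" by simp
  then have "\<forall>\<^sub>F R in sequentially. prob (A R) < e" by (rule order_tendstoD(2)[OF _ e])
  then obtain R where "prob (A R) < e" by (auto simp: eventually_sequentially)
  then show ?thesis using that[of R] e by (simp add: A_def emeasure_eq_measure)
qed

text \<open>The order of choices matters: e1 fixes R, the window and C, these fix G and \<kappa>,
  and only then come m and \<delta>. In particular \<delta> * R < 1 holds eventually because R is
  already fixed.\<close>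

lemma walk_series_block_series_close:
  assumes h: "path_lipschitz L h" "\<And>f. continuous_on {0<..} f \<Longrightarrow> \<bar>h f\<bar> \<le> K" and e: "e > 0"
  shows "\<forall>\<^sub>F m in sequentially. \<forall>\<^sub>F \<delta> in at_right 0.
    \<bar>expectation (\<lambda>\<omega>. h (\<lambda>u. walk_series \<Omega> \<delta> u \<omega>)) - expectation (\<lambda>\<omega>. h (\<lambda>u. block_series m \<delta> u \<omega>))\<bar> \<le> e"
proof -
  have L: "L \<ge> 0" using h(1) by (simp add: path_lipschitz_def)
  have K: "K \<ge> 0" using h(2)[of "\<lambda>_. 0"] by simp
  obtain e1 where e1: "0 < e1" "e1 < 1" "L * e1 + 2 * K * (2 * e1) \<le> e"
    using lipschitz_tolerance[OF e K L] by blast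
  obtain R :: nat where R: "emeasure M {\<omega>\<in>space M. \<not> (\<forall>k. \<mu> / 2 * real k - real R \<le> random_walk \<xi> k \<omega>)} \<le> ennreal e1"
    using cutoff_event[OF e1(1)] by blast
  define c where "c = 1 / e1"
  have "1 < c" using e1 by (simp add: c_def)
  then have ac: "e1 < c" using e1 by linarith
  define C where "C = s\<^sup>2 * 8 * exp_lip_const e1 c * exp e1 * (1 + 2 / (e1 * \<mu>))"
  have C: "C \<ge> 0" unfolding C_def using exp_lip_const_nonneg[of e1 c] e1 \<mu>_pos by (intro mult_nonneg_nonneg add_nonneg_nonneg) auto
  obtain G \<kappa> where G: "finite G" "G \<subseteq> {e1..c}" "\<kappa> > 0" and chain: "controls_sup M e1 c C e1 G \<kappa>"
    by (rule chaining_small_sup[OF ac C e1(1), where M = M])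
  have "\<forall>\<^sub>F m in sequentially. \<forall>u\<in>G. \<forall>\<^sub>F \<delta> in at_right 0.
      (\<integral>\<^sup>+\<omega>. ennreal ((cutoff_series R \<delta> u \<omega> - block_series m \<delta> u \<omega>)\<^sup>2) \<partial>M) \<le> ennreal \<kappa>"
    using G e1 by (intro eventually_ball_finite ballI series_difference_small) auto
  then show ?thesis
    using eventually_ge_at_top[of 1]
  proof eventually_elim
    case (elim m)
    have "\<forall>\<^sub>F \<delta> in at_right 0. \<forall>u\<in>G. (\<integral>\<^sup>+\<omega>. ennreal ((cutoff_series R \<delta> u \<omega> - block_series m \<delta> u \<omega>)\<^sup>2) \<partial>M) \<le> ennreal \<kappa>"
      using G(1) elim(1) by (intro eventually_ball_finite) auto
    moreover have "\<forall>\<^sub>F \<delta>::real in at_right 0. \<delta> \<in> {0<..<1}" by (rule eventually_at_right_real) simp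
    moreover have "\<forall>\<^sub>F \<delta> in at_right 0. \<delta> * real R < 1"
    proof -
      have "((\<lambda>\<delta>. \<delta> * real R) \<longlongrightarrow> 0 * real R) (at_right 0)" by (intro tendsto_intros)
      then show ?thesis by (rule order_tendstoD(2)) simp
    qed
    ultimately show ?case
    proof eventually_elim
      case E: (elim \<delta>)
      have d: "\<delta> > 0" "\<delta> \<le> 1" and dR: "\<delta> * real R \<le> 1" using E by auto
      define D where "D u \<omega> = (if \<omega> \<in> \<Omega> then cutoff_series R \<delta> u \<omega> - block_series m \<delta> u \<omega> else 0)" for u \<omega>
      have "\<exists>A\<in>sets M. emeasure M A \<le> ennreal e1 \<and> (\<forall>\<omega>\<in>space M - A. \<forall>u\<in>{e1..c}. \<bar>D u \<omega>\<bar> \<le> e1)"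
      proof (rule controls_supD[OF chain])
        show "D u \<in> borel_measurable M" for u unfolding D_def[abs_def] by measurable
        show "continuous_on {e1..c} (\<lambda>u. D u \<omega>)" for \<omega>
        proof (cases "\<omega> \<in> \<Omega>")
          case True
          have "continuous_on {0<..} (\<lambda>u. cutoff_series R \<delta> u \<omega>)"
            by (rule cutoff_series_continuous[OF \<Omega>_sub[OF True] d(1)]) simp
          then have "continuous_on {e1..c} (\<lambda>u. cutoff_series R \<delta> u \<omega>)"
            by (rule continuous_on_subset) (use e1 in auto)
          then show ?thesis using True by (simp add: D_def continuous_on_diff block_series_continuous)
        qed (simp add: D_def)
        show "(\<integral>\<^sup>+\<omega>. ennreal ((D u \<omega> - D v \<omega>)\<^sup>2) \<partial>M) \<le> ennreal (C * (u - v)\<^sup>2)"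
          if uv: "u \<in> {e1..c}" "v \<in> {e1..c}" for u v
        proof -
          have "(\<integral>\<^sup>+\<omega>. ennreal ((D u \<omega> - D v \<omega>)\<^sup>2) \<partial>M) = (\<integral>\<^sup>+\<omega>. ennreal (((cutoff_series R \<delta> u \<omega> - block_series m \<delta> u \<omega>) -
            (cutoff_series R \<delta> v \<omega> - block_series m \<delta> v \<omega>))\<^sup>2) \<partial>M)"
            by (rule nn_integral_cong_AE) (use \<Omega>_AE in eventually_elim, simp add: D_def)
          also have "\<dots> \<le> ennreal (C * (u - v)\<^sup>2)"
            unfolding C_def by (rule series_difference_increment[OF elim(2) d _ dR e1(1) uv]) simp
          finally show ?thesis .
        qed
        show "(\<integral>\<^sup>+\<omega>. ennreal ((D u \<omega>)\<^sup>2) \<partial>M) \<le> ennreal \<kappa>" if "u \<in> G" for u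
        proof -
          have "(\<integral>\<^sup>+\<omega>. ennreal ((D u \<omega>)\<^sup>2) \<partial>M) = (\<integral>\<^sup>+\<omega>. ennreal ((cutoff_series R \<delta> u \<omega> - block_series m \<delta> u \<omega>)\<^sup>2) \<partial>M)"
            by (rule nn_integral_cong_AE) (use \<Omega>_AE in eventually_elim, simp add: D_def)
          then show ?thesis using E that by simp
        qed
      qed
      then obtain A where A: "A \<in> sets M" "emeasure M A \<le> ennreal e1"
        and small: "\<And>\<omega> u. \<omega> \<in> space M - A \<Longrightarrow> u \<in> {e1..c} \<Longrightarrow> \<bar>D u \<omega>\<bar> \<le> e1" by blast
      \<comment> \<open>Two ways to fail, each of probability at most e1: the chaining bound breaks,
        or the cutoff is active and the cut-off series differs from the true one.\<close>
      define A' where "A' = {\<omega>\<in>space M. \<not> (\<forall>k. \<mu> / 2 * real k - real R \<le> random_walk \<xi> k \<omega>)}"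
      have A': "A' \<in> sets M" unfolding A'_def by measurable
      have N: "space M - \<Omega> \<in> null_sets M"
        using \<Omega>_AE by (subst AE_iff_null_sets) auto
      have "emeasure M (A \<union> A' \<union> (space M - \<Omega>)) = emeasure M (A \<union> A')"
        using N A A' by (intro emeasure_Un_null_set) auto
      also have "\<dots> \<le> emeasure M A + emeasure M A'" by (rule emeasure_subadditive[OF A(1) A'])
      also have "\<dots> \<le> ennreal e1 + ennreal e1" using A(2) R by (intro add_mono) (auto simp: A'_def)
      also have "\<dots> = ennreal (2 * e1)" using e1 by (simp flip: ennreal_plus)
      finally have bad: "emeasure M (A \<union> A' \<union> (space M - \<Omega>)) \<le> ennreal (2 * e1)" .
      have "\<bar>expectation (\<lambda>\<omega>. h (\<lambda>u. walk_series \<Omega> \<delta> u \<omega>)) - expectation (\<lambda>\<omega>. h (\<lambda>u. block_series m \<delta> u \<omega>))\<bar>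
        \<le> L * e1 + 2 * K * (2 * e1)"
      proof (rule expectation_close[OF _ _ _ _ _ bad])
        show "(\<lambda>\<omega>. h (\<lambda>u. walk_series \<Omega> \<delta> u \<omega>)) \<in> borel_measurable M"
          by (rule borel_measurable_path_lipschitz[OF _ walk_series_continuous[OF d(1)] h(1)]) simp
        show "(\<lambda>\<omega>. h (\<lambda>u. block_series m \<delta> u \<omega>)) \<in> borel_measurable M"
          by (rule borel_measurable_path_lipschitz[OF _ block_series_continuous h(1)]) simp
        show "\<bar>h (\<lambda>u. walk_series \<Omega> \<delta> u \<omega>)\<bar> \<le> K" for \<omega> by (rule h(2)[OF walk_series_continuous[OF d(1)]])
        show "\<bar>h (\<lambda>u. block_series m \<delta> u \<omega>)\<bar> \<le> K" for \<omega> by (rule h(2)[OF block_series_continuous])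
        show "A \<union> A' \<union> (space M - \<Omega>) \<in> sets M" using A A' by auto
        show "\<bar>h (\<lambda>u. walk_series \<Omega> \<delta> u \<omega>) - h (\<lambda>u. block_series m \<delta> u \<omega>)\<bar> \<le> L * e1"
          if \<omega>: "\<omega> \<in> space M - (A \<union> A' \<union> (space M - \<Omega>))" for \<omega>
        proof -
          have "path_dist (\<lambda>u. walk_series \<Omega> \<delta> u \<omega>) (\<lambda>u. block_series m \<delta> u \<omega>) \<le> e1"
          proof (rule path_dist_leI[OF e1(1)])
            fix u assume u: "u \<in> {e1..1/e1}"
            have "cutoff_series R \<delta> u \<omega> = walk_series \<Omega> \<delta> u \<omega>"
              using \<omega> by (intro cutoff_series_eq_walk_series) (auto simp: A'_def)
            then show "\<bar>walk_series \<Omega> \<delta> u \<omega> - block_series m \<delta> u \<omega>\<bar> \<le> e1"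
              using small[of \<omega> u] \<omega> u by (auto simp: D_def c_def)
          qed
          then have "L * path_dist (\<lambda>u. walk_series \<Omega> \<delta> u \<omega>) (\<lambda>u. block_series m \<delta> u \<omega>) \<le> L * e1"
            using L by (rule mult_left_mono)
          then show ?thesis
            using h(1) walk_series_continuous[OF d(1), of \<omega>] block_series_continuous[of "{0<..}" m \<delta> \<omega>]
            unfolding path_lipschitz_def by (meson order_trans)
        qed
      qed (use e1 L in auto)
      then show ?case using e1(3) by linarith
    qed
  qed
qed

end

end

section \<open>From the Brownian blocks to the Wiener integral\<close>

lemma wiener_integral_increment:
  assumes BM: "standard_brownian_motion N B" and a: "0 < a" and u: "u \<in> {a..c}" and v: "v \<in> {a..c}"
    and Wu: "is_wiener_integral N B (\<lambda>y. exp (- u * y)) I" and Wv: "is_wiener_integral N B (\<lambda>y. exp (- v * y)) J"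
  shows "(\<integral>\<^sup>+\<omega>. ennreal ((I \<omega> - J \<omega>)\<^sup>2) \<partial>N) \<le> ennreal (4 * (exp_lip_const a c * exp a / a * (u - v)\<^sup>2))"
proof -
  have [measurable]: "I \<in> borel_measurable N" "J \<in> borel_measurable N" using Wu Wv by (auto simp: is_wiener_integral_def)
  note [measurable] = bm_blocks_measurable[OF BM]
  have uv: "u > 0" "v > 0" using u v a by auto
  define r where "r w m = 4 * (w\<^sup>2 / real m + exp (- (2 * w * real m)) / (2 * w))" for w and m :: nat
  define k where "k = exp_lip_const a c * exp a / a * (u - v)\<^sup>2"
  have k: "k \<ge> 0" using a exp_lip_const_nonneg[of a c] by (simp add: k_def)
  have r0: "r w m \<ge> 0" if "w > 0" for w m using that by (simp add: r_def)
  have rlim: "r w \<longlonglongrightarrow> 0" if "w > 0" for w unfolding r_def[abs_def] using that by real_asymp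
  \<comment> \<open>The increment is compared with that of the Brownian blocks, whose bound is
    uniform in m; letting m tend to infinity removes the approximation errors and leaves 2 * 2 *
    k.\<close>
  have "(\<integral>\<^sup>+\<omega>. ennreal ((I \<omega> - J \<omega>)\<^sup>2) \<partial>N) \<le> ennreal (2 * r u m + 2 * (2 * k + 2 * r v m))" if m: "m \<ge> 1" for m
  proof -
    let ?Z = "bm_blocks B m"
    have "(\<integral>\<^sup>+\<omega>. ennreal ((I \<omega> - J \<omega>)\<^sup>2) \<partial>N) \<le> 2 * (\<integral>\<^sup>+\<omega>. ennreal ((I \<omega> - ?Z u \<omega>)\<^sup>2) \<partial>N) + 2 * (\<integral>\<^sup>+\<omega>. ennreal ((?Z u \<omega> - J \<omega>)\<^sup>2) \<partial>N)"
      using nn_integral_sq_triangle[of I N "?Z u" J "\<lambda>_. 1"] by simp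
    also have "(\<integral>\<^sup>+\<omega>. ennreal ((?Z u \<omega> - J \<omega>)\<^sup>2) \<partial>N) \<le> 2 * (\<integral>\<^sup>+\<omega>. ennreal ((?Z u \<omega> - ?Z v \<omega>)\<^sup>2) \<partial>N) + 2 * (\<integral>\<^sup>+\<omega>. ennreal ((?Z v \<omega> - J \<omega>)\<^sup>2) \<partial>N)"
      using nn_integral_sq_triangle[of "?Z u" N "?Z v" J "\<lambda>_. 1"] by simp
    also have "(\<integral>\<^sup>+\<omega>. ennreal ((I \<omega> - ?Z u \<omega>)\<^sup>2) \<partial>N) \<le> ennreal (r u m)"
      unfolding r_def by (rule bm_blocks_close[OF BM m uv(1) Wu])
    also have "(\<integral>\<^sup>+\<omega>. ennreal ((?Z u \<omega> - ?Z v \<omega>)\<^sup>2) \<partial>N) \<le> ennreal k"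
      unfolding k_def by (rule bm_blocks_increment[OF BM m a u v])
    also have "(\<integral>\<^sup>+\<omega>. ennreal ((?Z v \<omega> - J \<omega>)\<^sup>2) \<partial>N) \<le> ennreal (r v m)"
      using bm_blocks_close[OF BM m uv(2) Wv] unfolding r_def by (simp add: power2_commute)
    also have "2 * ennreal (r u m) + 2 * (2 * ennreal k + 2 * ennreal (r v m)) = ennreal (2 * r u m + 2 * (2 * k + 2 * r v m))"
      using r0[OF uv(1), of m] r0[OF uv(2), of m] k by (simp add: ennreal_mult)
    finally show ?thesis by (simp add: add_mono mult_left_mono)
  qed
  moreover have "(\<lambda>m. ennreal (2 * r u m + 2 * (2 * k + 2 * r v m))) \<longlonglongrightarrow> ennreal (2 * 0 + 2 * (2 * k + 2 * 0))"
    by (intro tendsto_ennrealI tendsto_intros rlim uv)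
  ultimately have "(\<integral>\<^sup>+\<omega>. ennreal ((I \<omega> - J \<omega>)\<^sup>2) \<partial>N) \<le> ennreal (2 * 0 + 2 * (2 * k + 2 * 0))"
    by (intro LIMSEQ_le_const) (auto intro: exI[of _ 1])
  then show ?thesis by (simp add: k_def)
qed

lemma bm_blocks_continuous: "continuous_on S (\<lambda>u. bm_blocks B m u \<omega>)"
  by (auto simp: bm_blocks_def step_integral_def intro!: continuous_intros)

text \<open>Blocks and integral live on the same space and are locally uniformly close with
  probability near 1, which is stronger than closeness of laws.\<close>

lemma bm_blocks_weak_convergence:
  assumes BM: "standard_brownian_motion N B"
    and W: "\<And>u. u > 0 \<Longrightarrow> is_wiener_integral N B (\<lambda>y. exp (- u * y)) (W u)"
    and Wc: "\<And>\<omega>. \<omega> \<in> space N \<Longrightarrow> continuous_on {0<..} (\<lambda>u. W u \<omega>)"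
    and h: "path_lipschitz L h" "\<And>f. continuous_on {0<..} f \<Longrightarrow> \<bar>h f\<bar> \<le> K" and e: "e > 0" and \<sigma>: "\<sigma> \<ge> 0"
  shows "\<forall>\<^sub>F m in sequentially. \<bar>(\<integral>\<omega>. h (\<lambda>u. \<sigma> * bm_blocks B m u \<omega>) \<partial>N) - (\<integral>\<omega>. h (\<lambda>u. \<sigma> * W u \<omega>) \<partial>N)\<bar> \<le> e"
proof -
  interpret N: prob_space N using BM by (simp add: standard_brownian_motion_def)
  note [measurable] = bm_blocks_measurable[OF BM]
  have Wm: "u > 0 \<Longrightarrow> W u \<in> borel_measurable N" for u using W[of u] by (simp add: is_wiener_integral_def)
  have L: "L \<ge> 0" using h(1) by (simp add: path_lipschitz_def)
  have K: "K \<ge> 0" using h(2)[of "\<lambda>_. 0"] by simp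
  obtain e1 where e1: "0 < e1" "e1 < 1" "L * e1 + 2 * K * (2 * e1) \<le> e"
    using lipschitz_tolerance[OF e K L] by blast
  define c where "c = 1 / e1"
  have "1 < c" using e1 by (simp add: c_def)
  then have ac: "e1 < c" using e1 by linarith
  define k where "k = exp_lip_const e1 c * exp e1 / e1"
  have k: "k \<ge> 0" using e1 exp_lip_const_nonneg[of e1 c] by (simp add: k_def)
  \<comment> \<open>Squared increments of the blocks contribute k, those of the Wiener integral 4 *
    k, and the squared triangle inequality doubles both: 2 + 8 = 10.\<close>
  define C where "C = \<sigma>\<^sup>2 * (10 * k)"
  have C: "C \<ge> 0" using k by (simp add: C_def)
  have scale: "(\<integral>\<^sup>+\<omega>. ennreal ((\<sigma> * f \<omega>)\<^sup>2) \<partial>N) = ennreal (\<sigma>\<^sup>2) * (\<integral>\<^sup>+\<omega>. ennreal ((f \<omega>)\<^sup>2) \<partial>N)"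
    if [measurable]: "f \<in> borel_measurable N" for f
    by (subst nn_integral_cmult[symmetric]) (auto simp: power_mult_distrib ennreal_mult)
  obtain G \<kappa> where G: "finite G" "G \<subseteq> {e1..c}" "\<kappa> > 0" and chain: "controls_sup N e1 c C e1 G \<kappa>"
    by (rule chaining_small_sup[OF ac C e1(1), where M = N])
  have "\<forall>\<^sub>F m in sequentially. \<sigma>\<^sup>2 * (4 * (u\<^sup>2 / real m + exp (- (2 * u * real m)) / (2 * u))) < \<kappa>" if "u > 0" for u
  proof -
    have "(\<lambda>m. \<sigma>\<^sup>2 * (4 * (u\<^sup>2 / real m + exp (- (2 * u * real m)) / (2 * u)))) \<longlonglongrightarrow> \<sigma>\<^sup>2 * 0"
      by (intro tendsto_intros) (use that in real_asymp)
    then show ?thesis using G(3) by (auto elim: order_tendstoD(2))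
  qed
  then have "\<forall>\<^sub>F m in sequentially. \<forall>u\<in>G. \<sigma>\<^sup>2 * (4 * (u\<^sup>2 / real m + exp (- (2 * u * real m)) / (2 * u))) < \<kappa>"
    using G e1 by (intro eventually_ball_finite) auto
  then show ?thesis
    using eventually_ge_at_top[of 1]
  proof eventually_elim
    case (elim m)
    define D where "D u \<omega> = \<sigma> * bm_blocks B m u \<omega> - \<sigma> * W u \<omega>" for u \<omega>
    have "\<exists>A\<in>sets N. emeasure N A \<le> ennreal e1 \<and> (\<forall>\<omega>\<in>space N - A. \<forall>u\<in>{e1..c}. \<bar>D u \<omega>\<bar> \<le> e1)"
    proof (rule controls_supD[OF chain])
      show "D u \<in> borel_measurable N" if "u \<in> {e1..c}" for u
      proof -
        have [measurable]: "W u \<in> borel_measurable N" using that e1 by (intro Wm) auto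
        show ?thesis unfolding D_def[abs_def] by measurable
      qed
      show "continuous_on {e1..c} (\<lambda>u. D u \<omega>)" if "\<omega> \<in> space N" for \<omega>
        unfolding D_def using e1
        by (intro continuous_intros bm_blocks_continuous continuous_on_subset[OF Wc[OF that]]) auto
      show "(\<integral>\<^sup>+\<omega>. ennreal ((D u \<omega> - D v \<omega>)\<^sup>2) \<partial>N) \<le> ennreal (C * (u - v)\<^sup>2)"
        if uv: "u \<in> {e1..c}" "v \<in> {e1..c}" for u v
      proof -
        have p: "u > 0" "v > 0" using uv e1 by auto
        note [measurable] = Wm[OF p(1)] Wm[OF p(2)]
        let ?Z = "bm_blocks B m"
        have "(\<integral>\<^sup>+\<omega>. ennreal ((D u \<omega> - D v \<omega>)\<^sup>2) \<partial>N) = (\<integral>\<^sup>+\<omega>. ennreal ((\<sigma> * ((?Z u \<omega> - ?Z v \<omega>) - (W u \<omega> - W v \<omega>)))\<^sup>2) \<partial>N)"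
          by (simp add: D_def algebra_simps)
        also have "\<dots> = ennreal (\<sigma>\<^sup>2) * (\<integral>\<^sup>+\<omega>. ennreal (((?Z u \<omega> - ?Z v \<omega>) - (W u \<omega> - W v \<omega>))\<^sup>2) \<partial>N)"
          by (rule scale) measurable
        also have "(\<integral>\<^sup>+\<omega>. ennreal (((?Z u \<omega> - ?Z v \<omega>) - (W u \<omega> - W v \<omega>))\<^sup>2) \<partial>N) \<le>
            2 * (\<integral>\<^sup>+\<omega>. ennreal ((?Z u \<omega> - ?Z v \<omega>)\<^sup>2) \<partial>N) + 2 * (\<integral>\<^sup>+\<omega>. ennreal ((W u \<omega> - W v \<omega>)\<^sup>2) \<partial>N)"
          using nn_integral_sq_triangle[of "\<lambda>\<omega>. ?Z u \<omega> - ?Z v \<omega>" N "\<lambda>_. 0" "\<lambda>\<omega>. W u \<omega> - W v \<omega>" "\<lambda>_. 1"]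
          by (simp only: diff_0 diff_0_right power2_minus mult_1_right) measurable
        also have "(\<integral>\<^sup>+\<omega>. ennreal ((?Z u \<omega> - ?Z v \<omega>)\<^sup>2) \<partial>N) \<le> ennreal (k * (u - v)\<^sup>2)"
          unfolding k_def by (rule bm_blocks_increment[OF BM elim(2) e1(1) uv])
        also have "(\<integral>\<^sup>+\<omega>. ennreal ((W u \<omega> - W v \<omega>)\<^sup>2) \<partial>N) \<le> ennreal (4 * (k * (u - v)\<^sup>2))"
          unfolding k_def by (rule wiener_integral_increment[OF BM e1(1) uv W[OF p(1)] W[OF p(2)]])
        also have "ennreal (\<sigma>\<^sup>2) * (2 * ennreal (k * (u - v)\<^sup>2) + 2 * ennreal (4 * (k * (u - v)\<^sup>2))) = ennreal (C * (u - v)\<^sup>2)"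
        proof -
          have ten: "2 * ennreal x + 2 * ennreal (4 * x) = ennreal (10 * x)" if "x \<ge> 0" for x
            using that by (simp add: ennreal_mult[symmetric] ennreal_plus[symmetric] ennreal_numeral[symmetric] del: ennreal_plus ennreal_numeral)
          have "k * (u - v)\<^sup>2 \<ge> 0" using k by simp
          from ten[OF this] show ?thesis by (simp add: C_def ennreal_mult'[symmetric] mult_ac)
        qed
        finally show ?thesis by (simp add: add_mono mult_left_mono)
      qed
      show "(\<integral>\<^sup>+\<omega>. ennreal ((D u \<omega>)\<^sup>2) \<partial>N) \<le> ennreal \<kappa>" if u: "u \<in> G" for u
      proof -
        have p: "u > 0" using u G e1 by auto
        note [measurable] = Wm[OF p]
        have "(\<integral>\<^sup>+\<omega>. ennreal ((D u \<omega>)\<^sup>2) \<partial>N) = (\<integral>\<^sup>+\<omega>. ennreal ((\<sigma> * (W u \<omega> - bm_blocks B m u \<omega>))\<^sup>2) \<partial>N)"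
          by (simp add: D_def right_diff_distrib power2_commute)
        also have "\<dots> = ennreal (\<sigma>\<^sup>2) * (\<integral>\<^sup>+\<omega>. ennreal ((W u \<omega> - bm_blocks B m u \<omega>)\<^sup>2) \<partial>N)"
          by (rule scale) measurable
        also have "\<dots> \<le> ennreal (\<sigma>\<^sup>2) * ennreal (4 * (u\<^sup>2 / real m + exp (- (2 * u * real m)) / (2 * u)))"
          by (intro mult_left_mono bm_blocks_close[OF BM elim(2) p W[OF p]]) simp
        also have "\<dots> = ennreal (\<sigma>\<^sup>2 * (4 * (u\<^sup>2 / real m + exp (- (2 * u * real m)) / (2 * u))))"
          by (rule ennreal_mult'[symmetric]) simp
        also have "\<dots> \<le> ennreal \<kappa>" using elim(1) u by (intro ennreal_leI less_imp_le) auto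
        finally show ?thesis .
      qed
    qed
    then obtain A where A: "A \<in> sets N" "emeasure N A \<le> ennreal e1"
      and small: "\<And>\<omega> u. \<omega> \<in> space N - A \<Longrightarrow> u \<in> {e1..c} \<Longrightarrow> \<bar>D u \<omega>\<bar> \<le> e1" by blast
    have Zc: "continuous_on {0<..} (\<lambda>u. \<sigma> * bm_blocks B m u \<omega>)" for \<omega>
      by (intro continuous_intros bm_blocks_continuous)
    have Wc': "continuous_on {0<..} (\<lambda>u. \<sigma> * W u \<omega>)" if "\<omega> \<in> space N" for \<omega>
      by (intro continuous_intros Wc that)
    have "\<bar>(\<integral>\<omega>. h (\<lambda>u. \<sigma> * bm_blocks B m u \<omega>) \<partial>N) - (\<integral>\<omega>. h (\<lambda>u. \<sigma> * W u \<omega>) \<partial>N)\<bar> \<le> L * e1 + 2 * K * e1"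
    proof (rule N.expectation_close[OF _ _ _ _ A])
      show "(\<lambda>\<omega>. h (\<lambda>u. \<sigma> * bm_blocks B m u \<omega>)) \<in> borel_measurable N"
        by (rule borel_measurable_path_lipschitz[OF _ Zc h(1)]) measurable
      show "(\<lambda>\<omega>. h (\<lambda>u. \<sigma> * W u \<omega>)) \<in> borel_measurable N"
        by (rule borel_measurable_path_lipschitz[OF _ Wc' h(1)]) (intro borel_measurable_times borel_measurable_const Wm)
      show "\<bar>h (\<lambda>u. \<sigma> * bm_blocks B m u \<omega>)\<bar> \<le> K" for \<omega> by (rule h(2)[OF Zc])
      show "\<bar>h (\<lambda>u. \<sigma> * W u \<omega>)\<bar> \<le> K" if "\<omega> \<in> space N" for \<omega> by (rule h(2)[OF Wc'[OF that]])
      show "\<bar>h (\<lambda>u. \<sigma> * bm_blocks B m u \<omega>) - h (\<lambda>u. \<sigma> * W u \<omega>)\<bar> \<le> L * e1" if \<omega>: "\<omega> \<in> space N - A" for \<omega>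
      proof -
        have "path_dist (\<lambda>u. \<sigma> * bm_blocks B m u \<omega>) (\<lambda>u. \<sigma> * W u \<omega>) \<le> e1"
          using small[OF \<omega>] by (intro path_dist_leI[OF e1(1)]) (auto simp: D_def c_def)
        then have "L * path_dist (\<lambda>u. \<sigma> * bm_blocks B m u \<omega>) (\<lambda>u. \<sigma> * W u \<omega>) \<le> L * e1"
          using L by (rule mult_left_mono)
        then show ?thesis
          using h(1) Zc[of \<omega>] Wc'[of \<omega>] \<omega> unfolding path_lipschitz_def by (meson DiffD1 order_trans)
      qed
    qed (use e1 L in auto)
    moreover have "2 * K * e1 \<le> 2 * K * (2 * e1)" using K e1 by (intro mult_left_mono) auto
    ultimately show ?case using e1(3) by linarith
  qed
qed

text \<open>The approximation of x by y m need only hold eventually in i for each large m: a single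
  m is fixed before the limit along F is taken.\<close>

lemma iterated_approximation_limit:
  fixes x :: "'i \<Rightarrow> real" and y :: "nat \<Rightarrow> 'i \<Rightarrow> real" and z :: "nat \<Rightarrow> real"
  assumes xy: "\<And>e. e > 0 \<Longrightarrow> \<forall>\<^sub>F m in sequentially. \<forall>\<^sub>F i in F. \<bar>x i - y m i\<bar> \<le> e"
    and yz: "\<And>m. m \<ge> 1 \<Longrightarrow> (y m \<longlongrightarrow> z m) F"
    and zw: "\<And>e. e > 0 \<Longrightarrow> \<forall>\<^sub>F m in sequentially. \<bar>z m - w\<bar> \<le> e"
  shows "(x \<longlongrightarrow> w) F"
proof (rule tendstoI)
  fix e :: real assume "e > 0"
  then have e: "e / 4 > 0" by simp
  have "\<forall>\<^sub>F m in sequentially. (\<forall>\<^sub>F i in F. \<bar>x i - y m i\<bar> \<le> e / 4) \<and> \<bar>z m - w\<bar> \<le> e / 4 \<and> m \<ge> 1"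
    using xy[OF e] zw[OF e] eventually_ge_at_top[of 1] by eventually_elim simp
  then obtain m where m: "\<forall>\<^sub>F i in F. \<bar>x i - y m i\<bar> \<le> e / 4" "\<bar>z m - w\<bar> \<le> e / 4" "m \<ge> 1"
    by (auto simp: eventually_sequentially)
  have "\<forall>\<^sub>F i in F. dist (y m i) (z m) < e / 4" using tendstoD[OF yz[OF m(3)] e] .
  with m(1) show "\<forall>\<^sub>F i in F. dist (x i) w < e"
  proof eventually_elim
    case (elim i)
    then show ?case using m(2) \<open>e > 0\<close> unfolding dist_real_def by linarith
  qed
qed

theorem theorem1p2:
  fixes M :: "'a measure" and N :: "'b measure"
    and \<xi> \<eta> :: "'a \<Rightarrow> real"
    and \<xi>s \<eta>s :: "nat \<Rightarrow> 'a \<Rightarrow> real"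
    and \<mu> s :: real
    and B :: "real \<Rightarrow> 'b \<Rightarrow> real"
    and W :: "real \<Rightarrow> 'b \<Rightarrow> real"
  assumes "prob_space M"
    and "\<xi> \<in> borel_measurable M" and "\<eta> \<in> borel_measurable M"
    and "prob_space.indep_vars M (\<lambda>_. borel) (\<lambda>k \<omega>. (\<xi>s k \<omega>, \<eta>s k \<omega>)) {1..}"
    and "\<forall>k\<ge>1. distr M borel (\<lambda>\<omega>. (\<xi>s k \<omega>, \<eta>s k \<omega>)) = distr M borel (\<lambda>\<omega>. (\<xi> \<omega>, \<eta> \<omega>))"
    and "integrable M \<xi>" and "\<mu> = prob_space.expectation M \<xi>" and "0 < \<mu>"
    and "integrable M \<eta>" and "prob_space.expectation M \<eta> = 0"
    and "integrable M (\<lambda>\<omega>. (\<eta> \<omega>)\<^sup>2)" and "s\<^sup>2 = prob_space.variance M \<eta>" and "0 < s\<^sup>2"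
    and "standard_brownian_motion N B"
    and "\<forall>u>0. is_wiener_integral N B (\<lambda>y. exp (- u * y)) (W u)"
    and "AE \<omega> in N. continuous_on {0<..} (\<lambda>u. W u \<omega>)"
  shows "J1_weak_conv M (\<lambda>b u \<omega>. sqrt (1 - b\<^sup>2) * discounted_series \<xi>s \<eta>s b u \<omega>) (at_left 1)
           N (\<lambda>u \<omega>. sqrt (2 * s\<^sup>2 / \<mu>) * W u \<omega>)"
proof -
  note indep = assms(4) and law = assms(5)[rule_format] and BM = assms(14)
  interpret M: prob_space M by fact
  interpret N: prob_space N using BM by (simp add: standard_brownian_motion_def)
  have pair: "(\<lambda>\<omega>. (\<xi>s k \<omega>, \<eta>s k \<omega>)) \<in> borel_measurable M" if "k \<ge> 1" for k
    using indep that unfolding M.indep_vars_def by simp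
  have pair0: "(\<lambda>\<omega>. (\<xi> \<omega>, \<eta> \<omega>)) \<in> borel_measurable M"
    unfolding borel_prod[symmetric] using assms(2,3) by measurable
  have fst_m: "(fst :: real \<times> real \<Rightarrow> real) \<in> borel_measurable borel" and snd_m: "(snd :: real \<times> real \<Rightarrow> real) \<in> borel_measurable borel"
    unfolding borel_prod[symmetric] by measurable
  have \<xi>s_m: "\<xi>s k \<in> borel_measurable M" and \<eta>s_m: "\<eta>s k \<in> borel_measurable M" if "k \<ge> 1" for k
    using measurable_compose[OF pair[OF that] fst_m] measurable_compose[OF pair[OF that] snd_m] by simp_all
  have \<xi>_law: "distr M borel (\<xi>s k) = distr M borel \<xi>" if "k \<ge> 1" for k
    using arg_cong[OF law[OF that], of "\<lambda>D. distr D borel fst"]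
    by (simp add: distr_distr[OF fst_m pair[OF that]] distr_distr[OF fst_m pair0] comp_def)
  have \<eta>_law: "distr M borel (\<eta>s k) = distr M borel \<eta>" if "k \<ge> 1" for k
    using arg_cong[OF law[OF that], of "\<lambda>D. distr D borel snd"]
    by (simp add: distr_distr[OF snd_m pair[OF that]] distr_distr[OF snd_m pair0] comp_def)
  have transfer: "integrable M (\<lambda>\<omega>. g (Z \<omega>)) \<longleftrightarrow> integrable M (\<lambda>\<omega>. g (Z' \<omega>))"
    "M.expectation (\<lambda>\<omega>. g (Z \<omega>)) = M.expectation (\<lambda>\<omega>. g (Z' \<omega>))"
    if Z: "Z \<in> borel_measurable M" "Z' \<in> borel_measurable M" "distr M borel Z = distr M borel Z'"
      and g: "g \<in> borel_measurable borel" for Z Z' :: "'a \<Rightarrow> real" and g :: "real \<Rightarrow> real"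
    using integrable_distr_eq[OF Z(1) g] integrable_distr_eq[OF Z(2) g] integral_distr[OF Z(1) g] integral_distr[OF Z(2) g] Z(3)
    by auto
  have sq: "(\<lambda>x::real. x\<^sup>2) \<in> borel_measurable borel" and id: "(\<lambda>x::real. x) \<in> borel_measurable borel" by measurable
  note T\<xi> = transfer[OF \<xi>s_m[of 1] assms(2) \<xi>_law[of 1] id] and T\<eta> = transfer[OF \<eta>s_m[of 1] assms(3) \<eta>_law[of 1] id]
    and T\<eta>2 = transfer[OF \<eta>s_m[of 1] assms(3) \<eta>_law[of 1] sq]
  interpret P: perturbed_walk M \<xi>s \<eta>s \<mu> s
  proof unfold_locales
    show "distr M borel (\<xi>s k) = distr M borel (\<xi>s 1)" "distr M borel (\<eta>s k) = distr M borel (\<eta>s 1)" if "1 \<le> k" for k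
      using \<xi>_law[of k] \<xi>_law[of 1] \<eta>_law[of k] \<eta>_law[of 1] that by simp_all
  \<comment> \<open>As the mean of \<eta> is 0, its variance is the second moment that the locale
    asks for.\<close>
  qed (use indep T\<xi> T\<eta> T\<eta>2 assms in simp_all)
  have "AE \<omega> in M. subexponential (\<lambda>k. \<eta>s (Suc k) \<omega>) \<and> (\<exists>R::nat. \<forall>k. \<mu> / 2 * real k - real R \<le> random_walk \<xi>s k \<omega>)"
    using P.\<eta>_subexponential P.walk_lower_bound by eventually_elim simp
  then obtain \<Omega> where \<Omega>: "\<Omega> \<in> sets M" "AE \<omega> in M. \<omega> \<in> \<Omega>" "\<And>\<omega>. \<omega> \<in> \<Omega> \<Longrightarrow> subexponential (\<lambda>k. \<eta>s (Suc k) \<omega>)"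
      "\<And>\<omega>. \<omega> \<in> \<Omega> \<Longrightarrow> \<exists>R::nat. \<forall>k. \<mu> / 2 * real k - real R \<le> random_walk \<xi>s k \<omega>"
    by (rule AE_obtain_event) blast
  obtain \<Omega>' where \<Omega>': "\<Omega>' \<in> sets N" "AE \<omega> in N. \<omega> \<in> \<Omega>'" "\<And>\<omega>. \<omega> \<in> \<Omega>' \<Longrightarrow> continuous_on {0<..} (\<lambda>u. W u \<omega>)"
    using AE_obtain_event[OF assms(16)] by blast
  \<comment> \<open>Paths of W are continuous only almost surely; on the exceptional event they are
    replaced by 0.\<close>
  define W' where "W' u \<omega> = (if \<omega> \<in> \<Omega>' then W u \<omega> else 0)" for u \<omega>
  define \<sigma> where "\<sigma> = sqrt (2 * s\<^sup>2 / \<mu>)"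
  have Wm: "W u \<in> borel_measurable N" if "u > 0" for u
    using assms(15) that by (simp add: is_wiener_integral_def)
  have W'm: "W' u \<in> borel_measurable N" if "u > 0" for u
    unfolding W'_def[abs_def] using Wm[OF that] \<Omega>'(1) by measurable
  have W'c: "continuous_on {0<..} (\<lambda>u. W' u \<omega>)" for \<omega>
    using \<Omega>'(3)[of \<omega>] by (cases "\<omega> \<in> \<Omega>'") (simp_all add: W'_def)
  have W'w: "is_wiener_integral N B (\<lambda>y. exp (- u * y)) (W' u)" if u: "u > 0" for u
  proof -
    \<comment> \<open>A change on a null set preserves all L2-distances, so the same step functions
      show that \<open>W'\<close> is still a Wiener integral.\<close>
    have "(\<integral>\<^sup>+\<omega>. ennreal ((W' u \<omega> - J \<omega>)\<^sup>2) \<partial>N) = (\<integral>\<^sup>+\<omega>. ennreal ((W u \<omega> - J \<omega>)\<^sup>2) \<partial>N)" for J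
      by (rule nn_integral_cong_AE) (use \<Omega>'(2) in eventually_elim, simp add: W'_def)
    then show ?thesis using assms(15) u W'm[OF u] unfolding is_wiener_integral_def by simp
  qed
  show ?thesis
  proof (rule J1_weak_conv_lipschitz[OF M.prob_space_axioms N.prob_space_axioms])
    have b: "\<forall>\<^sub>F b::real in at_left 1. b \<in> {0<..<1}" by (rule eventually_at_left_real) simp
    then show "\<forall>\<^sub>F b in at_left 1. continuous_version M (\<lambda>u \<omega>. sqrt (1 - b\<^sup>2) * discounted_series \<xi>s \<eta>s b u \<omega>) (P.walk_series \<Omega> (- ln b))"
      by eventually_elim (rule P.discounted_series_version[OF \<Omega>], auto)
    show "continuous_version N (\<lambda>u \<omega>. sqrt (2 * s\<^sup>2 / \<mu>) * W u \<omega>) (\<lambda>u \<omega>. \<sigma> * W' u \<omega>)"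
      unfolding continuous_version_def
    proof (intro conjI allI impI ballI)
      show "AE \<omega> in N. \<forall>u>0. sqrt (2 * s\<^sup>2 / \<mu>) * W u \<omega> = \<sigma> * W' u \<omega>"
        using \<Omega>'(2) by eventually_elim (simp add: W'_def \<sigma>_def)
    qed (auto intro!: continuous_intros W'c borel_measurable_times W'm)
    fix h :: "(real \<Rightarrow> real) \<Rightarrow> real" and L K
    assume h: "path_lipschitz L h" "\<And>f. continuous_on {0<..} f \<Longrightarrow> \<bar>h f\<bar> \<le> K"
    have "((\<lambda>\<delta>. M.expectation (\<lambda>\<omega>. h (\<lambda>u. P.walk_series \<Omega> \<delta> u \<omega>))) \<longlongrightarrow> N.expectation (\<lambda>\<omega>. h (\<lambda>u. \<sigma> * W' u \<omega>))) (at_right 0)"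
    proof (rule iterated_approximation_limit)
      show "\<forall>\<^sub>F m in sequentially. \<forall>\<^sub>F \<delta> in at_right 0. \<bar>M.expectation (\<lambda>\<omega>. h (\<lambda>u. P.walk_series \<Omega> \<delta> u \<omega>)) -
          M.expectation (\<lambda>\<omega>. h (\<lambda>u. P.block_series m \<delta> u \<omega>))\<bar> \<le> e" if "e > 0" for e
        by (rule P.walk_series_block_series_close[OF \<Omega> h that])
      show "((\<lambda>\<delta>. M.expectation (\<lambda>\<omega>. h (\<lambda>u. P.block_series m \<delta> u \<omega>))) \<longlongrightarrow>
          N.expectation (\<lambda>\<omega>. h (\<lambda>u. \<sigma> * bm_blocks B m u \<omega>))) (at_right 0)" if "m \<ge> 1" for m
        unfolding \<sigma>_def by (rule P.block_series_weak_convergence[OF that assms(13) h BM])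
      show "\<forall>\<^sub>F m in sequentially. \<bar>N.expectation (\<lambda>\<omega>. h (\<lambda>u. \<sigma> * bm_blocks B m u \<omega>)) -
          N.expectation (\<lambda>\<omega>. h (\<lambda>u. \<sigma> * W' u \<omega>))\<bar> \<le> e" if "e > 0" for e
        by (rule bm_blocks_weak_convergence[OF BM W'w W'c h that]) (auto simp: \<sigma>_def assms(8) less_imp_le)
    qed
    moreover have "filterlim (\<lambda>b::real. - ln b) (at_right 0) (at_left 1)" by real_asymp
    ultimately show "((\<lambda>b. M.expectation (\<lambda>\<omega>. h (\<lambda>u. P.walk_series \<Omega> (- ln b) u \<omega>))) \<longlongrightarrow>
        N.expectation (\<lambda>\<omega>. h (\<lambda>u. \<sigma> * W' u \<omega>))) (at_left 1)"
      by (rule filterlim_compose)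
  qed
qed

end
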